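(* Let $X$ be a compact real manifold of dimension $2n$, let $(\mathcal{J}_0,\mathcal{J}_1)$ be a generalized Kähler structure on $X$, and let $M\subset X$ be a submanifold of dimension $2m$ with conormal bundle $N^*\subset T^*X|_M$. If $M$ admits a $\mathcal{J}_0$-invariant conormal bundle, i.e. $\mathcal{J}_0(N^* )=N^*$, then $M$ is also a $\mathcal{J}_1$-submanifold, and $M$ inherits the induced generalized Kähler structure $(\mathcal{J}_{0,M},\mathcal{J}_{1,M})$.
   Context: Generalized complex structures: $\langle\,,\,\rangle$ is the natural symmetric pairing on $TX\oplus T^*X$, $\pi:TX\oplus T^*X\to TX$ the projection. An almost generalized complex structure is a section $\mathcal{J}$ of $SO(TX\oplus T^*X)$ with $\mathcal{J}^2=-\mathrm{id}$; $L_{\mathcal{J}}\subset(TX\oplus T^*X)^{\mathbb{C}}$ is its $(-\sqrt{-1})$-eigenbundle. It is a generalized complex structure if $L_{\mathcal{J}}$ is involutive for the Courant bracket $[v_1+\theta^1,v_2+\theta^2]_c=[v_1,v_2]+\frac12\{\mathcal{L}_{v_1}\theta^2-\mathcal{L}_{v_2}\theta^1-i_{v_2}d\theta^1+i_{v_1}d\theta^2\}$. $\mathcal{J}$-submanifolds: for a submanifold $i_M:M\to X$, let $p=\mathrm{id}_{TM}\oplus i_M^*:TM\oplus T^*X|_M\to TM\oplus T^*M$, whose kernel is the conormal bundle $N^*$. Put $L_{\mathcal{J}}(M)=L_{\mathcal{J}}\cap(TM\oplus T^*X|_M)^{\mathbb{C}}$ and $L_{\mathcal{J}}(N^* )=L_{\mathcal{J}}\cap(N^*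 )^{\mathbb{C}}$, assumed to be subbundles, and let $q$ be the restriction of (the complexification of) $p$ to $L_{\mathcal{J}}(M)\oplus\overline{L}_{\mathcal{J}}(M)$. $M$ is a $\mathcal{J}$-submanifold if $$0\to L_{\mathcal{J}}(N^* )\oplus\overline{L}_{\mathcal{J}}(N^* )\to L_{\mathcal{J}}(M)\oplus\overline{L}_{\mathcal{J}}(M)\xrightarrow{q}(TM\oplus T^*M)^{\mathbb{C}}\to0$$ is exact. In that case, since the first two bundles are $\mathcal{J}$-invariant, the quotient $TM\oplus T^*M$ carries an induced generalized complex structure $\mathcal{J}_M$, with $(-\sqrt{-1})$-eigenbundle $q(L_{\mathcal{J}}(M))$. (If $\mathcal{J}(N^* )=N^*$, then $M$ is a $\mathcal{J}$-submanifold.) For $\mathcal{J}=\mathcal{J}_i$ the induced structure is written $\mathcal{J}_{i,M}$. Generalized Kähler structures: a generalized metric is a section $\hat G$ of $SO(TX\oplus T^*X)$ with $\hat G^2=\mathrm{id}$ such that $G(E_1,E_2)=\langle\hat GE_1,E_2\rangle$ is positive-definite. A generalized Kähler structure is a pair $(\mathcal{J}_0,\mathcal{J}_1)$ of commuting generalized complex structures such that $-\mathcal{J}_0\mathcal{J}_1=-\mathcal{J}_1\mathcal{J}_0$ is a generalized metric. *)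

theory Defs
  imports
    "HOL-Analysis.Analysis"
    "Jordan_Normal_Form.Determinant"
begin

section \<open>Model spaces and smooth maps\<close>

text \<open>Manifolds are modelled on finite-dimensional inner product spaces. The class
  \<open>euclidean_space\<close> would exclude dimension 0, hence in particular submanifolds that are
  discrete sets of points.\<close>

class fin_dim_inner = real_inner +
  assumes finite_generators: "\<exists>B. finite B \<and> (\<forall>x. \<exists>u. x = (\<Sum>b\<in>B. u b *\<^sub>R b))"

subclass (in euclidean_space) fin_dim_inner
proof
  show "\<exists>B. finite B \<and> (\<forall>x. \<exists>u. x = (\<Sum>b\<in>B. u b *\<^sub>R b))"
    using finite_Basis euclidean_representation[symmetric] by blast
qed

text \<open>Differentiability class \<open>C\<^sup>k\<close> on an open set \<open>S\<close>; since the domain is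
  finite-dimensional it is enough to iterate directional derivatives.\<close>

primrec Ck_on :: "nat \<Rightarrow> 'e::fin_dim_inner set \<Rightarrow> ('e \<Rightarrow> 'v::real_normed_vector) \<Rightarrow> bool" where
  "Ck_on 0 S f \<longleftrightarrow> continuous_on S f"
| "Ck_on (Suc k) S f \<longleftrightarrow>
     (\<forall>x\<in>S. f differentiable (at x)) \<and> (\<forall>v. Ck_on k S (\<lambda>x. frechet_derivative f (at x) v))"

definition smooth_on :: "'e::fin_dim_inner set \<Rightarrow> ('e \<Rightarrow> 'v::real_normed_vector) \<Rightarrow> bool" where
  "smooth_on S f \<longleftrightarrow> (\<forall>k. Ck_on k S f)"


section \<open>Smooth manifolds and embedded submanifolds\<close>

text \<open>A chart is a pair of its domain and its coordinate map; the values of the coordinate map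
  outside of the domain are irrelevant.\<close>

type_synonym ('a, 'e) chart = "'a set \<times> ('a \<Rightarrow> 'e)"

abbreviation dom_chart :: "('a, 'e) chart \<Rightarrow> 'a set" where
  "dom_chart c \<equiv> fst c"

abbreviation coord :: "('a, 'e) chart \<Rightarrow> 'a \<Rightarrow> 'e" where
  "coord c \<equiv> snd c"

definition coord_inv :: "('a, 'e) chart \<Rightarrow> 'e \<Rightarrow> 'a" where
  "coord_inv c = inv_into (dom_chart c) (coord c)"

definition is_chart :: "'a topology \<Rightarrow> ('a, 'e::fin_dim_inner) chart \<Rightarrow> bool" where
  "is_chart X c \<longleftrightarrow> openin X (dom_chart c) \<and> open (coord c ` dom_chart c) \<and>
     homeomorphic_map (subtopology X (dom_chart c)) (top_of_set (coord c ` dom_chart c)) (coord c)"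

text \<open>The model spaces of the two charts may differ: for a chart \<open>d\<close> of a submanifold and a
  chart \<open>c\<close> of the ambient manifold, \<open>transition d c\<close> is the coordinate expression
  of the inclusion map.\<close>

definition transition :: "('a, 'e) chart \<Rightarrow> ('a, 'f) chart \<Rightarrow> 'e \<Rightarrow> 'f" where
  "transition c c' = coord c' \<circ> coord_inv c"

definition smooth_transition ::
  "('a, 'e::fin_dim_inner) chart \<Rightarrow> ('a, 'e) chart \<Rightarrow> bool" where
  "smooth_transition c c' \<longleftrightarrow>
     smooth_on (coord c ` (dom_chart c \<inter> dom_chart c')) (transition c c')"

text \<open>\<open>A\<close> is a smooth structure, that is, a maximal smooth atlas.\<close>

definition smooth_manifold :: "'a topology \<Rightarrow> ('a, 'e::fin_dim_inner) chart set \<Rightarrow> bool" where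
  "smooth_manifold X A \<longleftrightarrow>
     Hausdorff_space X \<and> second_countable X \<and>
     (\<forall>c\<in>A. is_chart X c) \<and> (\<Union>c\<in>A. dom_chart c) = topspace X \<and>
     (\<forall>c\<in>A. \<forall>c'\<in>A. smooth_transition c c') \<and>
     (\<forall>c. is_chart X c \<and> (\<forall>c'\<in>A. smooth_transition c c' \<and> smooth_transition c' c) \<longrightarrow> c \<in> A)"

text \<open>The charts induced on a subset \<open>M\<close> by the slice charts of the ambient manifold, i.e. by
  the charts in which \<open>M\<close> is a linear subspace \<open>range \<iota>\<close>. They form an atlas (not a
  maximal one) of the submanifold \<open>M\<close>.\<close>

definition slice_charts ::
  "('a, 'e::fin_dim_inner) chart set \<Rightarrow> 'a set \<Rightarrow> ('a, 'f::fin_dim_inner) chart set" where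
  "slice_charts A M = {d. \<exists>c\<in>A. \<exists>\<iota>::'f \<Rightarrow> 'e. linear \<iota> \<and> inj \<iota> \<and>
     dom_chart d = dom_chart c \<inter> M \<and>
     coord c ` (dom_chart c \<inter> M) = coord c ` dom_chart c \<inter> range \<iota> \<and>
     (\<forall>p\<in>dom_chart d. coord c p = \<iota> (coord d p))}"

definition embedded_submanifold ::
  "'a topology \<Rightarrow> ('a, 'e::fin_dim_inner) chart set \<Rightarrow> 'a set \<Rightarrow> ('a, 'f::fin_dim_inner) chart set \<Rightarrow> bool"
  where
  "embedded_submanifold X A M B \<longleftrightarrow>
     M \<subseteq> topspace X \<and> B = slice_charts A M \<and> (\<Union>d\<in>B. dom_chart d) = M"

text \<open>The differential at \<open>p\<close>, from the tangent space in the chart \<open>c\<close> to the tangent space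
  in the chart \<open>c'\<close>, of the identity map (for two charts of one manifold), respectively of the
  inclusion map (for a chart \<open>c\<close> of a submanifold and a chart \<open>c'\<close> of the ambient manifold).\<close>

definition tangent_map ::
  "('a, 'e::fin_dim_inner) chart \<Rightarrow> ('a, 'f::fin_dim_inner) chart \<Rightarrow> 'a \<Rightarrow> 'e \<Rightarrow> 'f" where
  "tangent_map c c' p = frechet_derivative (transition c c') (at (coord c p))"


section \<open>The generalized tangent bundle\<close>

text \<open>Fibre of \<open>TX \<oplus> T\<^sup>*X\<close> as seen in a chart. A section of a bundle associated with
  \<open>TX \<oplus> T\<^sup>*X\<close> is given by its expressions in all charts of an atlas, which
  have to agree on overlaps.\<close>

type_synonym 'e gtan = "'e \<times> ('e \<Rightarrow>\<^sub>L real)"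

definition gpairing :: "'e::fin_dim_inner gtan \<Rightarrow> 'e gtan \<Rightarrow> real" where
  "gpairing E F = (blinfun_apply (snd E) (fst F) + blinfun_apply (snd F) (fst E)) / 2"

text \<open>\<open>E\<close>, in the chart \<open>c\<close>, and \<open>E'\<close>, in the chart \<open>c'\<close>, are the same element of the
  fibre over \<open>p\<close>: vectors are pushed forward and covectors are pulled back.\<close>

definition same_gtan ::
  "('a, 'e::fin_dim_inner) chart \<Rightarrow> ('a, 'e) chart \<Rightarrow> 'a \<Rightarrow> 'e gtan \<Rightarrow> 'e gtan \<Rightarrow> bool" where
  "same_gtan c c' p E E' \<longleftrightarrow> fst E' = tangent_map c c' p (fst E) \<and>
     (\<forall>w. blinfun_apply (snd E) w = blinfun_apply (snd E') (tangent_map c c' p w))"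

text \<open>The determinant of an endomorphism, computed from its matrix in a basis.\<close>

definition endo_has_det :: "('v::real_vector \<Rightarrow> 'v) \<Rightarrow> real \<Rightarrow> bool" where
  "endo_has_det K \<delta> \<longleftrightarrow> (\<exists>N (v::nat \<Rightarrow> 'v) a.
     inj_on v {..<N} \<and> independent (v ` {..<N}) \<and> Real_Vector_Spaces.span (v ` {..<N}) = UNIV \<and>
     (\<forall>j<N. K (v j) = (\<Sum>i<N. a i j *\<^sub>R v i)) \<and>
     Determinant.det (Matrix.mat N N (\<lambda>(i, j). a i j)) = \<delta>)"

text \<open>Expressions of fields of endomorphisms of \<open>TX \<oplus> T\<^sup>*X\<close>:
  \<open>J c p\<close> is the endomorphism at \<open>p \<in> dom_chart c\<close>, written in the chart \<open>c\<close>.\<close>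

type_synonym ('a, 'e) gendo = "('a, 'e) chart \<Rightarrow> 'a \<Rightarrow> 'e gtan \<Rightarrow> 'e gtan"

definition endo_section :: "('a, 'e::fin_dim_inner) chart set \<Rightarrow> ('a, 'e) gendo \<Rightarrow> bool" where
  "endo_section A J \<longleftrightarrow>
     (\<forall>c\<in>A. \<forall>p\<in>dom_chart c. linear (J c p)) \<and>
     (\<forall>c\<in>A. \<forall>E. smooth_on (coord c ` dom_chart c) (\<lambda>x. J c (coord_inv c x) E)) \<and>
     (\<forall>c\<in>A. \<forall>c'\<in>A. \<forall>p\<in>dom_chart c \<inter> dom_chart c'. \<forall>E E'.
        same_gtan c c' p E E' \<longrightarrow> same_gtan c c' p (J c p E) (J c' p E'))"

definition SO_section :: "('a, 'e::fin_dim_inner) chart set \<Rightarrow> ('a, 'e) gendo \<Rightarrow> bool" where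
  "SO_section A J \<longleftrightarrow> endo_section A J \<and>
     (\<forall>c\<in>A. \<forall>p\<in>dom_chart c.
        (\<forall>E F. gpairing (J c p E) (J c p F) = gpairing E F) \<and> endo_has_det (J c p) 1)"


section \<open>Complexification\<close>

text \<open>The complexification of a real vector space \<open>V\<close> is \<open>V \<times> V\<close>, where \<open>(a, b)\<close> stands
  for \<open>a + \<i> b\<close>. Consequently the complexification of a subspace \<open>W\<close> is \<open>W \<times> W\<close>.\<close>

definition cscale :: "complex \<Rightarrow> 'v::real_vector \<times> 'v \<Rightarrow> 'v \<times> 'v" where
  "cscale \<zeta> z = (Re \<zeta> *\<^sub>R fst z - Im \<zeta> *\<^sub>R snd z, Re \<zeta> *\<^sub>R snd z + Im \<zeta> *\<^sub>R fst z)"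

definition cconj :: "'v::real_vector \<times> 'v \<Rightarrow> 'v \<times> 'v" where
  "cconj z = (fst z, - snd z)"

definition cmap :: "('v \<Rightarrow> 'w) \<Rightarrow> 'v \<times> 'v \<Rightarrow> 'w \<times> 'w" where
  "cmap K = map_prod K K"

definition minus_i_eigenspace :: "('v::real_vector \<Rightarrow> 'v) \<Rightarrow> ('v \<times> 'v) set" where
  "minus_i_eigenspace K = {z. cmap K z = cscale (- \<i>) z}"

definition plus_conj :: "('v::real_vector \<times> 'v) set \<Rightarrow> ('v \<times> 'v) set" where
  "plus_conj L = {z + cconj w | z w. z \<in> L \<and> w \<in> L}"


section \<open>The Courant bracket in coordinates\<close>

definition lie_bracket ::
  "('e::fin_dim_inner \<Rightarrow> 'e) \<Rightarrow> ('e \<Rightarrow> 'e) \<Rightarrow> 'e \<Rightarrow> 'e" where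
  "lie_bracket v w x = frechet_derivative w (at x) (v x) - frechet_derivative v (at x) (w x)"

definition lie_deriv_form ::
  "('e::fin_dim_inner \<Rightarrow> 'e) \<Rightarrow> ('e \<Rightarrow> ('e \<Rightarrow>\<^sub>L real)) \<Rightarrow> 'e \<Rightarrow> 'e \<Rightarrow> real" where
  "lie_deriv_form v \<theta> x w =
     blinfun_apply (frechet_derivative \<theta> (at x) (v x)) w
     + blinfun_apply (\<theta> x) (frechet_derivative v (at x) w)"

definition ext_deriv :: "('e::fin_dim_inner \<Rightarrow> ('e \<Rightarrow>\<^sub>L real)) \<Rightarrow> 'e \<Rightarrow> 'e \<Rightarrow> 'e \<Rightarrow> real" where
  "ext_deriv \<theta> x u w =
     blinfun_apply (frechet_derivative \<theta> (at x) u) w - blinfun_apply (frechet_derivative \<theta> (at x) w) u"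

definition courant ::
  "('e::fin_dim_inner \<Rightarrow> 'e gtan) \<Rightarrow> ('e \<Rightarrow> 'e gtan) \<Rightarrow> 'e \<Rightarrow> 'e gtan" where
  "courant s t x =
     (let v1 = fst \<circ> s; \<theta>1 = snd \<circ> s; v2 = fst \<circ> t; \<theta>2 = snd \<circ> t in
       (lie_bracket v1 v2 x,
        Blinfun (\<lambda>w. (lie_deriv_form v1 \<theta>2 x w - lie_deriv_form v2 \<theta>1 x w
                      - ext_deriv \<theta>1 x (v2 x) w + ext_deriv \<theta>2 x (v1 x) w) / 2)))"

definition ccourant ::
  "('e::fin_dim_inner \<Rightarrow> 'e gtan \<times> 'e gtan) \<Rightarrow> ('e \<Rightarrow> 'e gtan \<times> 'e gtan) \<Rightarrow> 'e \<Rightarrow> 'e gtan \<times> 'e gtan"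
  where
  "ccourant s t x =
     (courant (fst \<circ> s) (fst \<circ> t) x - courant (snd \<circ> s) (snd \<circ> t) x,
      courant (fst \<circ> s) (snd \<circ> t) x + courant (snd \<circ> s) (fst \<circ> t) x)"


section \<open>Generalized complex and generalized Kaehler structures\<close>

definition L_bundle :: "('a, 'e::fin_dim_inner) gendo \<Rightarrow> ('a, 'e) chart \<Rightarrow> 'a \<Rightarrow> ('e gtan \<times> 'e gtan) set"
  where
  "L_bundle J c p = minus_i_eigenspace (J c p)"

definition almost_generalized_complex ::
  "('a, 'e::fin_dim_inner) chart set \<Rightarrow> ('a, 'e) gendo \<Rightarrow> bool" where
  "almost_generalized_complex A J \<longleftrightarrow> SO_section A J \<and>
     (\<forall>c\<in>A. \<forall>p\<in>dom_chart c. \<forall>E. J c p (J c p E) = - E)"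

text \<open>Involutivity refers to smooth local sections, on the open sets of the charts.\<close>

definition courant_involutive :: "('a, 'e::fin_dim_inner) chart set \<Rightarrow> ('a, 'e) gendo \<Rightarrow> bool" where
  "courant_involutive A J \<longleftrightarrow>
     (\<forall>c\<in>A. \<forall>U s t. open U \<and> U \<subseteq> coord c ` dom_chart c \<and> smooth_on U s \<and> smooth_on U t \<and>
        (\<forall>x\<in>U. s x \<in> L_bundle J c (coord_inv c x) \<and> t x \<in> L_bundle J c (coord_inv c x)) \<longrightarrow>
        (\<forall>x\<in>U. ccourant s t x \<in> L_bundle J c (coord_inv c x)))"

definition generalized_complex :: "('a, 'e::fin_dim_inner) chart set \<Rightarrow> ('a, 'e) gendo \<Rightarrow> bool" where
  "generalized_complex A J \<longleftrightarrow> almost_generalized_complex A J \<and> courant_involutive A J"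

definition generalized_metric :: "('a, 'e::fin_dim_inner) chart set \<Rightarrow> ('a, 'e) gendo \<Rightarrow> bool" where
  "generalized_metric A G \<longleftrightarrow> SO_section A G \<and>
     (\<forall>c\<in>A. \<forall>p\<in>dom_chart c.
        (\<forall>E. G c p (G c p E) = E) \<and> (\<forall>E. E \<noteq> 0 \<longrightarrow> gpairing (G c p E) E > 0))"

definition generalized_Kaehler ::
  "('a, 'e::fin_dim_inner) chart set \<Rightarrow> ('a, 'e) gendo \<Rightarrow> ('a, 'e) gendo \<Rightarrow> bool" where
  "generalized_Kaehler A J0 J1 \<longleftrightarrow>
     generalized_complex A J0 \<and> generalized_complex A J1 \<and>
     (\<forall>c\<in>A. \<forall>p\<in>dom_chart c. \<forall>E. J0 c p (J1 c p E) = J1 c p (J0 c p E)) \<and>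
     generalized_metric A (\<lambda>c p E. - J0 c p (J1 c p E))"


section \<open>Generalized complex submanifolds\<close>

text \<open>In this section \<open>d\<close> is a chart of the submanifold \<open>M\<close> and \<open>c\<close> is a chart of the ambient
  manifold, both around \<open>p \<in> M\<close>. The fibre of \<open>TM \<oplus> T\<^sup>*X|M\<close> over \<open>p\<close>, the conormal
  space and the map \<open>id \<oplus> i\<^sub>M\<^sup>*\<close> are written in these charts.\<close>

definition TM_cotX ::
  "('a, 'f::fin_dim_inner) chart \<Rightarrow> ('a, 'e::fin_dim_inner) chart \<Rightarrow> 'a \<Rightarrow> 'e gtan set" where
  "TM_cotX d c p = {E. fst E \<in> range (tangent_map d c p)}"

definition conormal ::
  "('a, 'f::fin_dim_inner) chart \<Rightarrow> ('a, 'e::fin_dim_inner) chart \<Rightarrow> 'a \<Rightarrow> 'e gtan set" where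
  "conormal d c p = {E. fst E = 0 \<and> (\<forall>u. blinfun_apply (snd E) (tangent_map d c p u) = 0)}"

definition p_map ::
  "('a, 'f::fin_dim_inner) chart \<Rightarrow> ('a, 'e::fin_dim_inner) chart \<Rightarrow> 'a \<Rightarrow> 'e gtan \<Rightarrow> 'f gtan" where
  "p_map d c p E = (inv_into UNIV (tangent_map d c p) (fst E), snd E o\<^sub>L Blinfun (tangent_map d c p))"

definition L_tan ::
  "('a, 'e::fin_dim_inner) gendo \<Rightarrow> ('a, 'f::fin_dim_inner) chart \<Rightarrow> ('a, 'e) chart \<Rightarrow> 'a
    \<Rightarrow> ('e gtan \<times> 'e gtan) set" where
  "L_tan J d c p = L_bundle J c p \<inter> (TM_cotX d c p \<times> TM_cotX d c p)"

definition L_con ::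
  "('a, 'e::fin_dim_inner) gendo \<Rightarrow> ('a, 'f::fin_dim_inner) chart \<Rightarrow> ('a, 'e) chart \<Rightarrow> 'a
    \<Rightarrow> ('e gtan \<times> 'e gtan) set" where
  "L_con J d c p = L_bundle J c p \<inter> (conormal d c p \<times> conormal d c p)"

text \<open>A family \<open>F\<close> of subsets of the fibres of \<open>(TX \<oplus> T\<^sup>*X|M)\<^sup>\<complex>\<close>
  is a smooth complex subbundle if it has smooth local frames over \<open>M\<close>; that
  \<open>s 0, \<dots>, s (k - 1)\<close> is a frame is expressed by the bijectivity of the map that forms linear
  combinations.\<close>

definition complex_subbundle ::
  "('a, 'e::fin_dim_inner) chart set \<Rightarrow> ('a, 'f::fin_dim_inner) chart set
    \<Rightarrow> (('a, 'f) chart \<Rightarrow> ('a, 'e) chart \<Rightarrow> 'a \<Rightarrow> ('e gtan \<times> 'e gtan) set) \<Rightarrow> bool" where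
  "complex_subbundle A B F \<longleftrightarrow>
     (\<forall>c\<in>A. \<forall>d\<in>B. \<forall>p\<in>dom_chart c \<inter> dom_chart d.
        \<exists>V (k::nat) (s :: nat \<Rightarrow> 'f \<Rightarrow> 'e gtan \<times> 'e gtan).
          open V \<and> coord d p \<in> V \<and> V \<subseteq> coord d ` (dom_chart c \<inter> dom_chart d) \<and>
          (\<forall>j<k. smooth_on V (s j)) \<and>
          (\<forall>x\<in>V. bij_betw (\<lambda>a. \<Sum>j<k. cscale (a j) (s j x))
             ({..<k} \<rightarrow>\<^sub>E UNIV) (F d c (coord_inv d x))))"

text \<open>The last two conditions express the exactness of
  \<open>0 \<rightarrow> L(N\<^sup>*) \<oplus> conj L(N\<^sup>*) \<rightarrow> L(M) \<oplus> conj L(M) \<rightarrow> (TM \<oplus> T\<^sup>*M)\<^sup>\<complex> \<rightarrow> 0\<close>;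
  the first map is an inclusion.\<close>

definition J_submanifold ::
  "('a, 'e::fin_dim_inner) chart set \<Rightarrow> ('a, 'f::fin_dim_inner) chart set \<Rightarrow> ('a, 'e) gendo \<Rightarrow> bool"
  where
  "J_submanifold A B J \<longleftrightarrow>
     complex_subbundle A B (L_tan J) \<and> complex_subbundle A B (L_con J) \<and>
     (\<forall>c\<in>A. \<forall>d\<in>B. \<forall>p\<in>dom_chart c \<inter> dom_chart d.
        {z \<in> plus_conj (L_tan J d c p). cmap (p_map d c p) z = 0} = plus_conj (L_con J d c p) \<and>
        cmap (p_map d c p) ` plus_conj (L_tan J d c p) = UNIV)"

text \<open>For a \<open>J\<close>-submanifold, \<open>induced_gendo A J\<close> is the endomorphism induced by \<open>J\<close> on
  the quotient \<open>TM \<oplus> T\<^sup>*M\<close> of the exact sequence; its value is meaningful only in the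
  charts of \<open>M\<close>.\<close>

definition induced_gendo ::
  "('a, 'e::fin_dim_inner) chart set \<Rightarrow> ('a, 'e) gendo \<Rightarrow> ('a, 'f::fin_dim_inner) gendo" where
  "induced_gendo A J d p = (THE K. linear K \<and>
     (\<forall>c\<in>A. p \<in> dom_chart c \<longrightarrow> (\<forall>z \<in> plus_conj (L_tan J d c p).
        cmap K (cmap (p_map d c p) z) = cmap (p_map d c p) (cmap (J c p) z))))"

end

theory Submission
  imports Defs
begin

text \<open>
  Write \<open>W = TM \<oplus> T\<^sup>*X|M\<close>, \<open>N = N\<^sup>*\<close> and \<open>G = - J\<^sub>0 J\<^sub>1\<close>, all at a point of \<open>M\<close>. The pairing
  vanishes on \<open>N \<times> W\<close>, and \<open>W\<close> is the full orthogonal space of \<open>N\<close>. Hence \<open>J\<^sub>0 N = N\<close> gives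
  \<open>J\<^sub>0 W = W\<close>, and since \<open>G\<close> is positive definite, \<open>W\<close> is the direct sum of \<open>N\<close> and of its
  \<open>G\<close>-orthogonal complement \<open>V\<close> in \<open>W\<close>. As \<open>J\<^sub>1\<close> is skew and \<open>J\<^sub>0 N = N\<close>,
  this complement is \<open>V = {E \<in> W. J\<^sub>1 E \<in> W}\<close>: it is invariant under \<open>J\<^sub>1\<close>, and under \<open>J\<^sub>0\<close> because
  \<open>J\<^sub>0\<close> and \<open>J\<^sub>1\<close> commute. The projection \<open>p\<close> has kernel \<open>N\<close> on \<open>W\<close> and preserves the
  pairing, so it maps \<open>V\<close> isometrically onto \<open>TM \<oplus> T\<^sup>*M\<close>. Transporting the pair \<open>(J\<^sub>0, J\<^sub>1)\<close> from
  \<open>V\<close> along this isometry yields the induced pair together with all its algebraic properties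
  (locale \<open>kaehler_fibre\<close>). The space \<open>L(M) \<oplus> conj L(M)\<close> is the complexification of the largest
  \<open>J\<close>-invariant subspace of \<open>W\<close> (lemma \<open>plus_conj_eigenspace\<close>), which is \<open>W\<close> for \<open>J\<^sub>0\<close> and \<open>V\<close> for
  \<open>J\<^sub>1\<close>; exactness of both sequences follows (locale \<open>reduction\<close>).

  In a slice chart \<open>W\<close> and \<open>N\<close> are constant and only \<open>V\<close> varies. Gram-Schmidt with
  respect to \<open>G\<close> provides a smooth projection onto \<open>V\<close> (lemma \<open>smooth_orthogonal_projection\<close>), hence
  the smoothness of the induced pair. A smooth family of projections has local frames
  (lemma \<open>smooth_projection_frame\<close>), and these are carried from slice charts to all charts by the
  isomorphisms between the expressions of a fibre.

  For involutivity, a section of the eigenbundle of an induced structure is lifted to \<open>V\<close>, extended to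
  the ambient chart constantly along a complement of \<open>M\<close>, and projected to the eigenbundle of the ambient
  structure. The Courant bracket of two such extensions lies in that eigenbundle, and it restricts to the
  bracket of the given sections (lemma \<open>courant_restrict\<close>).

  The determinants are 1 for a purely algebraic reason
  (lemma \<open>endo_has_det_complex_structures\<close>).\<close>

section \<open>Finite-dimensional normed spaces\<close>

text \<open>The fibre \<open>'e \<times> ('e \<Rightarrow>\<^sub>L real)\<close> is a normed space without an inner product, so the expansion in
  a finite frame replaces that in an orthonormal basis. As the coordinate functionals are bounded by
  assumption, every linear map on such a space is bounded. The functionals are described in elementary
  terms because the type of a class parameter cannot carry the sort of \<open>bounded_linear\<close>.\<close>

class fin_dim_normed = real_normed_vector +
  assumes bounded_frame: "\<exists>(n::nat) b c K.
    (\<forall>i<n. (\<forall>x y. c i (x + y) = c i x + c i y) \<and> (\<forall>r x. c i (r *\<^sub>R x) = r * c i x) \<and>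
       (\<forall>x. \<bar>c i x\<bar> \<le> norm x * K)) \<and>
    (\<forall>x. x = (\<Sum>i<n. c i x *\<^sub>R b i))"

lemma finite_frame:
  "\<exists>(n::nat) b c. (\<forall>i<n. bounded_linear (c i)) \<and> (\<forall>x::'v::fin_dim_normed. x = (\<Sum>i<n. c i x *\<^sub>R b i))"
proof -
  obtain n b K and c :: "nat \<Rightarrow> 'v \<Rightarrow> real" where c: "\<forall>i<(n::nat). (\<forall>x y. c i (x + y) = c i x + c i y) \<and>
      (\<forall>r x. c i (r *\<^sub>R x) = r * c i x) \<and> (\<forall>x. \<bar>c i x\<bar> \<le> norm x * K)"
    and x: "\<forall>x. x = (\<Sum>i<n. c i x *\<^sub>R b i)"
    using bounded_frame[where 'a = 'v] by (elim exE conjE) (rule that)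
  have "\<forall>i<n. bounded_linear (c i)"
    using c by (auto intro!: bounded_linear_intro[where K=K])
  with x show ?thesis by blast
qed

text \<open>The frames of products and of spaces of operators are indexed by sums and products of
  index sets.\<close>

lemma bounded_frame_reindex:
  fixes c :: "'i \<Rightarrow> 'v::real_normed_vector \<Rightarrow> real"
  assumes I: "finite I" and c: "\<And>i. i \<in> I \<Longrightarrow> bounded_linear (c i)"
    and b: "\<And>x. x = (\<Sum>i\<in>I. c i x *\<^sub>R b i)"
  shows "\<exists>(n::nat) b c K.
    (\<forall>i<n. (\<forall>x y. c i (x + y) = c i x + c i y) \<and> (\<forall>r x. c i (r *\<^sub>R x) = r * c i x) \<and>
       (\<forall>x. \<bar>c i x\<bar> \<le> norm x * K)) \<and>
    (\<forall>x::'v. x = (\<Sum>i<n. c i x *\<^sub>R b i))"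
proof -
  obtain h where h: "bij_betw h {..<card I} I"
    using ex_bij_betw_nat_finite[OF I] by (metis atLeast0LessThan)
  have hI: "h i \<in> I" if "i < card I" for i
    using h that by (auto simp: bij_betw_def)
  have "\<exists>K. \<forall>i\<in>I. \<exists>k. k \<le> K \<and> (\<forall>x. \<bar>c i x\<bar> \<le> norm x * k)"
    using I c
  proof (induction I rule: finite_induct)
    case (insert i I)
    then obtain K where K: "\<forall>i\<in>I. \<exists>k. k \<le> K \<and> (\<forall>x. \<bar>c i x\<bar> \<le> norm x * k)" by auto
    obtain k where "\<forall>x. \<bar>c i x\<bar> \<le> norm x * k"
      using bounded_linear.bounded[OF insert.prems[of i]] by auto
    then show ?case
      using K by (intro exI[of _ "max k K"]) (metis insert_iff max.cobounded1 max.coboundedI2)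
  qed simp
  then obtain K where K: "\<And>i x. i \<in> I \<Longrightarrow> \<bar>c i x\<bar> \<le> norm x * K"
    by (meson mult_left_mono norm_ge_zero order_trans)
  have "x = (\<Sum>i<card I. c (h i) x *\<^sub>R b (h i))" for x
    using b[of x] sum.reindex_bij_betw[OF h, of "\<lambda>i. c i x *\<^sub>R b i"] by simp
  moreover have "linear (c (h i))" if "i < card I" for i
    using c[OF hI[OF that]] by (rule bounded_linear.linear)
  ultimately show ?thesis
    using K hI by (intro exI[of _ "card I"] exI[of _ "\<lambda>i. b (h i)"] exI[of _ "\<lambda>i. c (h i)"] exI[of _ K])
      (auto simp: linear_add linear_cmul)
qed

lemma linear_imp_bounded_linear:
  fixes f :: "'v::fin_dim_normed \<Rightarrow> 'w::real_normed_vector"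
  assumes "linear f"
  shows "bounded_linear f"
proof -
  obtain n b c where c: "\<forall>i<(n::nat). bounded_linear (c i)"
    and x: "\<forall>x::'v. x = (\<Sum>i<n. c i x *\<^sub>R b i)"
    using finite_frame by blast
  have f: "f x = (\<Sum>i<n. c i x *\<^sub>R f (b i))" for x
    by (subst x[rule_format, of x]) (simp add: linear_sum[OF assms] linear_cmul[OF assms])
  have "bounded_linear (\<lambda>x. \<Sum>i<n. c i x *\<^sub>R f (b i))"
    using c by (intro bounded_linear_sum bounded_linear_scaleR_const) auto
  then show ?thesis unfolding f[symmetric] .
qed

instance fin_dim_inner \<subseteq> fin_dim_normed
proof
  obtain B :: "'a set" where B: "finite B" "\<forall>x. \<exists>u. x = (\<Sum>b\<in>B. u b *\<^sub>R b)"
    using finite_generators by blast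
  have "x \<in> span B" for x :: 'a
  proof -
    obtain u where u: "x = (\<Sum>b\<in>B. u b *\<^sub>R b)" using B(2) by blast
    show ?thesis unfolding u by (intro span_sum span_scale span_base)
  qed
  obtain C where C: "finite C" "span C = span B" "pairwise Linear_Algebra.orthogonal C"
    using basis_orthogonal[OF B(1)] by blast
  \<comment> \<open>If \<open>0 \<in> C\<close>, its term vanishes, whatever the value of the quotient by 0.\<close>
  have "x = (\<Sum>b\<in>C. (inner x b / inner b b) *\<^sub>R b)" for x :: 'a
  proof -
    define y where "y = x - (\<Sum>b\<in>C. (inner x b / inner b b) *\<^sub>R b)"
    have "Linear_Algebra.orthogonal y a" if "a \<in> C" for a
    proof -
      have "(\<Sum>b\<in>C. (inner x b / inner b b) * (inner b a)) = (\<Sum>b\<in>C. if b = a then inner x a else 0)"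
        using C(3) that by (intro sum.cong) (auto simp: pairwise_def Linear_Algebra.orthogonal_def)
      then show ?thesis
        using C(1) that by (simp add: Linear_Algebra.orthogonal_def y_def inner_diff_left inner_sum_left)
    qed
    moreover have "y \<in> span C" using \<open>\<And>x. x \<in> span B\<close> C(2) by auto
    ultimately have "Linear_Algebra.orthogonal y y" by (metis orthogonal_to_span)
    then show ?thesis by (simp add: y_def Linear_Algebra.orthogonal_def)
  qed
  then show "\<exists>(n::nat) b c K.
    (\<forall>i<n. (\<forall>x y. c i (x + y) = c i x + c i y) \<and> (\<forall>r x. c i (r *\<^sub>R x) = r * c i x) \<and>
       (\<forall>x. \<bar>c i x\<bar> \<le> norm x * K)) \<and>
    (\<forall>x::'a. x = (\<Sum>i<n. c i x *\<^sub>R b i))"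
    by (intro bounded_frame_reindex[where I=C and c="\<lambda>b x. inner x b / inner b b" and b="\<lambda>b. b"] C(1)
        bounded_linear_compose[OF bounded_linear_divide bounded_linear_inner_left])
qed

instance prod :: (fin_dim_normed, fin_dim_normed) fin_dim_normed
proof
  obtain n b c where c: "\<forall>i<(n::nat). bounded_linear (c i)"
    and x: "\<forall>x::'a. x = (\<Sum>i<n. c i x *\<^sub>R b i)"
    using finite_frame by blast
  obtain m b' c' where c': "\<forall>i<(m::nat). bounded_linear (c' i)"
    and y: "\<forall>x::'b. x = (\<Sum>i<m. c' i x *\<^sub>R b' i)"
    using finite_frame by blast
  let ?b = "case_sum (\<lambda>i. (b i, 0)) (\<lambda>i. (0, b' i))"
  let ?c = "case_sum (\<lambda>i z. c i (fst z)) (\<lambda>i z. c' i (snd z)) :: _ \<Rightarrow> 'a \<times> 'b \<Rightarrow> real"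
  have "z = (\<Sum>i\<in>{..<n} <+> {..<m}. ?c i z *\<^sub>R ?b i)" for z
    using x[rule_format, of "fst z"] y[rule_format, of "snd z"]
    by (simp add: sum.Plus prod_eq_iff fst_sum snd_sum)
  moreover have fst: "bounded_linear (\<lambda>z::'a \<times> 'b. c i (fst z))" if "i < n" for i
    using c that by (intro bounded_linear_compose[OF _ bounded_linear_fst]) auto
  moreover have snd: "bounded_linear (\<lambda>z::'a \<times> 'b. c' i (snd z))" if "i < m" for i
    using c' that by (intro bounded_linear_compose[OF _ bounded_linear_snd]) auto
  ultimately show "\<exists>(n::nat) b c K.
    (\<forall>i<n. (\<forall>x y. c i (x + y) = c i x + c i y) \<and> (\<forall>r x. c i (r *\<^sub>R x) = r * c i x) \<and>
       (\<forall>x. \<bar>c i x\<bar> \<le> norm x * K)) \<and>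
    (\<forall>x::'a \<times> 'b. x = (\<Sum>i<n. c i x *\<^sub>R b i))"
    using fst snd by (intro bounded_frame_reindex[where I="{..<n} <+> {..<m}" and c="?c" and b="?b"]) auto
qed

text \<open>An operator \<open>L\<close> is the combination of the rank one operators \<open>v \<mapsto> c i v *\<^sub>R b' j\<close> with coefficients
  \<open>c' j (L (b i))\<close>.\<close>

instance blinfun :: (fin_dim_normed, fin_dim_normed) fin_dim_normed
proof
  obtain n b c where c: "\<forall>i<(n::nat). bounded_linear (c i)"
    and x: "\<forall>x::'a. x = (\<Sum>i<n. c i x *\<^sub>R b i)"
    using finite_frame by blast
  obtain m b' c' where c': "\<forall>i<(m::nat). bounded_linear (c' i)"
    and y: "\<forall>x::'b. x = (\<Sum>i<m. c' i x *\<^sub>R b' i)"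
    using finite_frame by blast
  let ?b = "\<lambda>(i, j). Blinfun (\<lambda>v. c i v *\<^sub>R b' j)"
  let ?c = "\<lambda>(i, j) L. c' j (blinfun_apply L (b i))"
  have app: "blinfun_apply (Blinfun (\<lambda>v. c i v *\<^sub>R b' j)) v = c i v *\<^sub>R b' j" if "i < n" for i j v
    using c that by (subst bounded_linear_Blinfun_apply) (auto intro: bounded_linear_scaleR_const)
  have "L = (\<Sum>i\<in>{..<n} \<times> {..<m}. ?c i L *\<^sub>R ?b i)" for L
  proof (rule blinfun_eqI)
    fix v
    have "blinfun_apply L v = (\<Sum>i<n. c i v *\<^sub>R blinfun_apply L (b i))"
      by (subst x[rule_format, of v]) (simp add: blinfun.sum_right blinfun.scaleR_right)
    also have "\<dots> = (\<Sum>i<n. c i v *\<^sub>R (\<Sum>j<m. c' j (blinfun_apply L (b i)) *\<^sub>R b' j))"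
      using y by auto
    also have "\<dots> = (\<Sum>(i, j)\<in>{..<n} \<times> {..<m}. (c' j (blinfun_apply L (b i)) * c i v) *\<^sub>R b' j)"
      by (simp add: sum.cartesian_product[symmetric] scaleR_sum_right mult.commute)
    also have "\<dots> = (\<Sum>p\<in>{..<n} \<times> {..<m}. ?c p L *\<^sub>R blinfun_apply (?b p) v)"
      by (intro sum.cong) (auto simp: app)
    finally show "blinfun_apply L v = blinfun_apply (\<Sum>i\<in>{..<n} \<times> {..<m}. ?c i L *\<^sub>R ?b i) v"
      by (simp add: blinfun.sum_left blinfun.scaleR_left)
  qed
  moreover have "bounded_linear (?c p)" if "p \<in> {..<n} \<times> {..<m}" for p
    using c' that by (auto intro!: bounded_linear_compose[OF _ blinfun.bounded_linear_left])
  ultimately show "\<exists>(n::nat) b c K.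
    (\<forall>i<n. (\<forall>x y. c i (x + y) = c i x + c i y) \<and> (\<forall>r x. c i (r *\<^sub>R x) = r * c i x) \<and>
       (\<forall>x. \<bar>c i x\<bar> \<le> norm x * K)) \<and>
    (\<forall>x::'a \<Rightarrow>\<^sub>L 'b. x = (\<Sum>i<n. c i x *\<^sub>R b i))"
    by (intro bounded_frame_reindex[where I="{..<n} \<times> {..<m}" and c="?c" and b="?b"]) auto
qed

lemma finite_spanning_set:
  "\<exists>B. finite B \<and> span B = (UNIV :: 'v::fin_dim_normed set)"
proof -
  obtain n b c where x: "\<forall>x::'v. x = (\<Sum>i<(n::nat). c i x *\<^sub>R b i)"
    using finite_frame by blast
  then have "x \<in> span (b ` {..<n})" for x
    by (subst x[rule_format, of x]) (intro span_sum span_scale span_base, auto)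
  then show ?thesis by blast
qed

section \<open>Smooth maps\<close>

lemma frechet_derivative_eqI:
  "(f has_derivative D) (at x) \<Longrightarrow> frechet_derivative f (at x) = D"
  using frechet_derivative_at by metis

lemma Ck_on_subset: "Ck_on k S f \<Longrightarrow> T \<subseteq> S \<Longrightarrow> Ck_on k T f"
  by (induction k arbitrary: f) (auto intro: continuous_on_subset)

lemma Ck_on_cong:
  assumes "open S" "\<And>x. x \<in> S \<Longrightarrow> f x = g x" "Ck_on k S f"
  shows "Ck_on k S g"
  using assms
proof (induction k arbitrary: f g)
  case 0
  then show ?case using continuous_on_cong by force
next
  case (Suc k)
  have d: "(g has_derivative frechet_derivative f (at x)) (at x)" if "x \<in> S" for x
  proof (rule has_derivative_transform_within_open[OF _ Suc.prems(1) that])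
    show "(f has_derivative frechet_derivative f (at x)) (at x)"
      using Suc.prems(3) that by (simp add: frechet_derivative_works)
  qed (use Suc.prems(2) in auto)
  show ?case
  proof (simp, intro conjI ballI allI)
    show "g differentiable (at x)" if "x \<in> S" for x using d[OF that] by (rule differentiableI)
    show "Ck_on k S (\<lambda>x. frechet_derivative g (at x) v)" for v
      using Suc.prems(3) frechet_derivative_eqI[OF d]
      by (intro Suc.IH[OF Suc.prems(1), of "\<lambda>x. frechet_derivative f (at x) v" "\<lambda>x. frechet_derivative g (at x) v"]) auto
  qed
qed

lemma Ck_on_SucI:
  assumes "open S" "\<And>x. x \<in> S \<Longrightarrow> (f has_derivative D x) (at x)" "\<And>v. Ck_on k S (\<lambda>x. D x v)"
  shows "Ck_on (Suc k) S f"
proof (simp, intro conjI ballI allI)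
  show "f differentiable (at x)" if "x \<in> S" for x using assms(2)[OF that] by (rule differentiableI)
  show "Ck_on k S (\<lambda>x. frechet_derivative f (at x) v)" for v
    by (rule Ck_on_cong[OF assms(1) _ assms(3)[of v]]) (simp add: frechet_derivative_eqI[OF assms(2)])
qed

lemma Ck_on_SucD: "Ck_on (Suc k) S f \<Longrightarrow> x \<in> S \<Longrightarrow> (f has_derivative frechet_derivative f (at x)) (at x)"
  by (simp add: frechet_derivative_works)

lemma Ck_on_Suc_imp: "Ck_on (Suc k) S f \<Longrightarrow> Ck_on k S f"
proof (induction k arbitrary: f)
  case 0
  then show ?case
    by (auto intro!: continuous_at_imp_continuous_on differentiable_imp_continuous_within)
qed auto

lemma Ck_on_const: "Ck_on k S (\<lambda>x. a)"
  by (induction k arbitrary: a) (auto simp: frechet_derivative_const)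

lemma Ck_on_bounded_linear:
  assumes "bounded_linear L" "open S" "Ck_on k S f"
  shows "Ck_on k S (\<lambda>x. L (f x))"
  using assms(3)
proof (induction k arbitrary: f)
  case 0
  then show ?case using assms(1) bounded_linear.continuous_on by auto
next
  case (Suc k)
  then show ?case
    by (intro Ck_on_SucI[OF assms(2) bounded_linear.has_derivative[OF assms(1) Ck_on_SucD[OF Suc.prems]]]) auto
qed

lemma Ck_on_add:
  assumes "open S" "Ck_on k S f" "Ck_on k S g"
  shows "Ck_on k S (\<lambda>x. f x + g x)"
  using assms(2,3)
proof (induction k arbitrary: f g)
  case 0
  then show ?case by (auto intro: continuous_on_add)
next
  case (Suc k)
  then show ?case
    by (intro Ck_on_SucI[OF assms(1) has_derivative_add[OF Ck_on_SucD[OF Suc.prems(1)] Ck_on_SucD[OF Suc.prems(2)]]]) auto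
qed

lemma Ck_on_sum:
  assumes "open S" "\<And>i. i \<in> I \<Longrightarrow> Ck_on k S (f i)"
  shows "Ck_on k S (\<lambda>x. \<Sum>i\<in>I. f i x)"
  using assms(2) by (induction I rule: infinite_finite_induct) (auto intro: Ck_on_const Ck_on_add assms(1))

lemma Ck_on_bilinear:
  assumes "bounded_bilinear h" "open S" "Ck_on k S f" "Ck_on k S g"
  shows "Ck_on k S (\<lambda>x. h (f x) (g x))"
  using assms(3,4)
proof (induction k arbitrary: f g)
  case 0
  then show ?case by (auto intro: bounded_bilinear.continuous_on[OF assms(1)])
next
  case (Suc k)
  note f = Suc.prems(1) and g = Suc.prems(2)
  show ?case
    using f g Ck_on_Suc_imp[OF f] Ck_on_Suc_imp[OF g]
    by (intro Ck_on_SucI[OF assms(2) bounded_bilinear.FDERIV[OF assms(1) Ck_on_SucD[OF f] Ck_on_SucD[OF g]]]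
         Ck_on_add[OF assms(2)] Suc.IH) auto
qed

lemma Ck_on_inverse:
  fixes f :: "_ \<Rightarrow> real"
  assumes "open S" "Ck_on k S f" "\<And>x. x \<in> S \<Longrightarrow> f x \<noteq> 0"
  shows "Ck_on k S (\<lambda>x. inverse (f x))"
  using assms(2)
proof (induction k)
  case 0
  then show ?case using assms(3) by (auto intro: continuous_on_inverse)
next
  case (Suc k)
  have i: "Ck_on k S (\<lambda>x. inverse (f x))" using Ck_on_Suc_imp Suc by blast
  have "((\<lambda>x. inverse (f x)) has_derivative
      (\<lambda>v. - (inverse (f x) * frechet_derivative f (at x) v * inverse (f x)))) (at x)" if "x \<in> S" for x
    using Ck_on_SucD[OF Suc.prems that] assms(3)[OF that] by (intro Deriv.has_derivative_inverse)
  moreover have "Ck_on k S (\<lambda>x. - (inverse (f x) * frechet_derivative f (at x) v * inverse (f x)))" for v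
    using Suc.prems i
    by (intro Ck_on_bounded_linear[OF bounded_linear_minus[OF bounded_linear_ident] assms(1)]
        Ck_on_bilinear[OF bounded_bilinear_mult assms(1)]) auto
  ultimately show ?case
    by (intro Ck_on_SucI[OF assms(1)])
qed

text \<open>The direction \<open>Dg x v\<close> of the outer derivative varies with \<open>x\<close>. Expanding it in a frame leaves derivatives
  of \<open>f\<close> in fixed directions, to which the induction hypothesis applies.\<close>

lemma Ck_on_compose:
  fixes f :: "'f::fin_dim_inner \<Rightarrow> 'v::real_normed_vector" and g :: "'e::fin_dim_inner \<Rightarrow> 'f"
  assumes "open S" "open T" "g ` S \<subseteq> T" "Ck_on k T f" "Ck_on k S g"
  shows "Ck_on k S (\<lambda>x. f (g x))"
  using assms(4,5)
proof (induction k arbitrary: f)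
  case 0
  then show ?case using assms(3) by (auto intro: continuous_on_compose2)
next
  case (Suc k)
  note f = Suc.prems(1) and g = Suc.prems(2)
  obtain n b c where c: "\<forall>i<(n::nat). bounded_linear (c i)"
    and x: "\<forall>x::'f. x = (\<Sum>i<n. c i x *\<^sub>R b i)"
    using finite_frame by blast
  let ?D = "\<lambda>x v. frechet_derivative f (at (g x)) (frechet_derivative g (at x) v)"
  have D: "((\<lambda>x. f (g x)) has_derivative ?D x) (at x)" if "x \<in> S" for x
    using has_derivative_compose[OF Ck_on_SucD[OF g that]] Ck_on_SucD[OF f] assms(3) that by blast
  have lin: "linear (frechet_derivative f (at (g x)))" if "x \<in> S" for x
    using Ck_on_SucD[OF f] assms(3) that by (blast intro: has_derivative_linear)
  have eq: "?D x v = (\<Sum>i<n. c i (frechet_derivative g (at x) v) *\<^sub>R frechet_derivative f (at (g x)) (b i))"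
    if "x \<in> S" for x v
    by (subst x[rule_format, of "frechet_derivative g (at x) v"])
      (simp add: linear_sum[OF lin[OF that]] linear_cmul[OF lin[OF that]])
  have "Ck_on k S (\<lambda>x. \<Sum>i<n. c i (frechet_derivative g (at x) v) *\<^sub>R frechet_derivative f (at (g x)) (b i))" for v
    using f g c Ck_on_Suc_imp[OF g]
    by (intro Ck_on_sum Ck_on_bilinear[OF bounded_bilinear_scaleR] assms(1) Suc.IH
         Ck_on_bounded_linear[of "c _"]) auto
  then have "Ck_on k S (\<lambda>x. ?D x v)" for v
    by (rule Ck_on_cong[OF assms(1), rotated]) (simp add: eq)
  with D show ?case by (intro Ck_on_SucI[OF assms(1)])
qed

lemma smooth_on_subset: "smooth_on S f \<Longrightarrow> T \<subseteq> S \<Longrightarrow> smooth_on T f"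
  unfolding smooth_on_def using Ck_on_subset by blast

lemma smooth_on_cong:
  "open S \<Longrightarrow> (\<And>x. x \<in> S \<Longrightarrow> f x = g x) \<Longrightarrow> smooth_on S f \<longleftrightarrow> smooth_on S g"
  unfolding smooth_on_def using Ck_on_cong[of S f g] Ck_on_cong[of S g f] by auto

lemma smooth_on_eqI:
  "open S \<Longrightarrow> smooth_on S g \<Longrightarrow> (\<And>x. x \<in> S \<Longrightarrow> f x = g x) \<Longrightarrow> smooth_on S f"
  using smooth_on_cong by blast

lemma smooth_on_const: "smooth_on S (\<lambda>x. a)"
  by (simp add: smooth_on_def Ck_on_const)

lemma smooth_on_add: "open S \<Longrightarrow> smooth_on S f \<Longrightarrow> smooth_on S g \<Longrightarrow> smooth_on S (\<lambda>x. f x + g x)"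
  by (simp add: smooth_on_def Ck_on_add)

lemma smooth_on_sum:
  "open S \<Longrightarrow> (\<And>i. i \<in> I \<Longrightarrow> smooth_on S (f i)) \<Longrightarrow> smooth_on S (\<lambda>x. \<Sum>i\<in>I. f i x)"
  by (simp add: smooth_on_def Ck_on_sum)

lemma smooth_on_linear:
  "linear (L :: 'v::fin_dim_normed \<Rightarrow> _) \<Longrightarrow> open S \<Longrightarrow> smooth_on S f \<Longrightarrow> smooth_on S (\<lambda>x. L (f x))"
  by (simp add: smooth_on_def Ck_on_bounded_linear linear_imp_bounded_linear)

lemma smooth_on_bilinear:
  "bounded_bilinear h \<Longrightarrow> open S \<Longrightarrow> smooth_on S f \<Longrightarrow> smooth_on S g \<Longrightarrow> smooth_on S (\<lambda>x. h (f x) (g x))"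
  by (simp add: smooth_on_def Ck_on_bilinear)

lemmas smooth_on_scaleR = smooth_on_bilinear[OF bounded_bilinear_scaleR]

lemma smooth_on_minus:
  assumes "open S" "smooth_on S f" shows "smooth_on S (\<lambda>x. - f x)"
  using smooth_on_scaleR[OF assms(1) smooth_on_const[of S "-1"] assms(2)] by simp

lemma smooth_on_diff: 
  assumes "open S" "smooth_on S f" "smooth_on S g" shows "smooth_on S (\<lambda>x. f x - g x)"
  using smooth_on_add[OF assms(1,2) smooth_on_minus[OF assms(1,3)]] by simp

lemma smooth_on_divide:
  fixes f g :: "_ \<Rightarrow> real"
  assumes "open S" "smooth_on S f" "smooth_on S g" "\<And>x. x \<in> S \<Longrightarrow> g x \<noteq> 0"
  shows "smooth_on S (\<lambda>x. f x / g x)"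
proof -
  have "smooth_on S (\<lambda>x. inverse (g x))"
    using assms by (simp add: smooth_on_def Ck_on_inverse)
  then show ?thesis
    using smooth_on_bilinear[OF bounded_bilinear_mult assms(1,2)] by (simp add: divide_inverse)
qed

lemma smooth_on_compose:
  fixes f :: "'f::fin_dim_inner \<Rightarrow> 'v::real_normed_vector" and g :: "'e::fin_dim_inner \<Rightarrow> 'f"
  shows "smooth_on T f \<Longrightarrow> smooth_on S g \<Longrightarrow> open S \<Longrightarrow> open T \<Longrightarrow> g ` S \<subseteq> T \<Longrightarrow> smooth_on S (\<lambda>x. f (g x))"
  by (simp add: smooth_on_def Ck_on_compose)

lemma smooth_on_frechet_derivative:
  "smooth_on S f \<Longrightarrow> smooth_on S (\<lambda>x. frechet_derivative f (at x) v)"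
  unfolding smooth_on_def by (metis Ck_on.simps(2))

lemma smooth_on_has_derivative:
  "smooth_on S f \<Longrightarrow> x \<in> S \<Longrightarrow> (f has_derivative frechet_derivative f (at x)) (at x)"
  unfolding smooth_on_def using Ck_on_SucD by blast

lemma smooth_on_continuous: "smooth_on S f \<Longrightarrow> continuous_on S f"
  unfolding smooth_on_def by (metis Ck_on.simps(1))

lemma smooth_on_ident: "smooth_on S (\<lambda>x. x)"
proof -
  have "Ck_on k S (\<lambda>x. x)" for k
    by (cases k) (auto simp: frechet_derivative_ident Ck_on_const continuous_on_id)
  then show ?thesis by (simp add: smooth_on_def)
qed

section \<open>Smooth families of linear maps\<close>

text \<open>Smoothness is required vector by vector, as in \<open>endo_section\<close>; on a finite-dimensional
  space this is smoothness of the family of operators.\<close>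

definition smooth_family ::
  "'e::fin_dim_inner set \<Rightarrow> ('e \<Rightarrow> 'v::real_normed_vector \<Rightarrow> 'w::real_normed_vector) \<Rightarrow> bool" where
  "smooth_family S A \<longleftrightarrow> (\<forall>x\<in>S. linear (A x)) \<and> (\<forall>v. smooth_on S (\<lambda>x. A x v))"

lemma smooth_familyI:
  "(\<And>x. x \<in> S \<Longrightarrow> linear (A x)) \<Longrightarrow> (\<And>v. smooth_on S (\<lambda>x. A x v)) \<Longrightarrow> smooth_family S A"
  by (simp add: smooth_family_def)

lemma smooth_family_linear: "smooth_family S A \<Longrightarrow> x \<in> S \<Longrightarrow> linear (A x)"
  by (simp add: smooth_family_def)

lemma smooth_family_subset: "smooth_family S A \<Longrightarrow> T \<subseteq> S \<Longrightarrow> smooth_family T A"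
  by (auto simp: smooth_family_def intro: smooth_on_subset)

lemma smooth_family_const: "linear L \<Longrightarrow> smooth_family S (\<lambda>x. L)"
  by (simp add: smooth_family_def smooth_on_const)

lemma smooth_family_apply:
  fixes A :: "'e::fin_dim_inner \<Rightarrow> 'v::fin_dim_normed \<Rightarrow> 'w::real_normed_vector"
  assumes "open S" "smooth_family S A" "smooth_on S s"
  shows "smooth_on S (\<lambda>x. A x (s x))"
proof -
  obtain n b c where c: "\<forall>i<(n::nat). bounded_linear (c i)"
    and v: "\<forall>v::'v. v = (\<Sum>i<n. c i v *\<^sub>R b i)"
    using finite_frame by blast
  have "A x (s x) = (\<Sum>i<n. c i (s x) *\<^sub>R A x (b i))" if "x \<in> S" for x
    using smooth_family_linear[OF assms(2) that]
    by (subst v[rule_format, of "s x"]) (simp add: linear_sum linear_cmul)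
  moreover have "smooth_on S (\<lambda>x. c i (s x) *\<^sub>R A x (b i))" if "i < n" for i
    using c that assms(2)
    by (intro smooth_on_scaleR[OF assms(1) smooth_on_linear[OF _ assms(1,3)]])
       (auto simp: smooth_family_def bounded_linear.linear)
  then have "smooth_on S (\<lambda>x. \<Sum>i<n. c i (s x) *\<^sub>R A x (b i))"
    by (intro smooth_on_sum assms(1)) auto
  ultimately show ?thesis by (rule smooth_on_eqI[OF assms(1), rotated])
qed

lemma smooth_family_compose:
  fixes A :: "'e::fin_dim_inner \<Rightarrow> 'v::fin_dim_normed \<Rightarrow> 'w::real_normed_vector"
  assumes "open S" "smooth_family S A" "smooth_family S B"
  shows "smooth_family S (\<lambda>x v. A x (B x v))"
proof (rule smooth_familyI)
  show "linear (\<lambda>v. A x (B x v))" if "x \<in> S" for x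
    using linear_compose[OF smooth_family_linear[OF assms(3) that] smooth_family_linear[OF assms(2) that]]
    by (simp add: o_def)
  show "smooth_on S (\<lambda>x. A x (B x v))" for v
    using assms(3) by (intro smooth_family_apply[OF assms(1,2)]) (auto simp: smooth_family_def)
qed

lemma smooth_family_add:
  "open S \<Longrightarrow> smooth_family S A \<Longrightarrow> smooth_family S B \<Longrightarrow> smooth_family S (\<lambda>x v. A x v + B x v)"
  by (simp add: smooth_family_def linear_compose_add smooth_on_add)

lemma smooth_family_diff:
  "open S \<Longrightarrow> smooth_family S A \<Longrightarrow> smooth_family S B \<Longrightarrow> smooth_family S (\<lambda>x v. A x v - B x v)"
  by (simp add: smooth_family_def linear_compose_sub smooth_on_diff)

lemma linear_cmap: "linear K \<Longrightarrow> linear (cmap K)"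
  by (auto simp: cmap_def linear_iff)

lemma smooth_family_cmap:
  fixes A :: "'e::fin_dim_inner \<Rightarrow> 'v::fin_dim_normed \<Rightarrow> 'w::fin_dim_normed"
  assumes "open S" "smooth_family S A"
  shows "smooth_family S (\<lambda>x. cmap (A x))"
proof (rule smooth_familyI)
  show "linear (cmap (A x))" if "x \<in> S" for x
    using smooth_family_linear[OF assms(2) that] by (rule linear_cmap)
  have "linear (\<lambda>w::'w. (w, 0 :: 'w))" "linear (\<lambda>w::'w. (0 :: 'w, w))" by (auto simp: linear_iff)
  then have "smooth_on S (\<lambda>x. (A x (fst v), 0) + (0, A x (snd v)))" for v
    using assms(2)
    by (intro smooth_on_add assms(1) smooth_on_linear[of "\<lambda>w. (w, 0)", OF _ assms(1)]
        smooth_on_linear[of "\<lambda>w. (0, w)", OF _ assms(1)])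
      (auto simp: smooth_family_def)
  then show "smooth_on S (\<lambda>x. cmap (A x) v)" for v
    by (simp add: cmap_def map_prod_def split_beta)
qed

text \<open>Gram-Schmidt without normalisation: one vector of \<open>B\<close> after the other is made
  orthogonal to the previous ones. The only division is by \<open>g x (e x) (e x) > 0\<close>, so smoothness in \<open>x\<close> is
  preserved in each step and no Gram matrix is inverted.\<close>

lemma smooth_orthogonal_projection:
  fixes g :: "'e::fin_dim_inner \<Rightarrow> 'v::fin_dim_normed \<Rightarrow> 'v \<Rightarrow> real"
  assumes S: "open S" and bil: "\<And>x. x \<in> S \<Longrightarrow> bilinear (g x)"
    and sym: "\<And>x u v. x \<in> S \<Longrightarrow> g x u v = g x v u"
    and pos: "\<And>x v. x \<in> S \<Longrightarrow> v \<noteq> 0 \<Longrightarrow> g x v v > 0"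
    and smooth: "\<And>u v. smooth_on S (\<lambda>x. g x u v)"
    and B: "finite B"
  shows "\<exists>P. smooth_family S P \<and>
    (\<forall>x\<in>S. \<forall>v. P x v \<in> span B \<and> (\<forall>n\<in>span B. g x n (v - P x v) = 0))"
  using B
proof (induction B rule: finite_induct)
  case empty
  show ?case
    by (intro exI[of _ "\<lambda>x v. 0"])
      (auto simp: smooth_family_const linear_zero bilinear_lzero[OF bil])
next
  case (insert b B)
  then obtain P where P: "smooth_family S P"
    and PB: "\<And>x v. x \<in> S \<Longrightarrow> P x v \<in> span B"
    and orth: "\<And>x v n. x \<in> S \<Longrightarrow> n \<in> span B \<Longrightarrow> g x n (v - P x v) = 0"
    by blast
  show ?case
  proof (cases "b \<in> span B")
    case True
    then have "span (insert b B) = span B" by (rule span_redundant)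
    with insert.IH show ?thesis by simp
  next
    case False
    define e where "e x = b - P x b" for x
    have e: "smooth_on S e"
      unfolding e_def using P by (intro smooth_on_diff S smooth_on_const) (simp add: smooth_family_def)
    have e0: "g x (e x) (e x) \<noteq> 0" if "x \<in> S" for x
      using False PB[OF that, of b] pos[OF that, of "e x"] unfolding e_def
      by (metis less_irrefl right_minus_eq)
    have ge: "smooth_on S (\<lambda>x. g x (e x) v)" for v
    proof (rule smooth_family_apply[OF S _ e])
      show "smooth_family S (\<lambda>x u. g x u v)"
        using bil smooth by (intro smooth_familyI) (auto simp: bilinear_def)
    qed
    have gee: "smooth_on S (\<lambda>x. g x (e x) (e x))"
    proof (rule smooth_family_apply[where A = "\<lambda>x. g x (e x)", OF S _ e])
      show "smooth_family S (\<lambda>x. g x (e x))"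
        using bil ge by (intro smooth_familyI) (auto simp: bilinear_def)
    qed
    define P' where "P' x v = P x v + (g x (e x) v / g x (e x) (e x)) *\<^sub>R e x" for x v
    have lin: "linear (\<lambda>v. g x (e x) v)" if "x \<in> S" for x
      using bil[OF that] by (simp add: bilinear_def)
    have "linear (P' x)" if "x \<in> S" for x
      using smooth_family_linear[OF P that] lin[OF that]
      by (auto simp: P'_def linear_iff algebra_simps add_divide_distrib)
    moreover have "smooth_on S (\<lambda>x. P' x v)" for v
      unfolding P'_def using P e0
      by (intro smooth_on_add S smooth_on_scaleR smooth_on_divide ge gee e) (auto simp: smooth_family_def)
    ultimately have "smooth_family S P'" by (rule smooth_familyI)
    moreover have "P' x v \<in> span (insert b B)" if "x \<in> S" for x v
    proof -
      have "P x w \<in> span (insert b B)" for w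
        using PB[OF that, of w] span_mono[of B "insert b B"] by blast
      moreover have "b \<in> span (insert b B)" by (simp add: span_base)
      ultimately show ?thesis
        unfolding P'_def e_def by (intro span_add span_scale span_diff)
    qed
    moreover have "g x n (v - P' x v) = 0" if x: "x \<in> S" and n: "n \<in> span (insert b B)" for x n v
    proof -
      note bl = bilinear_radd[OF bil[OF x]] bilinear_rsub[OF bil[OF x]] bilinear_rmul[OF bil[OF x]]
        bilinear_ladd[OF bil[OF x]] bilinear_lsub[OF bil[OF x]] bilinear_lmul[OF bil[OF x]]
      have span: "g x n' (v - P' x v) = 0" if n': "n' \<in> span B" for n'
      proof -
        have "g x n' (e x) = 0" unfolding e_def using orth[OF x n'] .
        then show ?thesis using orth[OF x n', of v] by (simp add: P'_def bl)
      qed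
      have "g x (e x) (P x v) = 0"
        using orth[OF x PB[OF x, of v], of b] sym[OF x] by (simp add: e_def)
      then have "g x (e x) (v - P' x v) = 0"
        using e0[OF x] by (simp add: P'_def bl)
      then have gb: "g x b (v - P' x v) = 0"
        using span[OF PB[OF x, of b]] by (simp add: e_def bl)
      obtain k where "n - k *\<^sub>R b \<in> span B" using n by (auto simp: span_insert)
      then have "g x (n - k *\<^sub>R b) (v - P' x v) = 0" by (rule span)
      then show ?thesis using gb by (simp add: bl)
    qed
    ultimately show ?thesis by blast
  qed
qed

section \<open>Frames of complex subbundles\<close>

lemma linear_inj_imp_surj_fin_dim:
  fixes f :: "'v::fin_dim_normed \<Rightarrow> 'v"
  assumes f: "linear f" and inj: "inj f"
  shows "surj f"
proof -
  obtain C :: "'v set" where C: "finite C" "span C = UNIV" using finite_spanning_set by blast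
  obtain B :: "'v set" where B: "independent B" "span B = UNIV"
    using basis_exists[of "UNIV :: 'v set"] by (metis top.extremum_uniqueI)
  have fin: "finite B" using independent_span_bound[OF C(1) B(1)] C(2) by simp
  have ind: "independent (f ` B)"
    using linear_independent_injective_image[OF f B(1)] inj inj_on_subset by blast
  have card: "card (f ` B) = card B" using inj by (metis card_image inj_on_subset subset_UNIV)
  have "y \<in> span (f ` B)" for y
  proof (rule ccontr)
    assume y: "y \<notin> span (f ` B)"
    then have "independent (insert y (f ` B))" "y \<notin> f ` B"
      using ind by (auto simp: independent_insert span_base)
    then show False
      using independent_span_bound[OF fin, of "insert y (f ` B)"] B(2) card fin by auto
  qed
  then show ?thesis by (metis linear_span_image[OF f] B(2) UNIV_eq_I)
qed

text \<open>The function \<open>h\<close> bounds the operator norm of \<open>A x - 1\<close>; it is continuous and vanishes at \<open>x0\<close>. Where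
  \<open>h < 1\<close>, the kernel of \<open>A x\<close> is trivial.\<close>

lemma smooth_family_bij_near_identity:
  fixes A :: "'e::fin_dim_inner \<Rightarrow> 'v::fin_dim_normed \<Rightarrow> 'v"
  assumes S: "open S" and A: "smooth_family S A" and x0: "x0 \<in> S" and id: "\<And>v. A x0 v = v"
  shows "\<exists>V. open V \<and> x0 \<in> V \<and> V \<subseteq> S \<and> (\<forall>x\<in>V. bij (A x))"
proof -
  obtain n b c where c: "\<forall>i<(n::nat). bounded_linear (c i)"
    and v: "\<forall>v::'v. v = (\<Sum>i<n. c i v *\<^sub>R b i)"
    using finite_frame by blast
  define h where "h x = (\<Sum>i<n. onorm (c i) * norm (A x (b i) - b i))" for x
  have "continuous_on S (\<lambda>x. A x v)" for v
    using A smooth_on_continuous by (auto simp: smooth_family_def)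
  then have "continuous_on S h"
    unfolding h_def
    by (intro continuous_on_sum continuous_on_mult continuous_on_const continuous_on_norm continuous_on_diff)
  then have "open (h -` {..<1} \<inter> S)"
    using continuous_on_open_vimage[OF S, of h] open_lessThan by auto
  moreover have "h x0 = 0" by (simp add: h_def id)
  moreover have "bij (A x)" if x: "x \<in> S" "h x < 1" for x
  proof -
    note lin = smooth_family_linear[OF A x(1)]
    have near: "norm (A x u - u) \<le> h x * norm u" for u
    proof -
      have "A x u - u = A x (\<Sum>i<n. c i u *\<^sub>R b i) - (\<Sum>i<n. c i u *\<^sub>R b i)"
        using v by metis
      also have "\<dots> = (\<Sum>i<n. c i u *\<^sub>R (A x (b i) - b i))"
        by (simp add: linear_sum[OF lin] linear_cmul[OF lin] sum_subtractf scaleR_diff_right)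
      finally have "norm (A x u - u) \<le> (\<Sum>i<n. norm (c i u *\<^sub>R (A x (b i) - b i)))"
        by (metis norm_sum)
      also have "\<dots> \<le> (\<Sum>i<n. onorm (c i) * norm (A x (b i) - b i) * norm u)"
      proof (intro sum_mono)
        fix i assume "i \<in> {..<n}"
        then have "\<bar>c i u\<bar> \<le> onorm (c i) * norm u" using onorm[of "c i" u] c by simp
        from mult_right_mono[OF this norm_ge_zero[of "A x (b i) - b i"]]
        show "norm (c i u *\<^sub>R (A x (b i) - b i)) \<le> onorm (c i) * norm (A x (b i) - b i) * norm u"
          by (simp add: mult_ac)
      qed
      finally show ?thesis by (simp add: h_def sum_distrib_right)
    qed
    have "u = 0" if "A x u = 0" for u
    proof (rule ccontr)
      assume "u \<noteq> 0"
      then have "h x * norm u < 1 * norm u" using x(2) by (intro mult_strict_right_mono) auto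
      moreover have "norm u \<le> h x * norm u" using near[of u] that by simp
      ultimately show False by simp
    qed
    then have "inj (A x)" using linear_injective_0[OF lin] by blast
    then show ?thesis using linear_inj_imp_surj_fin_dim[OF lin] by (simp add: bij_def)
  qed
  ultimately show ?thesis using x0 by (intro exI[of _ "h -` {..<1} \<inter> S"]) auto
qed

interpretation cvec: vector_space "cscale :: complex \<Rightarrow> 'v::real_vector \<times> 'v \<Rightarrow> 'v \<times> 'v"
  by unfold_locales (auto simp: cscale_def algebra_simps prod_eq_iff)

lemma linear_cscale: "linear (cscale \<zeta>)"
  by (auto simp: linear_iff cscale_def algebra_simps prod_eq_iff)

lemma complex_subspace_basis:
  fixes F :: "('v::fin_dim_normed \<times> 'v) set"
  assumes F: "cvec.subspace F"
  shows "\<exists>(k::nat) f. bij_betw (\<lambda>a. \<Sum>j<k. cscale (a j) (f j)) ({..<k} \<rightarrow>\<^sub>E UNIV) F"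
proof -
  obtain C :: "'v set" where C: "finite C" "span C = UNIV" using finite_spanning_set by blast
  have re: "(v, 0) \<in> cvec.span ((\<lambda>v. (v, 0)) ` C)" for v
  proof -
    have "v \<in> span C" using C by simp
    then show ?thesis
    proof (induction rule: span_induct_alt)
      case base
      show ?case using cvec.span_zero by (simp add: zero_prod_def)
    next
      case (step r x y)
      have "(r *\<^sub>R x + y, 0) = cscale (of_real r) (x, 0) + (y, 0)"
        by (simp add: cscale_def)
      moreover have "(x, 0) \<in> cvec.span ((\<lambda>v. (v, 0)) ` C)" using step by (intro cvec.span_base) auto
      ultimately show ?case
        using step by (metis cvec.span_add cvec.span_scale)
    qed
  qed
  have "z \<in> cvec.span ((\<lambda>v. (v, 0)) ` C)" for z
  proof -
    have "z = (fst z, 0) + cscale \<i> (snd z, 0)" by (simp add: cscale_def prod_eq_iff)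
    then show ?thesis using re by (metis cvec.span_add cvec.span_scale)
  qed
  then have UN: "cvec.span ((\<lambda>v. (v, 0)) ` C) = UNIV" by blast
  obtain B where B: "B \<subseteq> F" "cvec.independent B" "F \<subseteq> cvec.span B"
    using cvec.maximal_independent_subset by blast
  have span: "cvec.span B = F" using B F cvec.span_minimal by blast
  have fin: "finite B"
    using cvec.independent_span_bound[OF _ B(2), of "(\<lambda>v. (v, 0)) ` C"] C(1) UN by auto
  obtain f where f: "bij_betw f {..<card B} B"
    using ex_bij_betw_nat_finite[OF fin] by (metis atLeast0LessThan)
  let ?k = "card B"
  let ?g = "inv_into {..<?k} f"
  have sum_f: "(\<Sum>j<?k. cscale (a j) (f j)) = (\<Sum>v\<in>B. cscale (a (?g v)) v)" for a
    using sum.reindex_bij_betw[OF f, of "\<lambda>v. cscale (a (?g v)) v"]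
      bij_betw_inv_into_left[OF f] by simp
  have "bij_betw (\<lambda>a. \<Sum>j<?k. cscale (a j) (f j)) ({..<?k} \<rightarrow>\<^sub>E UNIV) F"
  proof (rule bij_betw_imageI)
    show "inj_on (\<lambda>a. \<Sum>j<?k. cscale (a j) (f j)) ({..<?k} \<rightarrow>\<^sub>E UNIV)"
    proof (rule inj_onI)
      fix a a' :: "nat \<Rightarrow> complex"
      assume aa: "a \<in> {..<?k} \<rightarrow>\<^sub>E UNIV" "a' \<in> {..<?k} \<rightarrow>\<^sub>E UNIV"
        and eq: "(\<Sum>j<?k. cscale (a j) (f j)) = (\<Sum>j<?k. cscale (a' j) (f j))"
      have sum0: "(\<Sum>v\<in>B. cscale (a (?g v) - a' (?g v)) v) = 0"
        using eq unfolding sum_f by (simp add: cvec.scale_left_diff_distrib sum_subtractf)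
      have ag: "a (?g v) - a' (?g v) = 0" if "v \<in> B" for v
      proof (rule ccontr)
        assume "a (?g v) - a' (?g v) \<noteq> 0"
        with sum0 that have "\<exists>u. (\<exists>v\<in>B. u v \<noteq> 0) \<and> (\<Sum>v\<in>B. cscale (u v) v) = 0"
          by (intro exI[of _ "\<lambda>v. a (?g v) - a' (?g v)"]) (rule conjI, rule bexI)
        then show False using B(2) cvec.dependent_finite[OF fin] by metis
      qed
      have "a j = a' j" if "j \<in> {..<?k}" for j
        using ag[of "f j"] that bij_betw_inv_into_left[OF f that] bij_betwE[OF f] by auto
      then show "a = a'" by (rule PiE_ext[OF aa])
    qed
    show "(\<lambda>a. \<Sum>j<?k. cscale (a j) (f j)) ` ({..<?k} \<rightarrow>\<^sub>E UNIV) = F"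
    proof
      show "(\<lambda>a. \<Sum>j<?k. cscale (a j) (f j)) ` ({..<?k} \<rightarrow>\<^sub>E UNIV) \<subseteq> F"
        unfolding sum_f span[symmetric]
        by (rule image_subsetI) (intro cvec.span_sum cvec.span_scale cvec.span_base)
      show "F \<subseteq> (\<lambda>a. \<Sum>j<?k. cscale (a j) (f j)) ` ({..<?k} \<rightarrow>\<^sub>E UNIV)"
      proof
        fix z assume "z \<in> F"
        then obtain u where "z = (\<Sum>v\<in>B. cscale (u v) v)"
          using span cvec.span_finite[OF fin] by auto
        then have "z = (\<Sum>j<?k. cscale (restrict (u \<circ> f) {..<?k} j) (f j))"
          using sum.reindex_bij_betw[OF f, of "\<lambda>v. cscale (u v) v"] by simp
        then show "z \<in> (\<lambda>a. \<Sum>j<?k. cscale (a j) (f j)) ` ({..<?k} \<rightarrow>\<^sub>E UNIV)"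
          by (intro image_eqI[of _ _ "restrict (u \<circ> f) {..<?k}"]) auto
      qed
    qed
  qed
  then show ?thesis by blast
qed

text \<open>The condition at one point in \<open>complex_subbundle\<close>.\<close>

definition has_local_frame ::
  "'e::fin_dim_inner set \<Rightarrow> 'e \<Rightarrow> ('e \<Rightarrow> ('v::real_normed_vector \<times> 'v) set) \<Rightarrow> bool" where
  "has_local_frame S x0 F \<longleftrightarrow>
     (\<exists>V (k::nat) s. open V \<and> x0 \<in> V \<and> V \<subseteq> S \<and> (\<forall>j<k. smooth_on V (s j)) \<and>
       (\<forall>x\<in>V. bij_betw (\<lambda>a. \<Sum>j<k. cscale (a j) (s j x)) ({..<k} \<rightarrow>\<^sub>E UNIV) (F x)))"

lemma has_local_frame_cong:
  assumes "has_local_frame S x0 F" "\<And>x. x \<in> S \<Longrightarrow> F x = G x"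
  shows "has_local_frame S x0 G"
proof -
  obtain V s and k :: nat where V: "open V" "x0 \<in> V" "V \<subseteq> S" "\<forall>j<k. smooth_on V (s j)"
    and bij: "\<forall>x\<in>V. bij_betw (\<lambda>a. \<Sum>j<k. cscale (a j) (s j x)) ({..<k} \<rightarrow>\<^sub>E UNIV) (F x)"
    using assms(1) unfolding has_local_frame_def by (elim exE conjE) (rule that)
  have "\<forall>x\<in>V. bij_betw (\<lambda>a. \<Sum>j<k. cscale (a j) (s j x)) ({..<k} \<rightarrow>\<^sub>E UNIV) (G x)"
  proof
    fix x assume x: "x \<in> V"
    have "x \<in> S" using x V(3) by blast
    from bij[rule_format, OF x, unfolded assms(2)[OF this]]
    show "bij_betw (\<lambda>a. \<Sum>j<k. cscale (a j) (s j x)) ({..<k} \<rightarrow>\<^sub>E UNIV) (G x)" .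
  qed
  with V show ?thesis unfolding has_local_frame_def by (intro exI[of _ V] exI[of _ k] exI[of _ s] conjI)
qed

text \<open>The operator \<open>A x = Q x Q x0 + (1 - Q x) (1 - Q x0)\<close> satisfies \<open>Q x A x = A x Q x0\<close> and \<open>A x0 = 1\<close>. So
  for \<open>x\<close> near \<open>x0\<close> it is invertible and maps the range of \<open>Q x0\<close> onto that of \<open>Q x\<close>; the image
  of a basis at \<open>x0\<close> is a frame. That the rank is locally constant is part of the conclusion.\<close>

lemma smooth_projection_frame:
  fixes Q :: "'e::fin_dim_inner \<Rightarrow> 'v::fin_dim_normed \<times> 'v \<Rightarrow> 'v \<times> 'v"
  assumes S: "open S" and Q: "smooth_family S Q"
    and cplx: "\<And>x \<zeta> z. x \<in> S \<Longrightarrow> Q x (cscale \<zeta> z) = cscale \<zeta> (Q x z)"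
    and idem: "\<And>x z. x \<in> S \<Longrightarrow> Q x (Q x z) = Q x z"
    and x0: "x0 \<in> S"
  shows "has_local_frame S x0 (\<lambda>x. range (Q x))"
proof -
  note lin = smooth_family_linear[OF Q]
  define A where "A x z = Q x (Q x0 z) + ((z - Q x0 z) - Q x (z - Q x0 z))" for x z
  have "smooth_family S (\<lambda>x. Q x0)" "smooth_family S (\<lambda>x z :: 'v \<times> 'v. z)"
    using lin[OF x0] by (simp_all add: smooth_family_const linear_ident)
  then have A: "smooth_family S A"
    unfolding A_def
    by (intro smooth_family_add smooth_family_diff smooth_family_compose[OF S Q] S)
  have "A x0 z = z" for z
    using lin[OF x0] idem[OF x0] by (simp add: A_def linear_diff)
  then obtain V where V: "open V" "x0 \<in> V" "V \<subseteq> S" and bij: "\<And>x. x \<in> V \<Longrightarrow> bij (A x)"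
    using smooth_family_bij_near_identity[OF S A x0] by blast
  have "cvec.subspace (range (Q x0))"
  proof (rule cvec.subspaceI)
    show "0 \<in> range (Q x0)" using linear_0[OF lin[OF x0]] by (rule range_eqI[OF sym])
    show "z + w \<in> range (Q x0)" if zw: "z \<in> range (Q x0)" "w \<in> range (Q x0)" for z w
    proof -
      obtain z' w' where "z = Q x0 z'" "w = Q x0 w'" using zw by (elim rangeE)
      then show ?thesis using linear_add[OF lin[OF x0], of z' w'] by (intro range_eqI[of _ _ "z' + w'"]) simp
    qed
    show "cscale \<zeta> z \<in> range (Q x0)" if z: "z \<in> range (Q x0)" for \<zeta> z
    proof -
      obtain z' where "z = Q x0 z'" using z by (elim rangeE)
      then show ?thesis using cplx[OF x0, of \<zeta> z'] by (intro range_eqI[of _ _ "cscale \<zeta> z'"]) simp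
    qed
  qed
  then obtain k :: nat and f
    where f: "bij_betw (\<lambda>a. \<Sum>j<k. cscale (a j) (f j)) ({..<k} \<rightarrow>\<^sub>E UNIV) (range (Q x0))"
    using complex_subspace_basis by blast
  have "bij_betw (\<lambda>a. \<Sum>j<k. cscale (a j) (A x (f j))) ({..<k} \<rightarrow>\<^sub>E UNIV) (range (Q x))" if x: "x \<in> V" for x
  proof -
    have xS: "x \<in> S" using x V by blast
    have Ac: "A x (cscale \<zeta> z) = cscale \<zeta> (A x z)" for \<zeta> z
      by (simp add: A_def cplx[OF xS] cplx[OF x0] cvec.scale_right_distrib cvec.scale_right_diff_distrib
        flip: cvec.scale_right_diff_distrib)
    have sum: "(\<Sum>j<k. cscale (a j) (A x (f j))) = A x (\<Sum>j<k. cscale (a j) (f j))" for a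
      by (simp add: linear_sum[OF smooth_family_linear[OF A xS]] Ac)
    have QA: "A x (Q x0 z) = Q x (A x z)" for z
      using lin[OF xS] lin[OF x0] by (simp add: A_def linear_add linear_diff linear_0 idem[OF xS] idem[OF x0])
    have "A x ` range (Q x0) = range (Q x)"
    proof -
      have "A x ` range (Q x0) = Q x ` range (A x)" by (simp add: QA image_image)
      then show ?thesis using bij[OF x] by (simp add: bij_is_surj)
    qed
    then have "bij_betw (A x) (range (Q x0)) (range (Q x))"
      using bij_betw_subset[OF bij[OF x] subset_UNIV] by metis
    from bij_betw_trans[OF f this] show ?thesis by (simp add: sum o_def)
  qed
  moreover have "smooth_on V (\<lambda>x. A x (f j))" for j
    using smooth_family_subset[OF A V(3)] unfolding smooth_family_def by blast
  ultimately show ?thesis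
    unfolding has_local_frame_def
    using V by (intro exI[of _ V] exI[of _ k] exI[of _ "\<lambda>j x. A x (f j)"]) auto
qed

text \<open>If \<open>J\<^sup>2 = -1\<close>, this operator \<open>(1 + \<i> J) / 2\<close> is the projection onto the eigenspace along its conjugate.\<close>

definition minus_i_projection :: "('v::real_vector \<Rightarrow> 'v) \<Rightarrow> 'v \<times> 'v \<Rightarrow> 'v \<times> 'v" where
  "minus_i_projection J z = (1/2) *\<^sub>R (z + cscale \<i> (cmap J z))"

lemma minus_i_eigenspace_iff:
  "(a, b) \<in> minus_i_eigenspace J \<longleftrightarrow> J a = b \<and> J b = - a"
  by (auto simp: minus_i_eigenspace_def cmap_def cscale_def)

lemma minus_i_projection_eq:
  "minus_i_projection J (a, b) = ((1/2) *\<^sub>R (a - J b), (1/2) *\<^sub>R (b + J a))"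
  by (simp add: minus_i_projection_def cmap_def cscale_def)

lemma cmap_cscale: "linear K \<Longrightarrow> cmap K (cscale \<zeta> z) = cscale \<zeta> (cmap K z)"
  by (cases z) (simp add: cmap_def cscale_def linear_cmul linear_diff linear_add)

lemma minus_i_projection_cscale:
  assumes "linear J" shows "minus_i_projection J (cscale \<zeta> z) = cscale \<zeta> (minus_i_projection J z)"
proof -
  have "minus_i_projection J z = cscale (1/2) (z + cscale \<i> (cmap J z))" for z
    by (simp add: minus_i_projection_def cscale_def prod_eq_iff)
  then show ?thesis
    by (simp add: cmap_cscale[OF assms] cvec.scale_right_distrib mult.commute)
qed

lemma minus_i_projection_in:
  assumes "linear J" "\<And>v. J (J v) = - v"
  shows "minus_i_projection J z \<in> minus_i_eigenspace J"
  using assms by (cases z) (simp add: minus_i_projection_eq minus_i_eigenspace_iff linear_cmul linear_diff linear_add)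

lemma minus_i_projection_fixes: "z \<in> minus_i_eigenspace J \<Longrightarrow> minus_i_projection J z = z"
  by (cases z) (simp add: minus_i_projection_eq minus_i_eigenspace_iff scaleR_2[symmetric])

lemma smooth_family_minus_i_projection:
  fixes J :: "'e::fin_dim_inner \<Rightarrow> 'v::fin_dim_normed \<Rightarrow> 'v"
  assumes "open S" "smooth_family S J"
  shows "smooth_family S (\<lambda>x. minus_i_projection (J x))"
proof -
  have "linear (scaleR (1/2) :: 'v \<times> 'v \<Rightarrow> 'v \<times> 'v)" by (auto simp: linear_iff algebra_simps)
  then have "smooth_family S (\<lambda>x. scaleR (1/2) :: 'v \<times> 'v \<Rightarrow> 'v \<times> 'v)" by (rule smooth_family_const)
  moreover have "smooth_family S (\<lambda>x z. z + cscale \<i> (cmap (J x) z))"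
    using assms linear_ident
    by (intro smooth_family_add smooth_family_const
        smooth_family_compose[of S "\<lambda>x. cscale \<i>" "\<lambda>x. cmap (J x)"] smooth_family_cmap linear_cscale) auto
  ultimately show ?thesis
    unfolding minus_i_projection_def by (rule smooth_family_compose[OF assms(1)])
qed

text \<open>Since \<open>J x\<close> preserves the range of \<open>P x\<close>, the composition of \<open>P x\<close> with the projection to the eigenspace is
  idempotent although the two need not commute.\<close>

lemma eigenbundle_frame:
  fixes J P :: "'e::fin_dim_inner \<Rightarrow> 'v::fin_dim_normed \<Rightarrow> 'v"
  assumes S: "open S" and J: "smooth_family S J" and P: "smooth_family S P"
    and J2: "\<And>x v. x \<in> S \<Longrightarrow> J x (J x v) = - v"
    and P2: "\<And>x v. x \<in> S \<Longrightarrow> P x (P x v) = P x v"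
    and JP: "\<And>x v. x \<in> S \<Longrightarrow> J x (P x v) \<in> range (P x)"
    and x0: "x0 \<in> S"
  shows "has_local_frame S x0 (\<lambda>x. minus_i_eigenspace (J x) \<inter> (range (P x) \<times> range (P x)))"
proof -
  define Q where "Q x z = minus_i_projection (J x) (cmap (P x) z)" for x z
  have Q: "smooth_family S Q"
    unfolding Q_def
    by (rule smooth_family_compose[OF S smooth_family_minus_i_projection[OF S J] smooth_family_cmap[OF S P]])
  have fixes_range: "P x v = v" if "x \<in> S" "v \<in> range (P x)" for x v using P2 that by auto
  have in_iff: "z \<in> range (P x) \<times> range (P x) \<longleftrightarrow> cmap (P x) z = z" if "x \<in> S" for x z
  proof -
    have "v \<in> range (P x) \<longleftrightarrow> P x v = v" for v
      using fixes_range[OF that, of v] range_eqI[of v "P x" v] by metis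
    then show ?thesis by (cases z) (simp add: cmap_def)
  qed
  have PQ: "cmap (P x) (Q x z) = Q x z" if "x \<in> S" for x z
    using smooth_family_linear[OF P that] P2[OF that] fixes_range[OF that JP[OF that]]
    by (cases z) (simp add: Q_def minus_i_projection_eq cmap_def linear_cmul linear_diff linear_add)
  have range: "range (Q x) = minus_i_eigenspace (J x) \<inter> (range (P x) \<times> range (P x))" if x: "x \<in> S" for x
  proof -
    have eig: "Q x z \<in> minus_i_eigenspace (J x)" for z
      unfolding Q_def using smooth_family_linear[OF J x] J2[OF x] by (rule minus_i_projection_in)
    have "Q x z \<in> range (P x) \<times> range (P x)" for z
      using PQ in_iff x by blast
    with eig have sub: "range (Q x) \<subseteq> minus_i_eigenspace (J x) \<inter> (range (P x) \<times> range (P x))" by blast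
    have "z \<in> range (Q x)" if z: "z \<in> minus_i_eigenspace (J x) \<inter> (range (P x) \<times> range (P x))" for z
    proof (rule range_eqI)
      show "z = Q x z"
        using z in_iff[OF x, of z] minus_i_projection_fixes[of z "J x"] by (simp add: Q_def)
    qed
    with sub show ?thesis by blast
  qed
  have "Q x (Q x z) = Q x z" if x: "x \<in> S" for x z
  proof -
    have "Q x z \<in> minus_i_eigenspace (J x)" using range[OF x] by blast
    then show ?thesis using PQ[OF x, of z] minus_i_projection_fixes by (metis Q_def)
  qed
  moreover have "Q x (cscale \<zeta> z) = cscale \<zeta> (Q x z)" if "x \<in> S" for x \<zeta> z
    using smooth_family_linear[OF P that] smooth_family_linear[OF J that]
    by (simp add: Q_def cmap_cscale minus_i_projection_cscale)
  ultimately have "has_local_frame S x0 (\<lambda>x. range (Q x))"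
    by (intro smooth_projection_frame[OF S Q _ _ x0])
  then show ?thesis by (rule has_local_frame_cong[OF _ range])
qed

section \<open>Determinants of complex structures\<close>

lemma finite_basis_coordinates:
  "\<exists>N (v :: nat \<Rightarrow> 'v::fin_dim_normed) c. inj_on v {..<N} \<and> independent (v ` {..<N}) \<and> span (v ` {..<N}) = UNIV \<and>
     (\<forall>i. linear (c i)) \<and> (\<forall>x. x = (\<Sum>i<N. c i x *\<^sub>R v i)) \<and>
     (\<forall>i<N. \<forall>j<N. c i (v j) = (if i = j then 1 else (0::real)))"
proof -
  obtain C :: "'v set" where C: "finite C" "span C = UNIV" using finite_spanning_set by blast
  obtain B :: "'v set" where B: "independent B" "span B = UNIV"
    using basis_exists[of "UNIV :: 'v set"] by (metis top.extremum_uniqueI)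
  have fin: "finite B" using independent_span_bound[OF C(1) B(1)] C(2) by simp
  obtain v where v: "bij_betw v {..<card B} B"
    using ex_bij_betw_nat_finite[OF fin] by (metis atLeast0LessThan)
  define c where "c i x = representation B x (v i)" for i x
  have im: "v ` {..<card B} = B" and inj: "inj_on v {..<card B}" using v by (auto simp: bij_betw_def)
  have "linear (c i)" for i
    using B by (auto simp: linear_iff c_def real_vector.representation_add real_vector.representation_scale)
  moreover have "x = (\<Sum>i<card B. c i x *\<^sub>R v i)" for x
    using real_vector.sum_representation_eq[OF B(1), of x B] fin B(2)
      sum.reindex_bij_betw[OF v, of "\<lambda>b. representation B x b *\<^sub>R b"] by (simp add: c_def)
  moreover have "c i (v j) = (if i = j then 1 else 0)" if "i < card B" "j < card B" for i j
  proof -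
    have "v j \<in> B" using im that by blast
    then show ?thesis
      using real_vector.representation_basis[OF B(1)] inj that by (auto simp: c_def inj_on_def)
  qed
  ultimately show ?thesis using im inj B by (intro exI[of _ "card B"] exI[of _ v] exI[of _ c]) simp
qed

text \<open>If \<open>K\<^sup>2 = -1\<close> on a space of dimension \<open>N\<close>, then \<open>(1 + K)\<^sup>2 = 2 K\<close> shows \<open>det K \<ge> 0\<close>, while
  \<open>(det K)\<^sup>2 = (-1)\<^sup>N\<close>. So \<open>N\<close> is even and \<open>det K = 1\<close>.\<close>

lemma endo_has_det_complex_structures:
  fixes K0 K1 :: "'v::fin_dim_normed \<Rightarrow> 'v"
  assumes K0: "linear K0" "\<And>x. K0 (K0 x) = - x" and K1: "linear K1" "\<And>x. K1 (K1 x) = - x"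
  shows "endo_has_det K0 1" "endo_has_det K1 1" "endo_has_det (\<lambda>x. - K0 (K1 x)) 1"
proof -
  obtain N c and v :: "nat \<Rightarrow> 'v" where v: "inj_on v {..<N}" "independent (v ` {..<N})" "span (v ` {..<N}) = UNIV"
    and c: "\<And>i. linear (c i)" and x: "\<And>x. x = (\<Sum>i<N. c i x *\<^sub>R v i)"
    and \<delta>: "\<And>i j. i < N \<Longrightarrow> j < N \<Longrightarrow> c i (v j) = (if i = j then 1 else (0::real))"
    using finite_basis_coordinates[where 'v = 'v] by (elim exE conjE) (rule that, auto)
  define m where "m K = Matrix.mat N N (\<lambda>(i, j). c i (K (v j)))" for K :: "'v \<Rightarrow> 'v"
  have carrier: "m K \<in> carrier_mat N N" for K by (simp add: m_def)
  have mult: "m (\<lambda>x. K (L x)) = m K * m L" if K: "linear K" for K L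
  proof (rule eq_matI)
    fix i j assume ij: "i < dim_row (m K * m L)" "j < dim_col (m K * m L)"
    have "c i (K (L (v j))) = c i (K (\<Sum>l<N. c l (L (v j)) *\<^sub>R v l))" by (subst x[of "L (v j)"]) simp
    also have "\<dots> = (\<Sum>l<N. c i (K (v l)) * c l (L (v j)))"
      using K c by (simp add: linear_sum linear_cmul mult.commute)
    finally show "m (\<lambda>x. K (L x)) $$ (i, j) = (m K * m L) $$ (i, j)"
      using ij by (simp add: m_def scalar_prod_def atLeast0LessThan)
  qed (simp_all add: m_def)
  have scale: "m (\<lambda>x. r *\<^sub>R K x) = r \<cdot>\<^sub>m m K" for r K
    using c by (intro eq_matI) (auto simp: m_def linear_cmul)
  have one: "m (\<lambda>x. x) = 1\<^sub>m N"
    by (intro eq_matI) (auto simp: m_def \<delta>)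
  have det_scale: "Determinant.det (m (\<lambda>x. r *\<^sub>R K x)) = r ^ N * Determinant.det (m K)" for r K
    using carrier[of K] by (simp add: scale)
  have det_mult: "Determinant.det (m (\<lambda>x. K (L x))) = Determinant.det (m K) * Determinant.det (m L)"
    if "linear K" for K L
    using Determinant.det_mult[OF carrier carrier] mult[OF that] by metis
  have has_det: "endo_has_det K (Determinant.det (m K))" for K
    unfolding endo_has_det_def
    by (intro exI[of _ N] exI[of _ v] exI[of _ "\<lambda>i j. c i (K (v j))"] conjI v allI impI x)
       (simp add: m_def)
  have cs: "Determinant.det (m K) = 1 \<and> (-1) ^ N = (1::real)" if K: "linear K" "\<And>x. K (K x) = - x" for K
  proof -
    let ?d = "Determinant.det (m K)"
    have "?d * ?d = Determinant.det (m (\<lambda>x. (-1) *\<^sub>R x))"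
      using det_mult[OF K(1), of K] K(2) by simp
    also have "\<dots> = (-1) ^ N" using det_scale[of "-1" "\<lambda>x. x"] one by simp
    finally have sq: "?d * ?d = (-1) ^ N" .
    have l: "linear (\<lambda>x. x + K x)" using K(1) by (intro linear_compose_add linear_ident)
    have "(\<lambda>x. (x + K x) + K (x + K x)) = (\<lambda>x. 2 *\<^sub>R K x)"
      using K by (auto simp: linear_add scaleR_2)
    then have "2 ^ N * ?d = Determinant.det (m (\<lambda>x. x + K x)) * Determinant.det (m (\<lambda>x. x + K x))"
      using det_mult[OF l, of "\<lambda>x. x + K x"] det_scale[of 2 K] by simp
    then have "0 \<le> 2 ^ N * ?d" by simp
    then have d: "0 \<le> ?d" using mult_le_cancel_left_pos[of "2 ^ N" 0 ?d] by simp
    have "(-1) ^ N = (1::real)"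
      using sq zero_le_square[of ?d] by (cases "even N") auto
    moreover have "?d = 1"
    proof -
      have "(?d - 1) * (?d + 1) = 0" using sq \<open>(-1) ^ N = 1\<close> by (simp add: algebra_simps)
      then show ?thesis using d by simp
    qed
    ultimately show ?thesis by simp
  qed
  show "endo_has_det K0 1" "endo_has_det K1 1"
    using has_det[of K0] has_det[of K1] cs[OF K0] cs[OF K1] by auto
  have "Determinant.det (m (\<lambda>x. (-1) *\<^sub>R K0 (K1 x))) = 1"
    using det_scale[of "-1" "\<lambda>x. K0 (K1 x)"] det_mult[OF K0(1), of K1] cs[OF K0] cs[OF K1] by simp
  then show "endo_has_det (\<lambda>x. - K0 (K1 x)) 1"
    using has_det[of "\<lambda>x. - K0 (K1 x)"] by simp
qed

section \<open>Linear algebra of a fibre\<close>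

lemma gpairing_sym: "gpairing E F = gpairing F E"
  by (simp add: gpairing_def)

lemma gpairing_simps:
  "gpairing (E + E') F = gpairing E F + gpairing E' F" "gpairing E (F + F') = gpairing E F + gpairing E F'"
  "gpairing (E - E') F = gpairing E F - gpairing E' F" "gpairing E (F - F') = gpairing E F - gpairing E F'"
  "gpairing (r *\<^sub>R E) F = r * gpairing E F" "gpairing E (r *\<^sub>R F) = r * gpairing E F"
  "gpairing (- E) F = - gpairing E F" "gpairing E (- F) = - gpairing E F"
  "gpairing 0 F = 0" "gpairing E 0 = 0"
  by (simp_all add: gpairing_def blinfun.add_left blinfun.add_right blinfun.diff_left blinfun.diff_right
      blinfun.scaleR_left blinfun.scaleR_right blinfun.minus_left blinfun.minus_right field_simps)

text \<open>For \<open>T\<close> the differential at a point of the inclusion of \<open>M\<close>, the following are the fibre of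
  \<open>TM \<oplus> T\<^sup>*X|M\<close>, the conormal space and the map \<open>p\<close>. They depend on the linear map \<open>T\<close> alone.\<close>

definition tangential :: "('f::fin_dim_inner \<Rightarrow> 'e::fin_dim_inner) \<Rightarrow> 'e gtan set" where
  "tangential T = {E. fst E \<in> range T}"

definition annihilator :: "('f::fin_dim_inner \<Rightarrow> 'e::fin_dim_inner) \<Rightarrow> 'e gtan set" where
  "annihilator T = {E. fst E = 0 \<and> (\<forall>u. blinfun_apply (snd E) (T u) = 0)}"

definition gtan_restrict :: "('f::fin_dim_inner \<Rightarrow> 'e::fin_dim_inner) \<Rightarrow> 'e gtan \<Rightarrow> 'f gtan" where
  "gtan_restrict T E = (inv_into UNIV T (fst E), snd E o\<^sub>L Blinfun T)"

locale tangent_inclusion =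
  fixes T :: "'f::fin_dim_inner \<Rightarrow> 'e::fin_dim_inner"
  assumes linT: "linear T" and injT: "inj T"
begin

lemma subspace_tangential: "subspace (tangential T)"
proof -
  have "tangential T = fst -` range T" by (auto simp: tangential_def)
  then show ?thesis
    using linear_subspace_vimage[OF bounded_linear.linear[OF bounded_linear_fst] linear_subspace_image[OF linT subspace_UNIV]]
    by simp
qed

lemma subspace_annihilator: "subspace (annihilator T)"
  by (auto simp: subspace_def annihilator_def blinfun.add_left blinfun.scaleR_left)

lemma annihilator_tangential: "annihilator T \<subseteq> tangential T"
  using linear_0[OF linT] unfolding annihilator_def tangential_def by (auto intro: range_eqI[of _ _ 0])

lemma gtan_restrict_fst: "E \<in> tangential T \<Longrightarrow> T (fst (gtan_restrict T E)) = fst E"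
  by (auto simp: tangential_def gtan_restrict_def f_inv_into_f)

lemma gtan_restrict_snd: "blinfun_apply (snd (gtan_restrict T E)) u = blinfun_apply (snd E) (T u)"
  by (simp add: gtan_restrict_def bounded_linear_Blinfun_apply linear_imp_bounded_linear[OF linT])

lemma gtan_restrict_eq_iff:
  "E \<in> tangential T \<Longrightarrow> gtan_restrict T E = F \<longleftrightarrow>
    fst E = T (fst F) \<and> (\<forall>u. blinfun_apply (snd F) u = blinfun_apply (snd E) (T u))"
proof -
  assume E: "E \<in> tangential T"
  have "fst E = T (fst F) \<longleftrightarrow> fst (gtan_restrict T E) = fst F"
    using gtan_restrict_fst[OF E] injT by (metis injD)
  moreover have "(\<forall>u. blinfun_apply (snd F) u = blinfun_apply (snd E) (T u)) \<longleftrightarrow> snd (gtan_restrict T E) = snd F"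
    using gtan_restrict_snd[of E] blinfun_eqI by metis
  ultimately show ?thesis by (simp add: prod_eq_iff)
qed

lemma tangentialI: "fst E = T u \<Longrightarrow> E \<in> tangential T"
  by (simp add: tangential_def)

lemma gtan_restrict_add:
  "E \<in> tangential T \<Longrightarrow> F \<in> tangential T \<Longrightarrow> gtan_restrict T (E + F) = gtan_restrict T E + gtan_restrict T F"
  using subspace_add[OF subspace_tangential, of E F]
  by (simp add: gtan_restrict_eq_iff gtan_restrict_fst gtan_restrict_snd linear_add[OF linT] blinfun.add_left)

lemma gtan_restrict_scaleR:
  "E \<in> tangential T \<Longrightarrow> gtan_restrict T (r *\<^sub>R E) = r *\<^sub>R gtan_restrict T E"
  using subspace_scale[OF subspace_tangential, of E r]
  by (simp add: gtan_restrict_eq_iff gtan_restrict_fst gtan_restrict_snd linear_cmul[OF linT] blinfun.scaleR_left)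

lemma gtan_restrict_diff:
  "E \<in> tangential T \<Longrightarrow> F \<in> tangential T \<Longrightarrow> gtan_restrict T (E - F) = gtan_restrict T E - gtan_restrict T F"
  using subspace_diff[OF subspace_tangential, of E F]
  by (simp add: gtan_restrict_eq_iff gtan_restrict_fst gtan_restrict_snd linear_diff[OF linT] blinfun.diff_left)

lemma gtan_restrict_minus:
  "E \<in> tangential T \<Longrightarrow> gtan_restrict T (- E) = - gtan_restrict T E"
  using gtan_restrict_scaleR[of E "-1"] by simp

lemma gtan_restrict_eq_0_iff: "E \<in> tangential T \<Longrightarrow> gtan_restrict T E = 0 \<longleftrightarrow> E \<in> annihilator T"
  by (auto simp: gtan_restrict_eq_iff annihilator_def linear_0[OF linT])

lemma gpairing_gtan_restrict:
  "E \<in> tangential T \<Longrightarrow> F \<in> tangential T \<Longrightarrow>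
    gpairing (gtan_restrict T E) (gtan_restrict T F) = gpairing E F"
  by (simp add: gpairing_def gtan_restrict_fst gtan_restrict_snd)

lemma gpairing_annihilator: "E \<in> annihilator T \<Longrightarrow> F \<in> tangential T \<Longrightarrow> gpairing E F = 0"
  by (auto simp: gpairing_def annihilator_def tangential_def)

text \<open>The component \<open>w\<close> of \<open>fst F\<close> transversal to the range of \<open>T\<close> is detected by the conormal covector
  \<open>\<langle>w, (1 - T R) \<cdot>\<rangle>\<close>.\<close>

lemma tangential_if_orthogonal:
  assumes "\<And>E. E \<in> annihilator T \<Longrightarrow> gpairing E F = 0"
  shows "F \<in> tangential T"
proof -
  obtain R where R: "linear R" "R \<circ> T = id"
    using linear_injective_left_inverse[OF linT injT] by blast
  define w where "w = fst F - T (R (fst F))"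
  define \<alpha> where "\<alpha> = Blinfun (\<lambda>x. inner w (x - T (R x)))"
  have "linear (\<lambda>x. inner w (x - T (R x)))"
    using linT R(1) by (auto simp: linear_iff inner_right_distrib inner_diff_right algebra_simps)
  then have \<alpha>: "blinfun_apply \<alpha> x = inner w (x - T (R x))" for x
    by (simp add: \<alpha>_def bounded_linear_Blinfun_apply linear_imp_bounded_linear)
  have "R (T u) = u" for u using R(2) by (metis comp_apply id_apply)
  then have "(0, \<alpha>) \<in> annihilator T" by (simp add: annihilator_def \<alpha>)
  from assms[OF this] have "inner w w = 0" by (simp add: gpairing_def \<alpha> w_def)
  then have "fst F = T (R (fst F))" by (simp add: w_def)
  then show ?thesis by (rule tangentialI)
qed

lemma gtan_restrict_surj: "\<exists>E\<in>tangential T. gtan_restrict T E = F"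
proof -
  obtain R where R: "linear R" "R \<circ> T = id"
    using linear_injective_left_inverse[OF linT injT] by blast
  let ?E = "(T (fst F), snd F o\<^sub>L Blinfun R)"
  have "?E \<in> tangential T" by (simp add: tangential_def)
  moreover have "R (T u) = u" for u using R(2) by (metis comp_apply id_apply)
  ultimately have "gtan_restrict T ?E = F"
    using bounded_linear_Blinfun_apply[OF linear_imp_bounded_linear[OF R(1)]]
    by (simp add: gtan_restrict_eq_iff)
  with \<open>?E \<in> tangential T\<close> show ?thesis by blast
qed

end

lemma cmap_eq_0_iff: "cmap f z = 0 \<longleftrightarrow> f (fst z) = 0 \<and> f (snd z) = 0"
  by (simp only: cmap_def prod_eq_iff fst_map_prod snd_map_prod fst_zero snd_zero)

text \<open>For a real subspace \<open>R\<close>, the sum of \<open>L \<inter> R\<^sup>\<complex>\<close> and of its conjugate is the complexification of the largest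
  \<open>J\<close>-invariant subspace of \<open>R\<close>.\<close>

lemma plus_conj_eigenspace:
  assumes J: "linear J" "\<And>v. J (J v) = - v" and R: "subspace R"
  shows "plus_conj (minus_i_eigenspace J \<inter> (R \<times> R)) = {E \<in> R. J E \<in> R} \<times> {E \<in> R. J E \<in> R}"
proof (intro subset_antisym subsetI)
  fix z assume "z \<in> plus_conj (minus_i_eigenspace J \<inter> (R \<times> R))"
  then obtain a b a' b' where z: "z = (a + a', b - b')"
    and ab: "J a = b" "J b = - a" "a \<in> R" "b \<in> R" and ab': "J a' = b'" "J b' = - a'" "a' \<in> R" "b' \<in> R"
    by (auto simp: plus_conj_def cconj_def minus_i_eigenspace_iff)
  have "J (a + a') = b + b'" "J (b - b') = a' - a"
    using ab ab' by (simp_all add: linear_add[OF J(1)] linear_diff[OF J(1)])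
  then show "z \<in> {E \<in> R. J E \<in> R} \<times> {E \<in> R. J E \<in> R}"
    using ab ab' R by (simp add: z subspace_add subspace_diff)
next
  fix z assume "z \<in> {E \<in> R. J E \<in> R} \<times> {E \<in> R. J E \<in> R}"
  then obtain x y where z: "z = (x, y)" and x: "x \<in> R" "J x \<in> R" and y: "y \<in> R" "J y \<in> R" by auto
  define e where "e s = ((1/2) *\<^sub>R (x + s *\<^sub>R J y), (1/2) *\<^sub>R (J x - s *\<^sub>R y))" for s
  have e: "e s \<in> minus_i_eigenspace J \<inter> (R \<times> R)" for s
    using x y R J by (simp add: e_def minus_i_eigenspace_iff linear_cmul linear_add linear_diff
        subspace_scale subspace_add subspace_diff)
  \<comment> \<open>Solving \<open>a + a' = x\<close> and \<open>J a - J a' = y\<close> for the components \<open>a, a'\<close> gives \<open>(x \<mp> J y) / 2\<close>.\<close>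
  have "z = e (-1) + cconj (e 1)"
    by (simp add: z e_def cconj_def prod_eq_iff algebra_simps flip: scaleR_add_left)
  then show "z \<in> plus_conj (minus_i_eigenspace J \<inter> (R \<times> R))"
    unfolding plus_conj_def using e by blast
qed

text \<open>A \<open>J\<close>-invariant complement \<open>V\<close> of \<open>N\<close> in \<open>W\<close>. The last assumption says that \<open>N\<close> absorbs what
  \<open>J\<close> leaves of \<open>N\<close> inside \<open>W\<close>: it holds if \<open>J N = N\<close>, but also if \<open>J E \<in> W\<close> only for
  \<open>E = 0\<close> in \<open>N\<close>. These are the cases of \<open>J\<^sub>0\<close> and of \<open>J\<^sub>1\<close>.\<close>

locale reduction = tangent_inclusion T for T :: "'f::fin_dim_inner \<Rightarrow> 'e::fin_dim_inner" +
  fixes J :: "'e gtan \<Rightarrow> 'e gtan" and V :: "'e gtan set"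
  assumes linJ: "linear J" and J2: "\<And>E. J (J E) = - E"
    and subV: "subspace V" and V_tangential: "V \<subseteq> tangential T"
    and V_annihilator: "V \<inter> annihilator T = {0}"
    and tangential_split: "\<And>E. E \<in> tangential T \<Longrightarrow> \<exists>v\<in>V. E - v \<in> annihilator T"
    and J_V: "\<And>E. E \<in> V \<Longrightarrow> J E \<in> V"
    and J_annihilator: "\<And>E. E \<in> annihilator T \<Longrightarrow> J E \<in> tangential T \<Longrightarrow> J E \<in> annihilator T"
begin

lemma lift_unique: "E \<in> V \<Longrightarrow> E' \<in> V \<Longrightarrow> gtan_restrict T E = gtan_restrict T E' \<Longrightarrow> E = E'"
proof -
  assume a: "E \<in> V" "E' \<in> V" "gtan_restrict T E = gtan_restrict T E'"
  then have E: "E \<in> tangential T" "E' \<in> tangential T" "E - E' \<in> V"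
    using subV V_tangential by (blast intro: subspace_diff)+
  have "gtan_restrict T (E - E') = 0" using gtan_restrict_diff[OF E(1,2)] a(3) by simp
  then have "E - E' \<in> annihilator T" using gtan_restrict_eq_0_iff E(3) V_tangential by blast
  with E(3) have "E - E' = 0" using V_annihilator by blast
  then show "E = E'" by simp
qed

lemma lift_exists: "\<exists>E\<in>V. gtan_restrict T E = F"
proof -
  obtain E where E: "E \<in> tangential T" "gtan_restrict T E = F" using gtan_restrict_surj by blast
  obtain v where v: "v \<in> V" "E - v \<in> annihilator T" using tangential_split[OF E(1)] by blast
  have "gtan_restrict T (E - v) = 0"
    using v(2) annihilator_tangential gtan_restrict_eq_0_iff by blast
  then have "gtan_restrict T v = F"
    using E v(1) V_tangential gtan_restrict_diff[of E v] by auto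
  with v(1) show ?thesis by blast
qed

definition lift :: "'f gtan \<Rightarrow> 'e gtan" where
  "lift F = (THE E. E \<in> V \<and> gtan_restrict T E = F)"

lemma lift: "lift F \<in> V" "gtan_restrict T (lift F) = F"
proof -
  have "\<exists>!E. E \<in> V \<and> gtan_restrict T E = F" using lift_exists[of F] lift_unique by metis
  from theI'[OF this] show "lift F \<in> V" "gtan_restrict T (lift F) = F" by (auto simp: lift_def)
qed

lemma lift_eqI: "E \<in> V \<Longrightarrow> gtan_restrict T E = F \<Longrightarrow> lift F = E"
  using lift lift_unique by metis

lemma lift_tangential: "lift F \<in> tangential T"
  using lift(1) V_tangential by blast

lemma linear_lift: "linear lift"
proof (rule linearI)
  show "lift (E + F) = lift E + lift F" for E F
    using lift lift_tangential subV by (intro lift_eqI) (auto simp: subspace_add gtan_restrict_add)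
  show "lift (r *\<^sub>R E) = r *\<^sub>R lift E" for r E
    using lift lift_tangential subV by (intro lift_eqI) (auto simp: subspace_scale gtan_restrict_scaleR)
qed

definition induced :: "'f gtan \<Rightarrow> 'f gtan" where
  "induced F = gtan_restrict T (J (lift F))"

lemma lift_induced: "lift (induced F) = J (lift F)"
  unfolding induced_def by (rule lift_eqI[OF J_V[OF lift(1)] refl])

lemma linear_induced: "linear induced"
proof (rule linearI)
  have JV: "J (lift E) \<in> tangential T" for E using J_V[OF lift(1)] V_tangential by blast
  show "induced (E + F) = induced E + induced F" for E F
    using JV by (simp add: induced_def linear_add[OF linear_lift] linear_add[OF linJ] gtan_restrict_add)
  show "induced (r *\<^sub>R E) = r *\<^sub>R induced E" for r E
    using JV by (simp add: induced_def linear_cmul[OF linear_lift] linear_cmul[OF linJ] gtan_restrict_scaleR)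
qed

lemma induced_square: "induced (induced F) = - F"
proof -
  have "induced (induced F) = gtan_restrict T (- lift F)"
    by (subst induced_def) (simp add: lift_induced J2)
  then show ?thesis using lift lift_tangential by (simp add: gtan_restrict_minus)
qed

text \<open>Any representative \<open>E\<close> with \<open>J E \<in> W\<close> computes the induced structure: it differs from the one in \<open>V\<close> by an
  element of \<open>N\<close> whose image under \<open>J\<close> is again in \<open>N\<close>.\<close>

lemma induced_gtan_restrict:
  assumes E: "E \<in> tangential T" "J E \<in> tangential T"
  shows "induced (gtan_restrict T E) = gtan_restrict T (J E)"
proof -
  obtain v where v: "v \<in> V" "E - v \<in> annihilator T" using tangential_split[OF E(1)] by blast
  have vT: "v \<in> tangential T" "J v \<in> tangential T" using v(1) J_V[OF v(1)] V_tangential by blast+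
  have "J (E - v) \<in> tangential T"
    using E vT subspace_tangential by (simp add: linear_diff[OF linJ] subspace_diff)
  from J_annihilator[OF v(2) this] have "J (E - v) \<in> annihilator T" .
  then have "gtan_restrict T (E - v) = 0" "gtan_restrict T (J (E - v)) = 0"
    using v(2) annihilator_tangential gtan_restrict_eq_0_iff by blast+
  then have "gtan_restrict T E = gtan_restrict T v" "gtan_restrict T (J E) = gtan_restrict T (J v)"
    using E vT by (simp_all add: gtan_restrict_diff linear_diff[OF linJ])
  moreover have "lift (gtan_restrict T v) = v" using v(1) by (intro lift_eqI refl)
  ultimately show ?thesis by (simp add: induced_def)
qed

lemma exact_kernel:
  "{z \<in> plus_conj (minus_i_eigenspace J \<inter> (tangential T \<times> tangential T)). cmap (gtan_restrict T) z = 0} =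
    plus_conj (minus_i_eigenspace J \<inter> (annihilator T \<times> annihilator T))"
proof -
  have "E \<in> tangential T \<and> J E \<in> tangential T \<and> gtan_restrict T E = 0 \<longleftrightarrow> E \<in> annihilator T \<and> J E \<in> annihilator T" for E
    using J_annihilator annihilator_tangential gtan_restrict_eq_0_iff[of E] by blast
  note iff = this
  show ?thesis
    unfolding plus_conj_eigenspace[OF linJ J2 subspace_tangential] plus_conj_eigenspace[OF linJ J2 subspace_annihilator]
  proof (rule Set.set_eqI)
    fix z
    show "z \<in> {z \<in> {E \<in> tangential T. J E \<in> tangential T} \<times> {E \<in> tangential T. J E \<in> tangential T}. cmap (gtan_restrict T) z = 0}
      \<longleftrightarrow> z \<in> {E \<in> annihilator T. J E \<in> annihilator T} \<times> {E \<in> annihilator T. J E \<in> annihilator T}"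
      using iff[of "fst z"] iff[of "snd z"] unfolding mem_Collect_eq mem_Times_iff cmap_eq_0_iff by blast
  qed
qed

lemma exact_surj:
  "cmap (gtan_restrict T) ` plus_conj (minus_i_eigenspace J \<inter> (tangential T \<times> tangential T)) = UNIV"
proof (rule UNIV_eq_I[symmetric])
  fix z :: "'f gtan \<times> 'f gtan"
  have "lift F \<in> {E \<in> tangential T. J E \<in> tangential T}" for F
    using J_V[OF lift(1)] lift_tangential V_tangential by blast
  then show "z \<in> cmap (gtan_restrict T) ` plus_conj (minus_i_eigenspace J \<inter> (tangential T \<times> tangential T))"
    unfolding plus_conj_eigenspace[OF linJ J2 subspace_tangential]
    by (intro image_eqI[of _ _ "(lift (fst z), lift (snd z))"]) (auto simp: cmap_def lift)
qed

text \<open>The left-hand side is the defining property of \<open>induced_gendo\<close>.\<close>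

lemma induced_condition_iff:
  "(\<forall>z \<in> plus_conj (minus_i_eigenspace J \<inter> (tangential T \<times> tangential T)).
      cmap K (cmap (gtan_restrict T) z) = cmap (gtan_restrict T) (cmap J z)) \<longleftrightarrow>
   (\<forall>E. E \<in> tangential T \<longrightarrow> J E \<in> tangential T \<longrightarrow> K (gtan_restrict T E) = gtan_restrict T (J E))"
  unfolding plus_conj_eigenspace[OF linJ J2 subspace_tangential]
  by (auto simp: cmap_def)

lemma induced_unique:
  assumes "\<forall>E. E \<in> tangential T \<longrightarrow> J E \<in> tangential T \<longrightarrow> K (gtan_restrict T E) = gtan_restrict T (J E)"
  shows "K = induced"
proof
  fix F
  have "J (lift F) \<in> tangential T" using J_V[OF lift(1)] V_tangential by blast
  then show "K F = induced F" using assms lift_tangential[of F] lift(2)[of F] by (metis induced_def)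
qed

end

locale kaehler_fibre = tangent_inclusion T for T :: "'f::fin_dim_inner \<Rightarrow> 'e::fin_dim_inner" +
  fixes J0 J1 :: "'e gtan \<Rightarrow> 'e gtan"
  assumes lin0: "linear J0" and lin1: "linear J1"
    and sq0: "\<And>E. J0 (J0 E) = - E" and sq1: "\<And>E. J1 (J1 E) = - E"
    and iso0: "\<And>E F. gpairing (J0 E) (J0 F) = gpairing E F"
    and iso1: "\<And>E F. gpairing (J1 E) (J1 F) = gpairing E F"
    and comm: "\<And>E. J0 (J1 E) = J1 (J0 E)"
    and pos: "\<And>E. E \<noteq> 0 \<Longrightarrow> gpairing (- J0 (J1 E)) E > 0"
    and con: "J0 ` annihilator T = annihilator T"
begin

text \<open>The complement \<open>V\<close> of \<open>N\<close> in \<open>W\<close>; by the lemma \<open>core_iff\<close> below it is the orthogonal complement with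
  respect to the metric \<open>G\<close>.\<close>

definition core :: "'e gtan set" where
  "core = {E \<in> tangential T. J1 E \<in> tangential T}"

lemma skew0: "gpairing (J0 E) F = - gpairing E (J0 F)"
  using iso0[of "J0 E" F] by (simp add: sq0 gpairing_simps)

lemma skew1: "gpairing (J1 E) F = - gpairing E (J1 F)"
  using iso1[of "J1 E" F] by (simp add: sq1 gpairing_simps)

lemma metric_sym: "gpairing (- J0 (J1 E)) F = gpairing (- J0 (J1 F)) E"
proof -
  have "gpairing (J0 (J1 E)) F = gpairing E (J1 (J0 F))" by (simp add: skew0 skew1)
  then show ?thesis by (simp add: gpairing_simps comm gpairing_sym)
qed

lemma J0_tangential:
  assumes "E \<in> tangential T" shows "J0 E \<in> tangential T"
proof (rule tangential_if_orthogonal)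
  fix n assume "n \<in> annihilator T"
  then have "n \<in> J0 ` annihilator T" using con by simp
  then obtain n' where "n' \<in> annihilator T" "n = J0 n'" by (elim imageE)
  then show "gpairing n (J0 E) = 0" using gpairing_annihilator[OF _ assms] by (simp add: iso0)
qed

text \<open>For \<open>n \<in> N\<close> one has \<open>\<langle>G n, E\<rangle> = \<langle>J\<^sub>0 n, J\<^sub>1 E\<rangle>\<close>, and \<open>J\<^sub>0 n\<close> runs through all of \<open>N\<close>.\<close>

lemma core_iff:
  assumes E: "E \<in> tangential T"
  shows "E \<in> core \<longleftrightarrow> (\<forall>n\<in>annihilator T. gpairing (- J0 (J1 n)) E = 0)"
proof -
  have eq: "gpairing (- J0 (J1 n)) E = gpairing (J0 n) (J1 E)" for n
    by (simp add: comm gpairing_simps skew1)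
  have "J1 E \<in> tangential T \<longleftrightarrow> (\<forall>n\<in>annihilator T. gpairing n (J1 E) = 0)"
    using tangential_if_orthogonal gpairing_annihilator by blast
  also have "\<dots> \<longleftrightarrow> (\<forall>n\<in>J0 ` annihilator T. gpairing n (J1 E) = 0)" by (simp add: con)
  finally show ?thesis using E by (simp add: core_def eq)
qed

lemma subspace_core: "subspace core"
proof -
  have "core = tangential T \<inter> J1 -` tangential T" by (auto simp: core_def)
  then show ?thesis
    using subspace_inter[OF subspace_tangential linear_subspace_vimage[OF lin1 subspace_tangential]] by simp
qed

lemma core_annihilator: "core \<inter> annihilator T = {0}"
proof -
  have "E = 0" if "E \<in> core" "E \<in> annihilator T" for E
    using that core_iff[of E] pos[of E] by (auto simp: core_def)
  then show ?thesis using subspace_0[OF subspace_core] subspace_0[OF subspace_annihilator] by blast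
qed

lemma metric_bilinear: "bilinear (\<lambda>E F. gpairing (- J0 (J1 E)) F)"
  by (auto simp: bilinear_def linear_iff gpairing_simps linear_add[OF lin1] linear_add[OF lin0]
      linear_cmul[OF lin1] linear_cmul[OF lin0])

lemma annihilator_spanning: "\<exists>B. finite B \<and> span B = annihilator T"
proof -
  obtain C :: "'e gtan set" where C: "finite C" "span C = UNIV" using finite_spanning_set by blast
  obtain B where B: "B \<subseteq> annihilator T" "independent B" "annihilator T \<subseteq> span B"
    using maximal_independent_subset by blast
  have "finite B" using independent_span_bound[OF C(1) B(2)] C(2) by simp
  moreover have "span B = annihilator T" using B subspace_annihilator span_minimal by blast
  ultimately show ?thesis by blast
qed

text \<open>The \<open>G\<close>-orthogonal projection onto \<open>N\<close> is taken from the case of a constant family of metrics.\<close>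

lemma tangential_split_core:
  assumes E: "E \<in> tangential T" shows "\<exists>v\<in>core. E - v \<in> annihilator T"
proof -
  obtain B where B: "finite B" "span B = annihilator T" using annihilator_spanning by blast
  obtain P :: "'f \<Rightarrow> 'e gtan \<Rightarrow> 'e gtan"
    where P: "\<And>x v. P x v \<in> span B" "\<And>x v n. n \<in> span B \<Longrightarrow> gpairing (- J0 (J1 n)) (v - P x v) = 0"
    using smooth_orthogonal_projection[OF open_UNIV metric_bilinear metric_sym pos smooth_on_const B(1)] by blast
  let ?n = "P 0 E"
  have n: "?n \<in> annihilator T" using P(1) B by blast
  then have "E - ?n \<in> tangential T" using E annihilator_tangential subspace_tangential by (blast intro: subspace_diff)
  then have "E - ?n \<in> core" using P(2) B by (simp add: core_iff)
  with n show ?thesis by (intro bexI[of _ "E - ?n"]) auto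
qed

lemma core_tangential: "core \<subseteq> tangential T"
  by (auto simp: core_def)

sublocale red0: reduction T J0 core
proof (intro reduction.intro reduction_axioms.intro tangent_inclusion_axioms)
  show "J0 E \<in> core" if "E \<in> core" for E
    using that J0_tangential by (auto simp: core_def comm[symmetric])
  show "J0 E \<in> annihilator T" if "E \<in> annihilator T" for E using con that by blast
qed (fact lin0 sq0 subspace_core core_tangential core_annihilator tangential_split_core)+

sublocale red1: reduction T J1 core
proof (intro reduction.intro reduction_axioms.intro tangent_inclusion_axioms)
  show "J1 E \<in> core" if "E \<in> core" for E
    using that subspace_neg[OF subspace_tangential] by (auto simp: core_def sq1)
  show "J1 E \<in> annihilator T" if "E \<in> annihilator T" "J1 E \<in> tangential T" for E
  proof -
    have "E \<in> core \<inter> annihilator T" using that annihilator_tangential by (auto simp: core_def)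
    then have "E = 0" using core_annihilator by blast
    then show ?thesis using linear_0[OF lin1] subspace_0[OF subspace_annihilator] by simp
  qed
qed (fact lin1 sq1 subspace_core core_tangential core_annihilator tangential_split_core)+

lemma lift_eq: "red1.lift = red0.lift"
  using red0.lift red1.lift_eqI by blast

lemma induced_comm: "red0.induced (red1.induced F) = red1.induced (red0.induced F)"
  unfolding red0.induced_def red1.induced_def
  by (metis comm lift_eq red0.induced_def red0.lift_induced red1.induced_def red1.lift_induced)

lemma induced_iso0: "gpairing (red0.induced E) (red0.induced F) = gpairing E F"
  using red0.lift red0.lift_tangential red0.J_V core_tangential
  by (metis gpairing_gtan_restrict iso0 red0.induced_def subset_iff)

lemma induced_iso1: "gpairing (red1.induced E) (red1.induced F) = gpairing E F"
  using red1.lift red1.lift_tangential red1.J_V core_tangential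
  by (metis gpairing_gtan_restrict iso1 red1.induced_def subset_iff)

lemma induced_pos:
  assumes "F \<noteq> 0" shows "gpairing (- red0.induced (red1.induced F)) F > 0"
proof -
  let ?E = "red0.lift F"
  have E0: "?E \<noteq> 0" using assms red0.lift(2)[of F] linear_0[OF red0.linear_lift] red0.lift_eqI
    by (metis gtan_restrict_eq_0_iff IntI core_annihilator red0.lift(1) red0.lift_tangential singletonI Int_iff)
  have t: "J0 (J1 ?E) \<in> tangential T"
    using red0.J_V red1.J_V red0.lift(1) core_tangential by blast
  have "red0.induced (red1.induced F) = gtan_restrict T (J0 (J1 ?E))"
    by (metis lift_eq red0.induced_def red1.lift_induced)
  then have "gpairing (red0.induced (red1.induced F)) F = gpairing (J0 (J1 ?E)) ?E"
    using gpairing_gtan_restrict[OF t red0.lift_tangential, of F] red0.lift(2) by simp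
  then show ?thesis using pos[OF E0] by (simp add: gpairing_simps)
qed

text \<open>The components of an element of the eigenspace are \<open>a\<close> and \<open>J\<^sub>1 a\<close>, so both of them lie in \<open>W\<close> only
  if they lie in \<open>V\<close>.\<close>

lemma eigenspace1_tangential:
  "minus_i_eigenspace J1 \<inter> (tangential T \<times> tangential T) = minus_i_eigenspace J1 \<inter> (core \<times> core)"
proof -
  have "a \<in> core \<and> b \<in> core" if "(a, b) \<in> minus_i_eigenspace J1" "a \<in> tangential T" "b \<in> tangential T" for a b
    using that subspace_neg[OF subspace_tangential] by (auto simp: core_def minus_i_eigenspace_iff)
  then show ?thesis using core_tangential by auto
qed

lemma eigenspace1_annihilator:
  "minus_i_eigenspace J1 \<inter> (annihilator T \<times> annihilator T) = {0}"
proof -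
  have "minus_i_eigenspace J1 \<inter> (annihilator T \<times> annihilator T) \<subseteq> (core \<inter> annihilator T) \<times> (core \<inter> annihilator T)"
    using eigenspace1_tangential annihilator_tangential by blast
  moreover have "0 \<in> minus_i_eigenspace J1 \<inter> (annihilator T \<times> annihilator T)"
    using linear_0[OF lin1] subspace_0[OF subspace_annihilator] by (simp add: zero_prod_def minus_i_eigenspace_iff)
  ultimately show ?thesis by (auto simp: core_annihilator zero_prod_def)
qed

end

section \<open>Changes of charts\<close>

text \<open>The model spaces may differ, so this covers two charts of \<open>X\<close>, two charts of \<open>M\<close>, and a chart of \<open>M\<close> with
  a chart of \<open>X\<close>.\<close>

definition smoothly_related :: "('a, 'e::fin_dim_inner) chart \<Rightarrow> ('a, 'f::fin_dim_inner) chart \<Rightarrow> bool" where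
  "smoothly_related c c' \<longleftrightarrow> inj_on (coord c) (dom_chart c) \<and> inj_on (coord c') (dom_chart c') \<and>
     open (coord c ` (dom_chart c \<inter> dom_chart c')) \<and>
     smooth_on (coord c ` (dom_chart c \<inter> dom_chart c')) (transition c c')"

lemma coord_inv_coord: "inj_on (coord c) (dom_chart c) \<Longrightarrow> p \<in> dom_chart c \<Longrightarrow> coord_inv c (coord c p) = p"
  by (simp add: coord_inv_def)

lemma transition_coord:
  "inj_on (coord c) (dom_chart c) \<Longrightarrow> p \<in> dom_chart c \<Longrightarrow> transition c c' (coord c p) = coord c' p"
  by (simp add: transition_def coord_inv_coord)

lemma tangent_map_has_derivative:
  assumes "smoothly_related c c'" "p \<in> dom_chart c" "p \<in> dom_chart c'"
  shows "(transition c c' has_derivative tangent_map c c' p) (at (coord c p))"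
  using assms unfolding tangent_map_def smoothly_related_def by (intro smooth_on_has_derivative) auto

lemma linear_tangent_map:
  "smoothly_related c c' \<Longrightarrow> p \<in> dom_chart c \<Longrightarrow> p \<in> dom_chart c' \<Longrightarrow> linear (tangent_map c c' p)"
  by (rule has_derivative_linear[OF tangent_map_has_derivative])

lemma tangent_map_eqI:
  assumes "smoothly_related c c'" "p \<in> dom_chart c" "p \<in> dom_chart c'"
    and "(f has_derivative D) (at (coord c p))" "open S" "coord c p \<in> S"
    and "\<And>x. x \<in> S \<Longrightarrow> f x = transition c c' x"
  shows "tangent_map c c' p = D"
  unfolding tangent_map_def
  by (rule frechet_derivative_eqI, rule has_derivative_transform_within_open[OF assms(4-6)])
    (simp add: assms(7))

lemma tangent_map_refl:
  assumes "smoothly_related c c" "p \<in> dom_chart c"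
  shows "tangent_map c c p v = v"
proof -
  have "tangent_map c c p = (\<lambda>v. v)"
    using assms transition_coord[of c _ c]
    by (intro tangent_map_eqI[OF assms(1,2,2) has_derivative_ident, of "coord c ` dom_chart c"])
       (auto simp: smoothly_related_def)
  then show ?thesis by simp
qed

lemma tangent_map_chain:
  assumes 1: "smoothly_related c c'" and 2: "smoothly_related c' c''" and 3: "smoothly_related c c''"
    and p: "p \<in> dom_chart c" "p \<in> dom_chart c'" "p \<in> dom_chart c''"
  shows "tangent_map c c'' p v = tangent_map c' c'' p (tangent_map c c' p v)"
proof -
  let ?f = "transition c c'" and ?g = "transition c' c''"
  define S where "S = ?f -` (coord c' ` (dom_chart c' \<inter> dom_chart c'')) \<inter> coord c ` (dom_chart c \<inter> dom_chart c')"
  have inj: "inj_on (coord c) (dom_chart c)" "inj_on (coord c') (dom_chart c')"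
    using 1 by (auto simp: smoothly_related_def)
  have "continuous_on (coord c ` (dom_chart c \<inter> dom_chart c')) ?f"
    using 1 smooth_on_continuous by (auto simp: smoothly_related_def)
  then have "open S"
    unfolding S_def using 1 2 continuous_on_open_vimage[of "coord c ` (dom_chart c \<inter> dom_chart c')" ?f]
    by (auto simp: smoothly_related_def)
  moreover have "coord c p \<in> S" using p inj by (auto simp: S_def transition_coord)
  moreover have "?g (?f x) = transition c c'' x" if x: "x \<in> S" for x
  proof -
    obtain q where q: "x = coord c q" "q \<in> dom_chart c" "q \<in> dom_chart c'" using x by (auto simp: S_def)
    then show ?thesis using inj by (simp add: transition_coord)
  qed
  moreover have "((\<lambda>x. ?g (?f x)) has_derivative (\<lambda>v. tangent_map c' c'' p (tangent_map c c' p v))) (at (coord c p))"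
    using has_derivative_compose[OF tangent_map_has_derivative[OF 1 p(1,2)], of ?g]
      tangent_map_has_derivative[OF 2 p(2,3)] transition_coord[OF inj(1) p(1), of c'] by simp
  ultimately have "tangent_map c c'' p = (\<lambda>v. tangent_map c' c'' p (tangent_map c c' p v))"
    by (intro tangent_map_eqI[OF 3 p(1,3)])
  then show ?thesis by simp
qed

lemma tangent_map_inverse:
  assumes "smoothly_related c c'" "smoothly_related c' c" "smoothly_related c c"
    and "p \<in> dom_chart c" "p \<in> dom_chart c'"
  shows "tangent_map c' c p (tangent_map c c' p v) = v"
  using tangent_map_chain[OF assms(1-4) assms(5,4)] tangent_map_refl[OF assms(3,4)] by simp

text \<open>The isomorphism between the expressions of a fibre in two charts; its graph is
  \<open>same_gtan\<close>.\<close>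

definition gtan_transport ::
  "('a, 'e::fin_dim_inner) chart \<Rightarrow> ('a, 'e) chart \<Rightarrow> 'a \<Rightarrow> 'e gtan \<Rightarrow> 'e gtan" where
  "gtan_transport c c' p E = (tangent_map c c' p (fst E), snd E o\<^sub>L Blinfun (tangent_map c' c p))"

definition mutually_related :: "('a, 'e::fin_dim_inner) chart \<Rightarrow> ('a, 'e) chart \<Rightarrow> 'a \<Rightarrow> bool" where
  "mutually_related c c' p \<longleftrightarrow> smoothly_related c c' \<and> smoothly_related c' c \<and>
     smoothly_related c c \<and> smoothly_related c' c' \<and> p \<in> dom_chart c \<and> p \<in> dom_chart c'"

lemma gtan_transport_fst: "fst (gtan_transport c c' p E) = tangent_map c c' p (fst E)"
  by (simp add: gtan_transport_def)

lemma gtan_transport_snd: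
  assumes "mutually_related c c' p"
  shows "blinfun_apply (snd (gtan_transport c c' p E)) w = blinfun_apply (snd E) (tangent_map c' c p w)"
  using assms linear_tangent_map[of c' c p]
  by (simp add: gtan_transport_def bounded_linear_Blinfun_apply linear_imp_bounded_linear mutually_related_def)

lemma same_gtan_iff:
  assumes "mutually_related c c' p"
  shows "same_gtan c c' p E E' \<longleftrightarrow> E' = gtan_transport c c' p E"
proof -
  have inv: "tangent_map c c' p (tangent_map c' c p w) = w" "tangent_map c' c p (tangent_map c c' p u) = u" for w u
    using assms tangent_map_inverse[of c c' p] tangent_map_inverse[of c' c p] by (auto simp: mutually_related_def)
  have "(\<forall>w. blinfun_apply (snd E) w = blinfun_apply (snd E') (tangent_map c c' p w)) \<longleftrightarrow>
      snd E' = snd (gtan_transport c c' p E)"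
  proof
    assume "\<forall>w. blinfun_apply (snd E) w = blinfun_apply (snd E') (tangent_map c c' p w)"
    then show "snd E' = snd (gtan_transport c c' p E)"
      by (intro blinfun_eqI) (simp add: gtan_transport_snd[OF assms] inv)
  qed (simp add: gtan_transport_snd[OF assms] inv)
  then show ?thesis by (auto simp: same_gtan_def prod_eq_iff gtan_transport_fst)
qed

lemma linear_gtan_transport:
  assumes "mutually_related c c' p" shows "linear (gtan_transport c c' p)"
proof -
  have l: "linear (tangent_map c c' p)" using assms linear_tangent_map[of c c' p] by (simp add: mutually_related_def)
  show ?thesis
    by (intro linearI prod_eqI blinfun_eqI)
      (simp_all add: gtan_transport_fst gtan_transport_snd[OF assms] linear_add[OF l] linear_cmul[OF l]
        blinfun.add_left blinfun.scaleR_left)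
qed

lemma mutually_related_sym: "mutually_related c c' p \<Longrightarrow> mutually_related c' c p"
  by (auto simp: mutually_related_def)

lemma gtan_transport_inverse:
  assumes "mutually_related c c' p"
  shows "gtan_transport c' c p (gtan_transport c c' p E) = E"
proof -
  have inv: "tangent_map c c' p (tangent_map c' c p w) = w" "tangent_map c' c p (tangent_map c c' p u) = u" for w u
    using assms tangent_map_inverse[of c c' p] tangent_map_inverse[of c' c p] by (auto simp: mutually_related_def)
  show ?thesis
    by (intro prod_eqI blinfun_eqI)
      (simp_all add: gtan_transport_fst gtan_transport_snd[OF assms] gtan_transport_snd[OF mutually_related_sym[OF assms]] inv)
qed

lemma endo_section_transport:
  assumes "endo_section A J" "c \<in> A" "c' \<in> A" "mutually_related c c' p"
  shows "J c' p (gtan_transport c c' p E) = gtan_transport c c' p (J c p E)"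
proof -
  have "same_gtan c c' p E (gtan_transport c c' p E)" by (simp add: same_gtan_iff[OF assms(4)])
  then have "same_gtan c c' p (J c p E) (J c' p (gtan_transport c c' p E))"
    using assms unfolding endo_section_def mutually_related_def by blast
  then show ?thesis by (simp add: same_gtan_iff[OF assms(4)])
qed

text \<open>The points \<open>q x\<close> run through a submanifold in the application, so that smoothness is in its
  coordinates. The pulled back covector is written in the frame of coordinate functionals, whose
  coefficients are values on the smooth vectors \<open>tangent_map c' c (q x) (b i)\<close>.\<close>

lemma smooth_family_gtan_transport:
  fixes c c' :: "('a, 'e::fin_dim_inner) chart" and q :: "'f::fin_dim_inner \<Rightarrow> 'a"
  assumes S: "open S" and rel: "\<And>x. x \<in> S \<Longrightarrow> mutually_related c c' (q x)"
    and q: "smooth_on S (\<lambda>x. coord c (q x))"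
  shows "smooth_family S (\<lambda>x. gtan_transport c c' (q x))"
proof (cases "S = {}")
  case True
  have "smooth_on {} f" for f :: "'f \<Rightarrow> 'e gtan"
    by (rule smooth_on_eqI[OF open_empty smooth_on_const[of _ 0]]) simp
  with True show ?thesis by (simp add: smooth_family_def)
next
  case False
  then obtain x0 where "x0 \<in> S" by blast
  from rel[OF this] have r: "smoothly_related c c'" "smoothly_related c' c" by (auto simp: mutually_related_def)
  let ?D = "coord c ` (dom_chart c \<inter> dom_chart c')" and ?D' = "coord c' ` (dom_chart c' \<inter> dom_chart c)"
  have im: "(\<lambda>x. coord c (q x)) ` S \<subseteq> ?D" "(\<lambda>x. coord c' (q x)) ` S \<subseteq> ?D'"
    using rel by (auto simp: mutually_related_def)
  have D: "open ?D" "open ?D'" "smooth_on ?D (transition c c')" "smooth_on ?D' (transition c' c)"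
    using r by (auto simp: smoothly_related_def)
  have q': "smooth_on S (\<lambda>x. coord c' (q x))"
  proof (rule smooth_on_eqI[OF S])
    show "smooth_on S (\<lambda>x. transition c c' (coord c (q x)))"
      by (rule smooth_on_compose[OF D(3) q S D(1) im(1)])
    show "coord c' (q x) = transition c c' (coord c (q x))" if "x \<in> S" for x
      using rel[OF that] by (simp add: transition_coord mutually_related_def smoothly_related_def)
  qed
  have push: "smooth_on S (\<lambda>x. tangent_map c c' (q x) v)" for v
    unfolding tangent_map_def
    by (rule smooth_on_compose[OF smooth_on_frechet_derivative[OF D(3)] q S D(1) im(1)])
  have pull: "smooth_on S (\<lambda>x. tangent_map c' c (q x) v)" for v
    unfolding tangent_map_def
    by (rule smooth_on_compose[OF smooth_on_frechet_derivative[OF D(4)] q' S D(2) im(2)])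
  obtain n b k where k: "\<forall>i<(n::nat). bounded_linear (k i)"
    and b: "\<forall>x::'e. x = (\<Sum>i<n. k i x *\<^sub>R b i)"
    using finite_frame by blast
  have kb: "blinfun_apply (Blinfun (k i)) = k i" if "i < n" for i
    using k that by (simp add: bounded_linear_Blinfun_apply)
  have "gtan_transport c c' (q x) E = (tangent_map c c' (q x) (fst E), 0) +
      (\<Sum>i<n. blinfun_apply (snd E) (tangent_map c' c (q x) (b i)) *\<^sub>R (0, Blinfun (k i)))" if x: "x \<in> S" for x E
  proof (intro prod_eqI blinfun_eqI)
    fix w
    have l: "linear (tangent_map c' c (q x))"
      using rel[OF x] by (intro linear_tangent_map) (auto simp: mutually_related_def)
    have "blinfun_apply (snd E) (tangent_map c' c (q x) w) =
        (\<Sum>i<n. k i w * blinfun_apply (snd E) (tangent_map c' c (q x) (b i)))"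
      by (subst b[rule_format, of w])
        (simp add: linear_sum[OF l] linear_cmul[OF l] blinfun.sum_right blinfun.scaleR_right)
    then show "blinfun_apply (snd (gtan_transport c c' (q x) E)) w = blinfun_apply (snd ((tangent_map c c' (q x) (fst E), 0) +
      (\<Sum>i<n. blinfun_apply (snd E) (tangent_map c' c (q x) (b i)) *\<^sub>R (0, Blinfun (k i))))) w"
      by (simp add: gtan_transport_snd[OF rel[OF x]] snd_sum blinfun.sum_left blinfun.scaleR_left kb mult.commute)
  qed (simp add: gtan_transport_fst fst_sum)
  moreover have "smooth_on S (\<lambda>x. (tangent_map c c' (q x) (fst E), 0) +
      (\<Sum>i<n. blinfun_apply (snd E) (tangent_map c' c (q x) (b i)) *\<^sub>R (0, Blinfun (k i))))" for E :: "'e gtan"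
  proof -
    have l1: "linear (\<lambda>v :: 'e. (v, 0 :: 'e \<Rightarrow>\<^sub>L real))" by (auto simp: linear_iff)
    have l2: "linear (blinfun_apply (snd E))"
      by (rule bounded_linear.linear[OF blinfun.bounded_linear_right])
    show ?thesis
      by (intro smooth_on_add[OF S smooth_on_linear[OF l1 S push]] smooth_on_sum[OF S]
          smooth_on_scaleR[OF S smooth_on_linear[OF l2 S pull] smooth_on_const])
  qed
  ultimately have "smooth_on S (\<lambda>x. gtan_transport c c' (q x) E)" for E
    by (rule smooth_on_eqI[OF S, rotated])
  then show ?thesis using rel by (intro smooth_familyI linear_gtan_transport)
qed

section \<open>Slice charts\<close>

lemma is_chart_inj: "is_chart X c \<Longrightarrow> inj_on (coord c) (dom_chart c)"
  unfolding is_chart_def using homeomorphic_imp_injective_map[of "subtopology X (dom_chart c)"]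
  by (metis inf.absorb_iff2 openin_subset topspace_subtopology)

lemma is_chart_open_image:
  assumes c: "is_chart X c" and W: "openin X W"
  shows "open (coord c ` (dom_chart c \<inter> W))"
proof -
  have "openin (subtopology X (dom_chart c)) (dom_chart c \<inter> W)"
    using W by (simp add: openin_subtopology_Int2)
  moreover have "open_map (subtopology X (dom_chart c)) (top_of_set (coord c ` dom_chart c)) (coord c)"
    using c homeomorphic_imp_open_map by (auto simp: is_chart_def)
  ultimately have "openin (top_of_set (coord c ` dom_chart c)) (coord c ` (dom_chart c \<inter> W))"
    by (auto simp: open_map_def)
  then show ?thesis using c by (simp add: is_chart_def openin_open_eq)
qed

locale submanifold =
  fixes X :: "'a topology" and A :: "('a, 'e::fin_dim_inner) chart set"
    and M :: "'a set" and B :: "('a, 'f::fin_dim_inner) chart set"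
  assumes manifold: "smooth_manifold X A" and embedded: "embedded_submanifold X A M B"
begin

lemma A_chart: "c \<in> A \<Longrightarrow> is_chart X c"
  using manifold by (simp add: smooth_manifold_def)

lemma A_inj: "c \<in> A \<Longrightarrow> inj_on (coord c) (dom_chart c)"
  using A_chart is_chart_inj by blast

lemma A_A:
  assumes "c \<in> A" "c' \<in> A" shows "smoothly_related c c'"
proof -
  have "openin X (dom_chart c')" using A_chart[OF assms(2)] by (simp add: is_chart_def)
  then show ?thesis
    using is_chart_open_image[OF A_chart[OF assms(1)]] manifold assms A_inj
    by (auto simp: smoothly_related_def smooth_manifold_def smooth_transition_def)
qed

definition slice :: "('a, 'f) chart \<Rightarrow> ('a, 'e) chart \<Rightarrow> ('f \<Rightarrow> 'e) \<Rightarrow> bool" where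
  "slice d c \<iota> \<longleftrightarrow> d \<in> B \<and> c \<in> A \<and> linear \<iota> \<and> inj \<iota> \<and> dom_chart d = dom_chart c \<inter> M \<and>
     coord c ` (dom_chart c \<inter> M) = coord c ` dom_chart c \<inter> range \<iota> \<and>
     (\<forall>p\<in>dom_chart d. coord c p = \<iota> (coord d p))"

lemma slice_exists:
  assumes "d \<in> B" shows "\<exists>c \<iota>. slice d c \<iota>"
proof -
  have "d \<in> slice_charts A M" using assms embedded by (simp add: embedded_submanifold_def)
  then obtain c and \<iota> :: "'f \<Rightarrow> 'e" where "c \<in> A" "linear \<iota> \<and> inj \<iota> \<and> dom_chart d = dom_chart c \<inter> M \<and>
     coord c ` (dom_chart c \<inter> M) = coord c ` dom_chart c \<inter> range \<iota> \<and>
     (\<forall>p\<in>dom_chart d. coord c p = \<iota> (coord d p))"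
    unfolding slice_charts_def by (elim CollectE bexE exE) (rule that)
  then show ?thesis unfolding slice_def using assms by (intro exI[of _ c] exI[of _ \<iota>] conjI) blast+
qed

context
  fixes d c \<iota>
  assumes s: "slice d c \<iota>"
begin

lemma slice_coord: "p \<in> dom_chart d \<Longrightarrow> coord c p = \<iota> (coord d p)"
  using s by (simp add: slice_def)

lemma slice_inj: "inj_on (coord d) (dom_chart d)"
proof (rule inj_onI)
  fix p q assume pq: "p \<in> dom_chart d" "q \<in> dom_chart d" "coord d p = coord d q"
  then have "coord c p = coord c q" "p \<in> dom_chart c" "q \<in> dom_chart c"
    using slice_coord s by (auto simp: slice_def)
  then show "p = q" using A_inj[of c] s by (auto simp: slice_def inj_on_def)
qed

lemma slice_image: "coord d ` (dom_chart d \<inter> Q) = \<iota> -` (coord c ` (dom_chart c \<inter> Q))"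
proof (intro subset_antisym subsetI)
  fix x assume "x \<in> coord d ` (dom_chart d \<inter> Q)"
  then obtain p where "x = coord d p" "p \<in> dom_chart d" "p \<in> Q" by blast
  then show "x \<in> \<iota> -` (coord c ` (dom_chart c \<inter> Q))"
    using slice_coord s by (auto simp: slice_def intro!: image_eqI[of _ _ p])
next
  fix x assume "x \<in> \<iota> -` (coord c ` (dom_chart c \<inter> Q))"
  then obtain q where q: "\<iota> x = coord c q" "q \<in> dom_chart c" "q \<in> Q" by auto
  \<comment> \<open>Points of the chart \<open>c\<close> whose coordinates lie in the linear slice belong to \<open>M\<close>.\<close>
  then have "coord c q \<in> coord c ` (dom_chart c \<inter> M)" using s unfolding slice_def by (metis IntI imageI rangeI)
  then have "q \<in> dom_chart c \<inter> M" using q A_inj[of c] s by (auto simp: slice_def inj_on_def)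
  then have qd: "q \<in> dom_chart d" using s by (simp add: slice_def)
  then have "\<iota> x = \<iota> (coord d q)" using slice_coord q by simp
  then have "x = coord d q" using s by (simp add: slice_def inj_eq)
  then show "x \<in> coord d ` (dom_chart d \<inter> Q)" using qd q by blast
qed

lemma slice_transition:
  assumes "c' \<in> A"
  shows "smoothly_related d c'"
proof -
  let ?S = "coord d ` (dom_chart d \<inter> dom_chart c')" and ?T = "coord c ` (dom_chart c \<inter> dom_chart c')"
  have r: "smoothly_related c c'" using A_A assms s by (simp add: slice_def)
  then have T: "open ?T" "smooth_on ?T (transition c c')" by (auto simp: smoothly_related_def)
  have \<iota>: "linear \<iota>" using s by (simp add: slice_def)
  have S: "open ?S"
    unfolding slice_image
    by (rule open_vimage[OF T(1) linear_continuous_on[OF linear_imp_bounded_linear[OF \<iota>]]])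
  have "smooth_on ?S (transition d c')"
  proof (rule smooth_on_eqI[OF S])
    show "smooth_on ?S (\<lambda>x. transition c c' (\<iota> x))"
      by (rule smooth_on_compose[OF T(2) smooth_on_linear[OF \<iota> S smooth_on_ident] S T(1)])
        (auto simp: slice_image)
    fix x assume "x \<in> ?S"
    then obtain p where p: "x = coord d p" "p \<in> dom_chart d" "p \<in> dom_chart c'" by blast
    have "\<iota> x = coord c p" using slice_coord[OF p(2)] p(1) by simp
    moreover have "p \<in> dom_chart c" using p(2) s by (simp add: slice_def)
    moreover have "c \<in> A" using s by (simp add: slice_def)
    ultimately show "transition d c' x = transition c c' (\<iota> x)"
      using p(1) transition_coord[OF slice_inj p(2), of c'] transition_coord[OF A_inj, of c p c'] by simp
  qed
  then show ?thesis using S slice_inj A_inj[OF assms] by (simp add: smoothly_related_def)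
qed

lemma tangent_map_slice:
  assumes "p \<in> dom_chart d" shows "tangent_map d c p = \<iota>"
proof (rule tangent_map_eqI)
  show "smoothly_related d c" using slice_transition s by (simp add: slice_def)
  then show "open (coord d ` (dom_chart d \<inter> dom_chart c))" by (simp add: smoothly_related_def)
  show pc: "p \<in> dom_chart c" using assms s by (simp add: slice_def)
  show "coord d p \<in> coord d ` (dom_chart d \<inter> dom_chart c)" using assms pc by blast
  show "(\<iota> has_derivative \<iota>) (at (coord d p))"
    using s by (auto simp: slice_def intro: bounded_linear_imp_has_derivative linear_imp_bounded_linear)
  fix x assume "x \<in> coord d ` (dom_chart d \<inter> dom_chart c)"
  then obtain q where "x = coord d q" "q \<in> dom_chart d" by blast
  then show "\<iota> x = transition d c x"
    using slice_coord transition_coord[OF slice_inj, of q c] by simp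
next
qed (fact assms)

end

lemma B_A: "d \<in> B \<Longrightarrow> c \<in> A \<Longrightarrow> smoothly_related d c"
  using slice_exists slice_transition by blast

text \<open>The coordinates of \<open>d'\<close> are recovered from the ambient ones by a left inverse of the linear slice.\<close>

lemma B_B:
  assumes "d \<in> B" "d' \<in> B" shows "smoothly_related d d'"
proof -
  obtain c \<iota> where s: "slice d c \<iota>" using slice_exists assms by blast
  obtain c' \<iota>' where s': "slice d' c' \<iota>'" using slice_exists assms by blast
  have c': "c' \<in> A" "linear \<iota>'" "inj \<iota>'" using s' by (auto simp: slice_def)
  have dom: "dom_chart d \<inter> dom_chart d' = dom_chart d \<inter> dom_chart c'"
    using s s' by (auto simp: slice_def)
  obtain R where R: "linear R" "R \<circ> \<iota>' = id"
    using linear_injective_left_inverse[OF c'(2,3)] by blast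
  let ?S = "coord d ` (dom_chart d \<inter> dom_chart d')"
  have r: "smoothly_related d c'" using slice_transition[OF s c'(1)] .
  have S: "open ?S" and sm: "smooth_on ?S (transition d c')" using r by (simp_all add: dom smoothly_related_def)
  have "smooth_on ?S (transition d d')"
  proof (rule smooth_on_eqI[OF S smooth_on_linear[OF R(1) S sm]])
    fix x assume "x \<in> ?S"
    then obtain p where p: "x = coord d p" "p \<in> dom_chart d" "p \<in> dom_chart d'" by auto
    then show "transition d d' x = R (transition d c' x)"
      using transition_coord[OF slice_inj[OF s] p(2), of d'] transition_coord[OF slice_inj[OF s] p(2), of c']
        slice_coord[OF s' p(3)] R(2)
      by (simp add: fun_eq_iff)
  qed
  then show ?thesis using S slice_inj[OF s] slice_inj[OF s'] by (simp add: smoothly_related_def)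
qed

lemma A_mutual: "c \<in> A \<Longrightarrow> c' \<in> A \<Longrightarrow> p \<in> dom_chart c \<Longrightarrow> p \<in> dom_chart c' \<Longrightarrow> mutually_related c c' p"
  by (simp add: mutually_related_def A_A)

lemma B_mutual: "d \<in> B \<Longrightarrow> d' \<in> B \<Longrightarrow> p \<in> dom_chart d \<Longrightarrow> p \<in> dom_chart d' \<Longrightarrow> mutually_related d d' p"
  by (simp add: mutually_related_def B_B)

lemma tangent_inclusion_tangent_map:
  assumes "d \<in> B" "c \<in> A" "p \<in> dom_chart d" "p \<in> dom_chart c"
  shows "tangent_inclusion (tangent_map d c p)"
proof (rule tangent_inclusion.intro)
  show "linear (tangent_map d c p)" using assms by (intro linear_tangent_map B_A)
  obtain c0 \<iota> where s: "slice d c0 \<iota>" using slice_exists assms by blast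
  have c0: "c0 \<in> A" "p \<in> dom_chart c0" "inj \<iota>" using s assms by (auto simp: slice_def)
  have "tangent_map c c0 p (tangent_map d c p v) = \<iota> v" for v
    using tangent_map_chain[OF B_A A_A B_A] assms c0 tangent_map_slice[OF s assms(3)] by metis
  then show "inj (tangent_map d c p)" using c0(3) by (metis injD injI)
qed

lemma tangential_transport:
  assumes "d \<in> B" "c \<in> A" "c' \<in> A" "p \<in> dom_chart d" "p \<in> dom_chart c" "p \<in> dom_chart c'"
    and E: "E \<in> tangential (tangent_map d c p)"
  shows "gtan_transport c c' p E \<in> tangential (tangent_map d c' p)"
    and "gtan_restrict (tangent_map d c' p) (gtan_transport c c' p E) = gtan_restrict (tangent_map d c p) E"
proof -
  interpret T: tangent_inclusion "tangent_map d c p" using assms tangent_inclusion_tangent_map by blast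
  interpret T': tangent_inclusion "tangent_map d c' p" using assms tangent_inclusion_tangent_map by blast
  have rel: "mutually_related c c' p" using assms A_mutual by blast
  have 1: "tangent_map d c' p v = tangent_map c c' p (tangent_map d c p v)" for v
    using tangent_map_chain[OF B_A A_A B_A] assms by metis
  have 2: "tangent_map c' c p (tangent_map d c' p v) = tangent_map d c p v" for v
    using tangent_map_chain[OF B_A A_A B_A] assms by metis
  have f: "fst (gtan_transport c c' p E) = tangent_map d c' p (fst (gtan_restrict (tangent_map d c p) E))"
    using T.gtan_restrict_fst[OF E] by (simp add: gtan_transport_fst 1)
  then show t: "gtan_transport c c' p E \<in> tangential (tangent_map d c' p)" by (rule T'.tangentialI)
  show "gtan_restrict (tangent_map d c' p) (gtan_transport c c' p E) = gtan_restrict (tangent_map d c p) E"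
    using t f by (simp add: T'.gtan_restrict_eq_iff T.gtan_restrict_snd gtan_transport_snd[OF rel] 2)
qed

lemma annihilator_transport:
  assumes "d \<in> B" "c \<in> A" "c' \<in> A" "p \<in> dom_chart d" "p \<in> dom_chart c" "p \<in> dom_chart c'"
    and E: "E \<in> annihilator (tangent_map d c p)"
  shows "gtan_transport c c' p E \<in> annihilator (tangent_map d c' p)"
proof -
  interpret T: tangent_inclusion "tangent_map d c p" using assms tangent_inclusion_tangent_map by blast
  interpret T': tangent_inclusion "tangent_map d c' p" using assms tangent_inclusion_tangent_map by blast
  have t: "E \<in> tangential (tangent_map d c p)" using E T.annihilator_tangential by blast
  show ?thesis
    using T.gtan_restrict_eq_0_iff[OF t] E tangential_transport[OF assms(1-6) t]
      T'.gtan_restrict_eq_0_iff by metis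
qed

lemma gtan_restrict_same_gtan:
  assumes "d \<in> B" "d' \<in> B" "c \<in> A" "p \<in> dom_chart d" "p \<in> dom_chart d'" "p \<in> dom_chart c"
    and E: "E \<in> tangential (tangent_map d c p)"
  shows "E \<in> tangential (tangent_map d' c p)"
    and "gtan_restrict (tangent_map d' c p) E = gtan_transport d d' p (gtan_restrict (tangent_map d c p) E)"
proof -
  interpret T: tangent_inclusion "tangent_map d c p" using assms tangent_inclusion_tangent_map by blast
  interpret T': tangent_inclusion "tangent_map d' c p" using assms tangent_inclusion_tangent_map by blast
  have rel: "mutually_related d d' p" using assms B_mutual by blast
  have 1: "tangent_map d' c p (tangent_map d d' p v) = tangent_map d c p v" for v
    using tangent_map_chain[OF B_B B_A B_A] assms by metis
  have 2: "tangent_map d c p (tangent_map d' d p v) = tangent_map d' c p v" for v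
    using tangent_map_chain[OF B_B B_A B_A] assms by metis
  have f: "fst E = tangent_map d' c p (fst (gtan_transport d d' p (gtan_restrict (tangent_map d c p) E)))"
    using T.gtan_restrict_fst[OF E] by (simp add: gtan_transport_fst 1)
  then show t: "E \<in> tangential (tangent_map d' c p)" by (rule T'.tangentialI)
  show "gtan_restrict (tangent_map d' c p) E = gtan_transport d d' p (gtan_restrict (tangent_map d c p) E)"
    using t f by (simp add: T'.gtan_restrict_eq_iff T.gtan_restrict_snd gtan_transport_snd[OF rel] 2)
qed

end

section \<open>The splitting in a slice chart\<close>

lemma linear_blinfun_comp_right: "linear (\<lambda>L :: 'e::fin_dim_inner \<Rightarrow>\<^sub>L real. L o\<^sub>L G)"
  by (intro linearI blinfun_eqI) (simp_all add: blinfun.add_left blinfun.scaleR_left)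

text \<open>The kernel of \<open>R\<close> is a complement of the slice in the model space. Fixing it gives linear projections
  onto \<open>W\<close> and onto \<open>N\<close>, and a linear right inverse of \<open>gtan_restrict\<close>.\<close>

locale slice_inclusion = tangent_inclusion \<iota> for \<iota> :: "'f::fin_dim_inner \<Rightarrow> 'e::fin_dim_inner" +
  fixes R :: "'e \<Rightarrow> 'f"
  assumes linR: "linear R" and R: "\<And>u. R (\<iota> u) = u"
begin

lemma Blinfun_\<iota>: "blinfun_apply (Blinfun \<iota>) u = \<iota> u"
  by (simp add: bounded_linear_Blinfun_apply linear_imp_bounded_linear linT)

lemma Blinfun_R: "blinfun_apply (Blinfun R) u = R u"
  by (simp add: bounded_linear_Blinfun_apply linear_imp_bounded_linear linR)

definition tangential_projection :: "'e gtan \<Rightarrow> 'e gtan" where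
  "tangential_projection E = (\<iota> (R (fst E)), snd E)"

definition annihilator_projection :: "'e gtan \<Rightarrow> 'e gtan" where
  "annihilator_projection E = (0, snd E - (snd E o\<^sub>L Blinfun (\<iota> \<circ> R)))"

definition extension :: "'f gtan \<Rightarrow> 'e gtan" where
  "extension F = (\<iota> (fst F), snd F o\<^sub>L Blinfun R)"

text \<open>Agrees with \<open>gtan_restrict \<iota>\<close> on \<open>tangential \<iota>\<close> but is linear everywhere, since \<open>R\<close> replaces
  \<open>inv_into\<close>.\<close>

definition linear_restriction :: "'e gtan \<Rightarrow> 'f gtan" where
  "linear_restriction E = (R (fst E), snd E o\<^sub>L Blinfun \<iota>)"

lemma linear_tangential_projection: "linear tangential_projection"
  by (intro linearI prod_eqI)
    (simp_all add: tangential_projection_def linear_add[OF linR] linear_add[OF linT] linear_cmul[OF linR] linear_cmul[OF linT])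

lemma linear_extension: "linear extension"
  by (intro linearI prod_eqI)
    (simp_all add: extension_def linear_add[OF linT] linear_cmul[OF linT]
      linear_add[OF linear_blinfun_comp_right] linear_cmul[OF linear_blinfun_comp_right])

lemma linear_linear_restriction: "linear linear_restriction"
  by (intro linearI prod_eqI)
    (simp_all add: linear_restriction_def linear_add[OF linR] linear_cmul[OF linR]
      linear_add[OF linear_blinfun_comp_right] linear_cmul[OF linear_blinfun_comp_right])

lemma linear_annihilator_projection: "linear annihilator_projection"
  by (intro linearI prod_eqI)
    (simp_all add: annihilator_projection_def algebra_simps
      linear_add[OF linear_blinfun_comp_right] linear_cmul[OF linear_blinfun_comp_right])

lemma tangential_projection_in: "tangential_projection E \<in> tangential \<iota>"
  by (simp add: tangential_projection_def tangential_def)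

lemma tangential_projection_fixes: "E \<in> tangential \<iota> \<Longrightarrow> tangential_projection E = E"
  by (auto simp: tangential_projection_def tangential_def R prod_eq_iff)

lemma range_tangential_projection: "range tangential_projection = tangential \<iota>"
  using tangential_projection_in tangential_projection_fixes by (metis image_subsetI rangeI subsetI subset_antisym)

lemma annihilator_projection_apply:
  "fst (annihilator_projection E) = 0"
  "blinfun_apply (snd (annihilator_projection E)) w = blinfun_apply (snd E) w - blinfun_apply (snd E) (\<iota> (R w))"
proof -
  have "bounded_linear (\<iota> \<circ> R)" by (intro linear_imp_bounded_linear linear_compose linT linR)
  then show "blinfun_apply (snd (annihilator_projection E)) w = blinfun_apply (snd E) w - blinfun_apply (snd E) (\<iota> (R w))"
    by (simp add: annihilator_projection_def blinfun.diff_left bounded_linear_Blinfun_apply)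
qed (simp add: annihilator_projection_def)

lemma annihilator_projection_in: "annihilator_projection E \<in> annihilator \<iota>"
  by (simp add: annihilator_def annihilator_projection_apply R)

lemma annihilator_projection_fixes: "E \<in> annihilator \<iota> \<Longrightarrow> annihilator_projection E = E"
  by (intro prod_eqI blinfun_eqI) (simp_all add: annihilator_def annihilator_projection_apply)

lemma range_annihilator_projection: "range annihilator_projection = annihilator \<iota>"
  using annihilator_projection_in annihilator_projection_fixes by (metis image_subsetI rangeI subsetI subset_antisym)

lemma extension_tangential: "extension F \<in> tangential \<iota>"
  by (simp add: extension_def tangential_def)

lemma gtan_restrict_extension: "gtan_restrict \<iota> (extension F) = F"
  by (simp add: gtan_restrict_eq_iff[OF extension_tangential]) (simp add: extension_def Blinfun_R R)

lemma linear_restriction_eq: "E \<in> tangential \<iota> \<Longrightarrow> linear_restriction E = gtan_restrict \<iota> E"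
  by (rule sym) (auto simp: gtan_restrict_eq_iff linear_restriction_def Blinfun_\<iota> R tangential_def)

end

locale kaehler_family = slice_inclusion \<iota> R for \<iota> :: "'f::fin_dim_inner \<Rightarrow> 'e::fin_dim_inner" and R +
  fixes S :: "'f set" and J0 J1 :: "'f \<Rightarrow> 'e gtan \<Rightarrow> 'e gtan"
  assumes S: "open S" and J0: "smooth_family S J0" and J1: "smooth_family S J1"
    and fibre: "\<And>x. x \<in> S \<Longrightarrow> kaehler_fibre \<iota> (J0 x) (J1 x)"
begin

abbreviation "core x \<equiv> kaehler_fibre.core \<iota> (J1 x)"

text \<open>First project linearly onto \<open>W\<close>, then subtract the \<open>G\<close>-orthogonal projection onto \<open>N\<close>. As \<open>N\<close> does not depend
  on \<open>x\<close> in a slice chart, one spanning set of \<open>N\<close> serves all points.\<close>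

lemma smooth_core_projection:
  "\<exists>P. smooth_family S P \<and> (\<forall>x\<in>S. range (P x) = core x \<and> (\<forall>v\<in>core x. P x v = v) \<and>
     (\<forall>v\<in>tangential \<iota>. gtan_restrict \<iota> (P x v) = gtan_restrict \<iota> v))"
proof -
  obtain B where B: "finite B" "span B = annihilator \<iota>"
  proof (cases "S = {}")
    case False
    then show ?thesis using kaehler_fibre.annihilator_spanning[OF fibre] that by blast
  next
    case True
    obtain C :: "'e gtan set" where C: "finite C" "span C = UNIV" using finite_spanning_set by blast
    have "span (annihilator_projection ` C) = annihilator \<iota>"
      using linear_span_image[OF linear_annihilator_projection, of C] C(2) range_annihilator_projection by simp
    then show ?thesis using that[of "annihilator_projection ` C"] C(1) by simp
  qed
  let ?g = "\<lambda>x E F. gpairing (- J0 x (J1 x E)) F"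
  have smooth: "smooth_on S (\<lambda>x. ?g x E F)" for E F
  proof -
    have l: "linear (\<lambda>G. gpairing (- G) F)" by (intro linearI) (simp_all add: gpairing_simps)
    have "smooth_on S (\<lambda>x. J0 x (J1 x E))"
      using smooth_family_compose[OF S J0 J1] unfolding smooth_family_def by blast
    from smooth_on_linear[OF l S this] show ?thesis .
  qed
  obtain P where P: "smooth_family S P"
    and P_in: "\<And>x v. x \<in> S \<Longrightarrow> P x v \<in> annihilator \<iota>"
    and P_orth: "\<And>x v n. x \<in> S \<Longrightarrow> n \<in> annihilator \<iota> \<Longrightarrow> ?g x n (v - P x v) = 0"
    using smooth_orthogonal_projection[of S ?g B, OF S kaehler_fibre.metric_bilinear[OF fibre] kaehler_fibre.metric_sym[OF fibre]
        kaehler_fibre.pos[OF fibre] smooth B(1)] unfolding B(2) by blast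
  define Q where "Q x v = tangential_projection v - P x (tangential_projection v)" for x v
  have Q: "smooth_family S Q"
    unfolding Q_def
    by (intro smooth_family_diff S smooth_family_const linear_tangential_projection
        smooth_family_compose[OF S P smooth_family_const[OF linear_tangential_projection]])
  have Q_props: "range (Q x) = core x \<and> (\<forall>v\<in>core x. Q x v = v) \<and>
     (\<forall>v\<in>tangential \<iota>. gtan_restrict \<iota> (Q x v) = gtan_restrict \<iota> v)" if x: "x \<in> S" for x
  proof -
    interpret F: kaehler_fibre \<iota> "J0 x" "J1 x" using fibre x .
    have P_t: "P x v \<in> tangential \<iota>" for v using P_in[OF x] annihilator_tangential by blast
    have Q_t: "Q x v \<in> tangential \<iota>" for v
      unfolding Q_def by (intro subspace_diff[OF subspace_tangential] P_t tangential_projection_in)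
    have in_core: "Q x v \<in> F.core" for v
      using P_orth[OF x] by (simp add: F.core_iff[OF Q_t]) (simp add: Q_def)
    have fixes_core: "Q x v = v" if v: "v \<in> F.core" for v
    proof -
      have t: "v \<in> tangential \<iota>" using v by (simp add: F.core_def)
      have "?g x (P x v) (v - P x v) = 0" "?g x (P x v) v = 0"
        using P_orth[OF x P_in[OF x]] v P_in[OF x] by (auto simp: F.core_iff[OF t])
      then have "?g x (P x v) (P x v) = 0" by (simp add: gpairing_simps)
      then have "P x v = 0" using F.pos[of "P x v"] by force
      then show ?thesis using t by (simp add: Q_def tangential_projection_fixes)
    qed
    have "gtan_restrict \<iota> (Q x v) = gtan_restrict \<iota> v" if t: "v \<in> tangential \<iota>" for v
    proof -
      have "gtan_restrict \<iota> (P x v) = 0" using gtan_restrict_eq_0_iff[OF P_t] P_in[OF x] by blast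
      then show ?thesis using gtan_restrict_diff[OF t P_t] t by (simp add: Q_def tangential_projection_fixes)
    qed
    moreover have "range (Q x) = F.core"
      using in_core fixes_core by (metis image_subsetI rangeI subsetI subset_antisym)
    ultimately show ?thesis using fixes_core by blast
  qed
  show ?thesis by (intro exI[of _ Q] conjI Q ballI Q_props)
qed

lemma smooth_lift: "smooth_family S (\<lambda>x. reduction.lift \<iota> (core x))"
proof -
  obtain P where P: "smooth_family S P" and props: "\<And>x. x \<in> S \<Longrightarrow> range (P x) = core x \<and>
     (\<forall>v\<in>tangential \<iota>. gtan_restrict \<iota> (P x v) = gtan_restrict \<iota> v)"
    using smooth_core_projection by blast
  have eq: "reduction.lift \<iota> (core x) F = P x (extension F)" if x: "x \<in> S" for x F
  proof -
    interpret F: kaehler_fibre \<iota> "J0 x" "J1 x" using fibre x .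
    have "P x (extension F) \<in> F.core" using props[OF x] by blast
    moreover have "gtan_restrict \<iota> (P x (extension F)) = F"
      using props[OF x] extension_tangential gtan_restrict_extension by simp
    ultimately show ?thesis by (rule F.red0.lift_eqI)
  qed
  have "smooth_family S (\<lambda>x F. P x (extension F))"
    by (rule smooth_family_compose[OF S P smooth_family_const[OF linear_extension]])
  then have "smooth_on S (\<lambda>x. P x (extension F))" for F unfolding smooth_family_def by blast
  then have "smooth_on S (\<lambda>x. reduction.lift \<iota> (core x) F)" for F
    by (rule smooth_on_eqI[OF S]) (simp add: eq)
  moreover have "linear (reduction.lift \<iota> (core x))" if x: "x \<in> S" for x
  proof -
    interpret F: kaehler_fibre \<iota> "J0 x" "J1 x" using fibre x .
    show ?thesis by (rule F.red0.linear_lift)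
  qed
  ultimately show ?thesis by (intro smooth_familyI)
qed

lemma frame_tangential0:
  assumes "x0 \<in> S"
  shows "has_local_frame S x0 (\<lambda>x. minus_i_eigenspace (J0 x) \<inter> (tangential \<iota> \<times> tangential \<iota>))"
  unfolding range_tangential_projection[symmetric]
proof (rule eigenbundle_frame[OF S J0 smooth_family_const[OF linear_tangential_projection] _ _ _ assms])
  show "J0 x (J0 x v) = - v" if "x \<in> S" for x v using kaehler_fibre.sq0[OF fibre[OF that]] .
  show "tangential_projection (tangential_projection v) = tangential_projection v" for v
    by (intro tangential_projection_fixes tangential_projection_in)
  show "J0 x (tangential_projection v) \<in> range tangential_projection" if "x \<in> S" for x v
    unfolding range_tangential_projection
    by (intro kaehler_fibre.J0_tangential[OF fibre[OF that]] tangential_projection_in)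
qed

lemma frame_annihilator0:
  assumes "x0 \<in> S"
  shows "has_local_frame S x0 (\<lambda>x. minus_i_eigenspace (J0 x) \<inter> (annihilator \<iota> \<times> annihilator \<iota>))"
  unfolding range_annihilator_projection[symmetric]
proof (rule eigenbundle_frame[OF S J0 smooth_family_const[OF linear_annihilator_projection] _ _ _ assms])
  show "J0 x (J0 x v) = - v" if "x \<in> S" for x v using kaehler_fibre.sq0[OF fibre[OF that]] .
  show "annihilator_projection (annihilator_projection v) = annihilator_projection v" for v
    by (intro annihilator_projection_fixes annihilator_projection_in)
  show "J0 x (annihilator_projection v) \<in> range annihilator_projection" if "x \<in> S" for x v
    unfolding range_annihilator_projection
    using kaehler_fibre.con[OF fibre[OF that]] annihilator_projection_in[of v] by blast
qed

lemma frame_tangential1: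
  assumes "x0 \<in> S"
  shows "has_local_frame S x0 (\<lambda>x. minus_i_eigenspace (J1 x) \<inter> (tangential \<iota> \<times> tangential \<iota>))"
proof -
  obtain P where P: "smooth_family S P" and props: "\<And>x. x \<in> S \<Longrightarrow> range (P x) = core x \<and> (\<forall>v\<in>core x. P x v = v)"
    using smooth_core_projection by blast
  have "has_local_frame S x0 (\<lambda>x. minus_i_eigenspace (J1 x) \<inter> (range (P x) \<times> range (P x)))"
  proof (rule eigenbundle_frame[OF S J1 P _ _ _ assms])
    show "J1 x (J1 x v) = - v" if "x \<in> S" for x v using kaehler_fibre.sq1[OF fibre[OF that]] .
    show "P x (P x v) = P x v" if "x \<in> S" for x v using props[OF that] by blast
    show "J1 x (P x v) \<in> range (P x)" if x: "x \<in> S" for x v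
    proof -
      interpret F: kaehler_fibre \<iota> "J0 x" "J1 x" using fibre x .
      show ?thesis using props[OF x] F.red1.J_V by blast
    qed
  qed
  then show ?thesis
    by (rule has_local_frame_cong) (simp add: props kaehler_fibre.eigenspace1_tangential[OF fibre])
qed

end

section \<open>The Courant bracket along the submanifold\<close>

lemma courant_eq:
  assumes s: "(s has_derivative Ds) (at x)" and t: "(t has_derivative Dt) (at x)"
  shows "fst (courant s t x) = fst (Dt (fst (s x))) - fst (Ds (fst (t x)))"
    and "blinfun_apply (snd (courant s t x)) w =
      (blinfun_apply (snd (Dt (fst (s x)))) w + blinfun_apply (snd (t x)) (fst (Ds w))
       - (blinfun_apply (snd (Ds (fst (t x)))) w + blinfun_apply (snd (s x)) (fst (Dt w)))
       - (blinfun_apply (snd (Ds (fst (t x)))) w - blinfun_apply (snd (Ds w)) (fst (t x)))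
       + (blinfun_apply (snd (Dt (fst (s x)))) w - blinfun_apply (snd (Dt w)) (fst (s x)))) / 2"
proof -
  have fs: "frechet_derivative (fst \<circ> s) (at x) = (\<lambda>h. fst (Ds h))"
    and ft: "frechet_derivative (fst \<circ> t) (at x) = (\<lambda>h. fst (Dt h))"
    and ss: "frechet_derivative (snd \<circ> s) (at x) = (\<lambda>h. snd (Ds h))"
    and st: "frechet_derivative (snd \<circ> t) (at x) = (\<lambda>h. snd (Dt h))"
    using has_derivative_fst[OF s] has_derivative_fst[OF t] has_derivative_snd[OF s] has_derivative_snd[OF t]
    by (auto intro!: frechet_derivative_eqI simp: o_def)
  show "fst (courant s t x) = fst (Dt (fst (s x))) - fst (Ds (fst (t x)))"
    by (simp add: courant_def Let_def lie_bracket_def fs ft)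
  let ?F = "\<lambda>w. (blinfun_apply (snd (Dt (fst (s x)))) w + blinfun_apply (snd (t x)) (fst (Ds w))
       - (blinfun_apply (snd (Ds (fst (t x)))) w + blinfun_apply (snd (s x)) (fst (Dt w)))
       - (blinfun_apply (snd (Ds (fst (t x)))) w - blinfun_apply (snd (Ds w)) (fst (t x)))
       + (blinfun_apply (snd (Dt (fst (s x)))) w - blinfun_apply (snd (Dt w)) (fst (s x)))) / 2"
  note l = has_derivative_linear[OF s] has_derivative_linear[OF t]
  have "linear ?F"
    by (intro linearI) (simp_all add: linear_add[OF l(1)] linear_add[OF l(2)] linear_cmul[OF l(1)] linear_cmul[OF l(2)]
        blinfun.add_left blinfun.add_right blinfun.scaleR_left blinfun.scaleR_right field_simps)
  then have "blinfun_apply (Blinfun ?F) w = ?F w"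
    by (simp add: bounded_linear_Blinfun_apply linear_imp_bounded_linear)
  then show "blinfun_apply (snd (courant s t x)) w = ?F w"
    by (simp add: courant_def Let_def lie_deriv_form_def ext_deriv_def fs ft ss st)
qed

text \<open>Only derivatives along the range of \<open>T\<close> enter the restricted bracket: the vector parts of the sections
  are tangent to the submanifold, and the covector part is evaluated on tangent vectors. These derivatives
  are determined by the restricted sections.\<close>

lemma (in tangent_inclusion) courant_restrict:
  assumes U: "open U" "x \<in> U"
    and s: "(s has_derivative Ds) (at (T x))" and t: "(t has_derivative Dt) (at (T x))"
    and s': "(s' has_derivative Ds') (at x)" and t': "(t' has_derivative Dt') (at x)"
    and ss': "\<And>y. y \<in> U \<Longrightarrow> s (T y) \<in> tangential T \<and> gtan_restrict T (s (T y)) = s' y"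
    and tt': "\<And>y. y \<in> U \<Longrightarrow> t (T y) \<in> tangential T \<and> gtan_restrict T (t (T y)) = t' y"
  shows "courant s t (T x) \<in> tangential T"
    and "gtan_restrict T (courant s t (T x)) = courant s' t' x"
proof -
  have dT: "(T has_derivative T) (at x)"
    by (rule bounded_linear_imp_has_derivative[OF linear_imp_bounded_linear[OF linT]])
  have D: "fst (Dr (T h)) = T (fst (Dr' h))" "blinfun_apply (snd (Dr (T h))) (T w) = blinfun_apply (snd (Dr' h)) w"
    "fst (r (T x)) = T (fst (r' x))" "blinfun_apply (snd (r (T x))) (T w) = blinfun_apply (snd (r' x)) w"
    if r: "(r has_derivative Dr) (at (T x))" and r': "(r' has_derivative Dr') (at x)"
      and rr': "\<And>y. y \<in> U \<Longrightarrow> r (T y) \<in> tangential T \<and> gtan_restrict T (r (T y)) = r' y" for r r' Dr Dr' h w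
  proof -
    have pt: "fst (r (T y)) = T (fst (r' y))" "blinfun_apply (snd (r (T y))) (T w) = blinfun_apply (snd (r' y)) w"
      if "y \<in> U" for y w
      using rr'[OF that] gtan_restrict_eq_iff[of "r (T y)" "r' y"] by auto
    have rT: "((\<lambda>y. r (T y)) has_derivative (\<lambda>h. Dr (T h))) (at x)"
      by (rule has_derivative_compose[OF dT r])
    have "((\<lambda>y. fst (r (T y))) has_derivative (\<lambda>h. fst (Dr (T h)))) (at x)"
      by (rule has_derivative_fst[OF rT])
    moreover have "((\<lambda>y. fst (r (T y))) has_derivative (\<lambda>h. T (fst (Dr' h)))) (at x)"
    proof (rule has_derivative_transform_within_open[OF _ U])
      show "((\<lambda>y. T (fst (r' y))) has_derivative (\<lambda>h. T (fst (Dr' h)))) (at x)"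
        by (rule bounded_linear.has_derivative[OF linear_imp_bounded_linear[OF linT] has_derivative_fst[OF r']])
    qed (simp add: pt)
    ultimately show "fst (Dr (T h)) = T (fst (Dr' h))" using has_derivative_unique by metis
    have "((\<lambda>y. blinfun_apply (snd (r (T y))) (T w)) has_derivative (\<lambda>h. blinfun_apply (snd (Dr (T h))) (T w))) (at x)"
      by (rule bounded_linear.has_derivative[OF blinfun.bounded_linear_left has_derivative_snd[OF rT]])
    moreover have "((\<lambda>y. blinfun_apply (snd (r (T y))) (T w)) has_derivative (\<lambda>h. blinfun_apply (snd (Dr' h)) w)) (at x)"
    proof (rule has_derivative_transform_within_open[OF _ U])
      show "((\<lambda>y. blinfun_apply (snd (r' y)) w) has_derivative (\<lambda>h. blinfun_apply (snd (Dr' h)) w)) (at x)"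
        by (rule bounded_linear.has_derivative[OF blinfun.bounded_linear_left has_derivative_snd[OF r']])
    qed (simp add: pt)
    ultimately show "blinfun_apply (snd (Dr (T h))) (T w) = blinfun_apply (snd (Dr' h)) w"
      using has_derivative_unique by metis
    show "fst (r (T x)) = T (fst (r' x))" "blinfun_apply (snd (r (T x))) (T w) = blinfun_apply (snd (r' x)) w"
      using pt[OF U(2)] by auto
  qed
  note Ds = D[OF s s' ss'] and Dt = D[OF t t' tt']
  have f: "fst (courant s t (T x)) = T (fst (courant s' t' x))"
    by (simp add: courant_eq[OF s t] courant_eq[OF s' t'] Ds Dt linear_diff[OF linT])
  then show tan: "courant s t (T x) \<in> tangential T" by (rule tangentialI)
  have "blinfun_apply (snd (courant s' t' x)) u = blinfun_apply (snd (courant s t (T x))) (T u)" for u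
    by (simp add: courant_eq[OF s t] courant_eq[OF s' t'] Ds Dt)
  with f show "gtan_restrict T (courant s t (T x)) = courant s' t' x"
    by (simp add: gtan_restrict_eq_iff[OF tan])
qed

lemma (in tangent_inclusion) ccourant_restrict:
  assumes U: "open U" "x \<in> U"
    and s: "(s has_derivative Ds) (at (T x))" and t: "(t has_derivative Dt) (at (T x))"
    and s': "(s' has_derivative Ds') (at x)" and t': "(t' has_derivative Dt') (at x)"
    and ss': "\<And>y. y \<in> U \<Longrightarrow> s (T y) \<in> tangential T \<times> tangential T \<and> cmap (gtan_restrict T) (s (T y)) = s' y"
    and tt': "\<And>y. y \<in> U \<Longrightarrow> t (T y) \<in> tangential T \<times> tangential T \<and> cmap (gtan_restrict T) (t (T y)) = t' y"
  shows "ccourant s t (T x) \<in> tangential T \<times> tangential T"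
    and "cmap (gtan_restrict T) (ccourant s t (T x)) = ccourant s' t' x"
proof -
  have c: "fst (s (T y)) \<in> tangential T \<and> gtan_restrict T (fst (s (T y))) = fst (s' y)"
    "snd (s (T y)) \<in> tangential T \<and> gtan_restrict T (snd (s (T y))) = snd (s' y)"
    "fst (t (T y)) \<in> tangential T \<and> gtan_restrict T (fst (t (T y))) = fst (t' y)"
    "snd (t (T y)) \<in> tangential T \<and> gtan_restrict T (snd (t (T y))) = snd (t' y)" if "y \<in> U" for y
    using ss'[OF that] tt'[OF that] unfolding mem_Times_iff cmap_def
    by (metis fst_map_prod snd_map_prod)+
  note d = has_derivative_fst[OF s] has_derivative_snd[OF s] has_derivative_fst[OF t] has_derivative_snd[OF t]
  note d' = has_derivative_fst[OF s'] has_derivative_snd[OF s'] has_derivative_fst[OF t'] has_derivative_snd[OF t']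
  note ff = courant_restrict[OF U d(1) d(3) d'(1) d'(3) c(1) c(3)]
    and gg = courant_restrict[OF U d(2) d(4) d'(2) d'(4) c(2) c(4)]
    and fg = courant_restrict[OF U d(1) d(4) d'(1) d'(4) c(1) c(4)]
    and gf = courant_restrict[OF U d(2) d(3) d'(2) d'(3) c(2) c(3)]
  show "ccourant s t (T x) \<in> tangential T \<times> tangential T"
    using ff(1) gg(1) fg(1) gf(1) subspace_tangential
    by (simp add: ccourant_def o_def subspace_add subspace_diff)
  show "cmap (gtan_restrict T) (ccourant s t (T x)) = ccourant s' t' x"
    using ff gg fg gf by (simp add: ccourant_def cmap_def o_def gtan_restrict_diff gtan_restrict_add)
qed

text \<open>The extension of a section \<open>r\<close> is \<open>ext r\<close>: the lift of \<open>r\<close> to \<open>V\<close>, constant along the fibres of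
  \<open>R\<close>, projected to the eigenspaces of \<open>J\<close>. Along the slice the projection changes nothing, because
  the lift intertwines the induced structure with \<open>J\<close>.\<close>

lemma (in slice_inclusion) involutive_induced:
  fixes J :: "'e \<Rightarrow> 'e gtan \<Rightarrow> 'e gtan" and V :: "'f \<Rightarrow> 'e gtan set"
  defines "K \<equiv> \<lambda>x. reduction.induced \<iota> (J (\<iota> x)) (V x)"
  assumes W: "open W" and J: "smooth_family W J" and J2: "\<And>y E. y \<in> W \<Longrightarrow> J y (J y E) = - E"
    and inv: "\<And>U s t y. open U \<Longrightarrow> U \<subseteq> W \<Longrightarrow> smooth_on U s \<Longrightarrow> smooth_on U t \<Longrightarrow>
       (\<And>y. y \<in> U \<Longrightarrow> s y \<in> minus_i_eigenspace (J y) \<and> t y \<in> minus_i_eigenspace (J y)) \<Longrightarrow> y \<in> U \<Longrightarrow>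
       ccourant s t y \<in> minus_i_eigenspace (J y)"
    and red: "\<And>x. \<iota> x \<in> W \<Longrightarrow> reduction \<iota> (J (\<iota> x)) (V x)"
    and U: "open U" "\<iota> ` U \<subseteq> W" and lift: "smooth_family U (\<lambda>x. reduction.lift \<iota> (V x))"
    and s: "smooth_on U s" "\<And>x. x \<in> U \<Longrightarrow> s x \<in> minus_i_eigenspace (K x)"
    and t: "smooth_on U t" "\<And>x. x \<in> U \<Longrightarrow> t x \<in> minus_i_eigenspace (K x)"
    and x: "x \<in> U"
  shows "ccourant s t x \<in> minus_i_eigenspace (K x)"
proof -
  define L where "L x = reduction.lift \<iota> (V x)" for x
  define W' where "W' = R -` U \<inter> W"
  have L: "smooth_family U L" using lift by (simp add: L_def[abs_def])
  have "open (R -` U)" using U(1) linear_continuous_on[OF linear_imp_bounded_linear[OF linR]] by (rule open_vimage)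
  then have W': "open W'" "W' \<subseteq> W" using W by (auto simp: W'_def)
  have \<iota>W': "\<iota> y \<in> W'" if "y \<in> U" for y using that U(2) by (auto simp: W'_def R)
  note J' = smooth_family_subset[OF J W'(2)]
  define ext where "ext r y = minus_i_projection (J y) (cmap (L (R y)) (r (R y)))" for r y
  have ext: "smooth_on W' (ext r)" "\<And>y. y \<in> W' \<Longrightarrow> ext r y \<in> minus_i_eigenspace (J y)"
    "\<And>y. y \<in> U \<Longrightarrow> ext r (\<iota> y) \<in> tangential \<iota> \<times> tangential \<iota> \<and> cmap (gtan_restrict \<iota>) (ext r (\<iota> y)) = r y"
    if r: "smooth_on U r" "\<And>x. x \<in> U \<Longrightarrow> r x \<in> minus_i_eigenspace (K x)" for r
  proof -
    have sm: "smooth_on U (\<lambda>x. cmap (L x) (r x))"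
      by (rule smooth_family_apply[OF U(1) smooth_family_cmap[OF U(1) L] r(1)])
    have sm': "smooth_on W' (\<lambda>y. cmap (L (R y)) (r (R y)))"
      by (rule smooth_on_compose[OF sm smooth_on_linear[OF linR W'(1) smooth_on_ident] W'(1) U(1)])
        (auto simp: W'_def)
    show "smooth_on W' (ext r)"
      unfolding ext_def
      by (rule smooth_family_apply[OF W'(1) smooth_family_minus_i_projection[OF W'(1) J'] sm'])
    show "ext r y \<in> minus_i_eigenspace (J y)" if "y \<in> W'" for y
      unfolding ext_def using that W'(2) J2 smooth_family_linear[OF J]
      by (intro minus_i_projection_in) auto
    fix y assume y: "y \<in> U"
    then have \<iota>y: "\<iota> y \<in> W" using U(2) by blast
    interpret red: reduction \<iota> "J (\<iota> y)" "V y" using red[OF \<iota>y] .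
    have "cmap (L y) (r y) \<in> minus_i_eigenspace (J (\<iota> y))"
      using r(2)[OF y] red.lift_induced linear_neg[OF red.linear_lift]
      by (cases "r y") (simp add: cmap_def minus_i_eigenspace_iff L_def K_def, metis)
    then have e: "ext r (\<iota> y) = cmap (L y) (r y)" by (simp add: ext_def R minus_i_projection_fixes)
    show "ext r (\<iota> y) \<in> tangential \<iota> \<times> tangential \<iota> \<and> cmap (gtan_restrict \<iota>) (ext r (\<iota> y)) = r y"
      unfolding e using red.lift_tangential red.lift(2)
      by (cases "r y") (simp add: cmap_def L_def)
  qed
  have \<iota>x: "\<iota> x \<in> W" "\<iota> x \<in> W'" using \<iota>W'[OF x] W'(2) by auto
  interpret red: reduction \<iota> "J (\<iota> x)" "V x" using red[OF \<iota>x(1)] .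
  let ?z = "ccourant (ext s) (ext t) (\<iota> x)"
  have z: "?z \<in> minus_i_eigenspace (J (\<iota> x))"
    using inv[OF W' ext(1)[OF s] ext(1)[OF t]] ext(2)[OF s] ext(2)[OF t] \<iota>x(2) by blast
  note cr = ccourant_restrict[OF U(1) x smooth_on_has_derivative[OF ext(1)[OF s] \<iota>x(2)]
      smooth_on_has_derivative[OF ext(1)[OF t] \<iota>x(2)] smooth_on_has_derivative[OF s(1) x]
      smooth_on_has_derivative[OF t(1) x] ext(3)[OF s] ext(3)[OF t]]
  obtain a b where ab: "?z = (a, b)" by (cases ?z)
  have t: "a \<in> tangential \<iota>" "b \<in> tangential \<iota>" and J: "J (\<iota> x) a = b" "J (\<iota> x) b = - a"
    using cr(1) z by (simp_all add: ab minus_i_eigenspace_iff)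
  have "red.induced (gtan_restrict \<iota> a) = gtan_restrict \<iota> b" "red.induced (gtan_restrict \<iota> b) = - gtan_restrict \<iota> a"
    using red.induced_gtan_restrict[of a] red.induced_gtan_restrict[of b] t J subspace_neg[OF subspace_tangential]
    by (simp_all add: gtan_restrict_minus)
  then show ?thesis
    using cr(2) by (simp add: ab K_def cmap_def minus_i_eigenspace_iff flip: cr(2))
qed

section \<open>The induced structure\<close>

lemma cmap_inverse: "(\<And>v. f (g v) = v) \<Longrightarrow> cmap f (cmap g z) = z"
  by (cases z) (simp add: cmap_def)

lemma TM_cotX_eq: "TM_cotX d c p = tangential (tangent_map d c p)"
  by (simp add: TM_cotX_def tangential_def)

lemma conormal_eq: "conormal d c p = annihilator (tangent_map d c p)"
  by (simp add: conormal_def annihilator_def)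

lemma p_map_eq: "p_map d c p = gtan_restrict (tangent_map d c p)"
  by (simp add: fun_eq_iff p_map_def gtan_restrict_def)

lemma L_tan_eq:
  "L_tan J d c p = minus_i_eigenspace (J c p) \<inter> (tangential (tangent_map d c p) \<times> tangential (tangent_map d c p))"
  by (simp add: L_tan_def L_bundle_def TM_cotX_eq)

lemma L_con_eq:
  "L_con J d c p = minus_i_eigenspace (J c p) \<inter> (annihilator (tangent_map d c p) \<times> annihilator (tangent_map d c p))"
  by (simp add: L_con_def L_bundle_def conormal_eq)

context submanifold
begin

text \<open>The defining property of \<open>induced_gendo\<close> refers to all ambient charts at once. It determines a single
  endomorphism because the endomorphisms computed in two charts agree: the change of charts is compatible
  with \<open>J\<close> and with \<open>p\<close>.\<close>

lemma induced_gendo_eq: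
  assumes J: "endo_section A J" and d: "d \<in> B" "p \<in> dom_chart d"
    and red: "\<And>c. c \<in> A \<Longrightarrow> p \<in> dom_chart c \<Longrightarrow> reduction (tangent_map d c p) (J c p) (V c)"
    and c: "c \<in> A" "p \<in> dom_chart c"
  shows "induced_gendo A J d p = reduction.induced (tangent_map d c p) (J c p) (V c)"
proof -
  let ?K = "\<lambda>c. reduction.induced (tangent_map d c p) (J c p) (V c)"
  have indep: "?K c = ?K c'" if c': "c' \<in> A" "p \<in> dom_chart c'" for c'
  proof -
    interpret r: reduction "tangent_map d c p" "J c p" "V c" using red c .
    interpret r': reduction "tangent_map d c' p" "J c' p" "V c'" using red c' .
    have rel: "mutually_related c' c p" using A_mutual c c' by blast
    show ?thesis
    proof (rule r'.induced_unique, intro allI impI)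
      fix E assume E: "E \<in> tangential (tangent_map d c' p)" "J c' p E \<in> tangential (tangent_map d c' p)"
      note tr = tangential_transport[OF d(1) c'(1) c(1) d(2) c'(2) c(2)]
      have JE: "J c p (gtan_transport c' c p E) = gtan_transport c' c p (J c' p E)"
        by (rule endo_section_transport[OF J c'(1) c(1) rel])
      have "r.induced (gtan_restrict (tangent_map d c p) (gtan_transport c' c p E)) =
          gtan_restrict (tangent_map d c p) (J c p (gtan_transport c' c p E))"
        using tr(1)[OF E(1)] tr(1)[OF E(2)] by (intro r.induced_gtan_restrict) (simp_all add: JE)
      then show "r.induced (gtan_restrict (tangent_map d c' p) E) = gtan_restrict (tangent_map d c' p) (J c' p E)"
        by (simp add: JE tr(2)[OF E(1)] tr(2)[OF E(2)])
    qed
  qed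
  have cond: "(\<forall>z \<in> plus_conj (L_tan J d c' p). cmap K (cmap (p_map d c' p) z) = cmap (p_map d c' p) (cmap (J c' p) z)) \<longleftrightarrow>
      K = ?K c" if c': "c' \<in> A" "p \<in> dom_chart c'" for c' K
  proof -
    interpret r': reduction "tangent_map d c' p" "J c' p" "V c'" using red c' .
    show ?thesis
      unfolding L_tan_eq p_map_eq r'.induced_condition_iff indep[OF c']
      using r'.induced_unique r'.induced_gtan_restrict by metis
  qed
  interpret r: reduction "tangent_map d c p" "J c p" "V c" using red c .
  show ?thesis
    unfolding induced_gendo_def
  proof (rule the_equality)
    show "linear (?K c) \<and> (\<forall>c'\<in>A. p \<in> dom_chart c' \<longrightarrow> (\<forall>z \<in> plus_conj (L_tan J d c' p).
        cmap (?K c) (cmap (p_map d c' p) z) = cmap (p_map d c' p) (cmap (J c' p) z)))"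
      using r.linear_induced cond by blast
  next
    fix K assume "linear K \<and> (\<forall>c'\<in>A. p \<in> dom_chart c' \<longrightarrow> (\<forall>z \<in> plus_conj (L_tan J d c' p).
        cmap K (cmap (p_map d c' p) z) = cmap (p_map d c' p) (cmap (J c' p) z)))"
    then show "K = ?K c" using cond[OF c, of K] c by blast
  qed
qed

lemma induced_compatible:
  assumes d: "d \<in> B" "d' \<in> B" "p \<in> dom_chart d" "p \<in> dom_chart d'" and c: "c \<in> A" "p \<in> dom_chart c"
    and red: "reduction (tangent_map d c p) (J c p) V" "reduction (tangent_map d' c p) (J c p) V'"
    and same: "same_gtan d d' p E E'"
  shows "same_gtan d d' p (reduction.induced (tangent_map d c p) (J c p) V E)
    (reduction.induced (tangent_map d' c p) (J c p) V' E')"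
proof -
  interpret r: reduction "tangent_map d c p" "J c p" V using red(1) .
  interpret r': reduction "tangent_map d' c p" "J c p" V' using red(2) .
  have rel: "mutually_related d d' p" using B_mutual d by blast
  have E': "E' = gtan_transport d d' p E" using same same_gtan_iff[OF rel] by blast
  note tr = gtan_restrict_same_gtan[OF d(1,2) c(1) d(3,4) c(2)]
  have t: "r.lift E \<in> tangential (tangent_map d c p)" "J c p (r.lift E) \<in> tangential (tangent_map d c p)"
    using r.lift_tangential r.J_V[OF r.lift(1)] r.V_tangential by blast+
  have "E' = gtan_restrict (tangent_map d' c p) (r.lift E)" using tr(2)[OF t(1)] r.lift(2) E' by simp
  then have "r'.induced E' = gtan_restrict (tangent_map d' c p) (J c p (r.lift E))"
    using r'.induced_gtan_restrict[OF tr(1)[OF t(1)] tr(1)[OF t(2)]] by simp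
  also have "\<dots> = gtan_transport d d' p (r.induced E)" using tr(2)[OF t(2)] by (simp add: r.induced_def)
  finally show ?thesis using same_gtan_iff[OF rel] by blast
qed

lemma slice_coord_inv:
  assumes s: "slice d c \<iota>" and x: "x \<in> coord d ` dom_chart d"
  shows "coord_inv c (\<iota> x) = coord_inv d x" "coord_inv d x \<in> dom_chart d" "coord_inv d x \<in> dom_chart c"
    "coord d (coord_inv d x) = x" "coord c (coord_inv d x) = \<iota> x" "\<iota> x \<in> coord c ` dom_chart c"
proof -
  obtain p where p: "x = coord d p" "p \<in> dom_chart d" using x by blast
  have pd: "coord_inv d x = p" using coord_inv_coord[OF slice_inj[OF s] p(2)] p(1) by simp
  have c: "c \<in> A" "p \<in> dom_chart c" "coord c p = \<iota> x" using s p slice_coord[OF s p(2)] by (auto simp: slice_def)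
  have "coord_inv c (\<iota> x) = p" using coord_inv_coord[OF A_inj[OF c(1)] c(2)] c(3) by simp
  then show "coord_inv c (\<iota> x) = coord_inv d x" "coord_inv d x \<in> dom_chart d" "coord_inv d x \<in> dom_chart c"
    "coord d (coord_inv d x) = x" "coord c (coord_inv d x) = \<iota> x" "\<iota> x \<in> coord c ` dom_chart c"
    using pd p c by auto (metis imageI)
qed

lemma slice_image_dom:
  assumes s: "slice d c \<iota>" shows "coord d ` dom_chart d = \<iota> -` (coord c ` dom_chart c)"
  using slice_image[OF s, of UNIV] by simp

lemma open_slice_image:
  assumes s: "slice d c \<iota>" shows "open (coord d ` dom_chart d)"
proof -
  have "smoothly_related d d" using s B_B by (simp add: slice_def)
  then show ?thesis by (simp add: smoothly_related_def)
qed

lemma open_A_image: "c \<in> A \<Longrightarrow> open (coord c ` dom_chart c)"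
  using A_chart by (simp add: is_chart_def)

lemma smooth_family_ambient:
  assumes "endo_section A J" "c \<in> A"
  shows "smooth_family (coord c ` dom_chart c) (\<lambda>y. J c (coord_inv c y))"
  using assms coord_inv_coord[OF A_inj[OF assms(2)]] unfolding endo_section_def smooth_family_def by force

lemma smooth_family_slice:
  assumes J: "endo_section A J" and s: "slice d c \<iota>"
  shows "smooth_family (coord d ` dom_chart d) (\<lambda>x. J c (coord_inv c (\<iota> x)))"
proof -
  have c: "c \<in> A" "linear \<iota>" using s by (auto simp: slice_def)
  have im: "\<iota> ` (coord d ` dom_chart d) \<subseteq> coord c ` dom_chart c" using slice_image_dom[OF s] by blast
  note amb = smooth_family_ambient[OF J c(1)]
  show ?thesis
  proof (rule smooth_familyI)
    show "linear (J c (coord_inv c (\<iota> x)))" if "x \<in> coord d ` dom_chart d" for x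
      using smooth_family_linear[OF amb] im that by blast
    show "smooth_on (coord d ` dom_chart d) (\<lambda>x. J c (coord_inv c (\<iota> x)) E)" for E
    proof (rule smooth_on_compose[OF _ smooth_on_linear[OF c(2) open_slice_image[OF s] smooth_on_ident]
          open_slice_image[OF s] open_A_image[OF c(1)] im])
      show "smooth_on (coord c ` dom_chart c) (\<lambda>y. J c (coord_inv c y) E)"
        using amb unfolding smooth_family_def by blast
    qed
  qed
qed

text \<open>A frame in a slice chart is transported to any other ambient chart by \<open>gtan_transport\<close>, which commutes
  with \<open>J\<close> and preserves the family \<open>Z\<close> of real subspaces.\<close>

lemma complex_subbundle_from_slices:
  fixes Z :: "('a, 'f) chart \<Rightarrow> ('a, 'e) chart \<Rightarrow> 'a \<Rightarrow> 'e gtan set"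
  assumes J: "endo_section A J"
    and Z: "\<And>d c c' p E. d \<in> B \<Longrightarrow> c \<in> A \<Longrightarrow> c' \<in> A \<Longrightarrow> p \<in> dom_chart d \<Longrightarrow> p \<in> dom_chart c \<Longrightarrow> p \<in> dom_chart c' \<Longrightarrow>
      E \<in> Z d c p \<Longrightarrow> gtan_transport c c' p E \<in> Z d c' p"
    and frame: "\<And>d c \<iota> x0. slice d c \<iota> \<Longrightarrow> x0 \<in> coord d ` dom_chart d \<Longrightarrow>
      has_local_frame (coord d ` dom_chart d) x0
        (\<lambda>x. minus_i_eigenspace (J c (coord_inv c (\<iota> x))) \<inter> (Z d c (coord_inv c (\<iota> x)) \<times> Z d c (coord_inv c (\<iota> x))))"
    and F: "\<And>d c p. F d c p = minus_i_eigenspace (J c p) \<inter> (Z d c p \<times> Z d c p)"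
  shows "complex_subbundle A B F"
  unfolding complex_subbundle_def
proof (intro ballI)
  fix c d p assume c: "c \<in> A" and d: "d \<in> B" and "p \<in> dom_chart c \<inter> dom_chart d"
  then have p: "p \<in> dom_chart c" "p \<in> dom_chart d" by auto
  obtain c0 \<iota> where s: "slice d c0 \<iota>" using slice_exists d by blast
  have c0: "c0 \<in> A" and \<iota>: "linear \<iota>" using s by (auto simp: slice_def)
  have "has_local_frame (coord d ` dom_chart d) (coord d p) (\<lambda>x. F d c0 (coord_inv d x))"
    by (rule has_local_frame_cong[OF frame[OF s imageI[OF p(2)]]]) (simp add: F slice_coord_inv(1)[OF s])
  then obtain V0 f and k :: nat where V0: "open V0" "coord d p \<in> V0" "V0 \<subseteq> coord d ` dom_chart d"
    and f: "\<forall>j<k. smooth_on V0 (f j)"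
    and bij: "\<forall>x\<in>V0. bij_betw (\<lambda>a. \<Sum>j<k. cscale (a j) (f j x)) ({..<k} \<rightarrow>\<^sub>E UNIV) (F d c0 (coord_inv d x))"
    unfolding has_local_frame_def by (elim exE conjE) (rule that)
  define V where "V = V0 \<inter> coord d ` (dom_chart d \<inter> dom_chart c)"
  have "open (coord d ` (dom_chart d \<inter> dom_chart c))" using B_A[OF d c] by (simp add: smoothly_related_def)
  then have V: "open V" "coord d p \<in> V" "V \<subseteq> V0" "V \<subseteq> coord d ` (dom_chart c \<inter> dom_chart d)"
    using V0 p by (auto simp: V_def)
  have VS: "x \<in> coord d ` dom_chart d" if "x \<in> V" for x using that V(4) by blast
  have in_c: "coord_inv d x \<in> dom_chart c" if x: "x \<in> V" for x
  proof -
    obtain q where "x = coord d q" "q \<in> dom_chart c" "q \<in> dom_chart d" using x V(4) by blast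
    then show ?thesis using coord_inv_coord[OF slice_inj[OF s]] by simp
  qed
  have rel: "mutually_related c0 c (coord_inv d x)" if "x \<in> V" for x
    using A_mutual[OF c0 c] slice_coord_inv(3)[OF s VS[OF that]] in_c[OF that] by blast
  have tr: "smooth_family V (\<lambda>x. gtan_transport c0 c (coord_inv d x))"
  proof (rule smooth_family_gtan_transport[OF V(1) rel])
    show "smooth_on V (\<lambda>x. coord c0 (coord_inv d x))"
      by (rule smooth_on_eqI[OF V(1) smooth_on_linear[OF \<iota> V(1) smooth_on_ident]])
        (simp add: slice_coord_inv(5)[OF s VS])
  qed
  define g where "g j x = cmap (gtan_transport c0 c (coord_inv d x)) (f j x)" for j x
  have "smooth_on V (g j)" if "j < k" for j
    unfolding g_def
    by (rule smooth_family_apply[OF V(1) smooth_family_cmap[OF V(1) tr] smooth_on_subset[OF f[rule_format, OF that] V(3)]])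
  moreover have "bij_betw (\<lambda>a. \<Sum>j<k. cscale (a j) (g j x)) ({..<k} \<rightarrow>\<^sub>E UNIV) (F d c (coord_inv d x))" if x: "x \<in> V" for x
  proof -
    let ?q = "coord_inv d x"
    let ?T = "gtan_transport c0 c ?q" and ?T' = "gtan_transport c c0 ?q"
    note rx = rel[OF x] and rx' = mutually_related_sym[OF rel[OF x]]
    have q: "?q \<in> dom_chart d" "?q \<in> dom_chart c0" using slice_coord_inv[OF s VS[OF x]] by auto
    have qc: "?q \<in> dom_chart c" by (rule in_c[OF x])
    have lin: "linear ?T" using linear_gtan_transport[OF rx] .
    have maps: "cmap (gtan_transport a b ?q) z \<in> F d b ?q"
      if ab: "a \<in> A" "b \<in> A" "?q \<in> dom_chart a" "?q \<in> dom_chart b" and z: "z \<in> F d a ?q" for a b z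
    proof -
      have r: "mutually_related a b ?q" using A_mutual ab by blast
      obtain u v where uv: "z = (u, v)" "u \<in> Z d a ?q" "v \<in> Z d a ?q" "J a ?q u = v" "J a ?q v = - u"
        using z by (cases z) (auto simp: F minus_i_eigenspace_iff)
      note e = endo_section_transport[OF J ab(1,2) r]
      show ?thesis
        using Z[OF d ab(1,2) q(1) ab(3,4)] uv linear_neg[OF linear_gtan_transport[OF r], of u]
        by (simp add: F cmap_def minus_i_eigenspace_iff e)
    qed
    have bij_T: "bij_betw (cmap ?T) (F d c0 ?q) (F d c ?q)"
    proof (rule bij_betw_byWitness[where f' = "cmap ?T'"])
      show "\<forall>z\<in>F d c0 ?q. cmap ?T' (cmap ?T z) = z"
        using cmap_inverse[of ?T' ?T] gtan_transport_inverse[OF rx] by blast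
      show "\<forall>z\<in>F d c ?q. cmap ?T (cmap ?T' z) = z"
        using cmap_inverse[of ?T ?T'] gtan_transport_inverse[OF rx'] by blast
      show "cmap ?T ` F d c0 ?q \<subseteq> F d c ?q" using maps[OF c0 c q(2) qc] by blast
      show "cmap ?T' ` F d c ?q \<subseteq> F d c0 ?q" using maps[OF c c0 qc q(2)] by blast
    qed
    from bij_betw_trans[OF bij[rule_format, OF subsetD[OF V(3) x]] bij_T] show ?thesis
      by (simp add: o_def g_def linear_sum[OF linear_cmap[OF lin]] cmap_cscale[OF lin])
  qed
  ultimately show "\<exists>V (k::nat) s. open V \<and> coord d p \<in> V \<and> V \<subseteq> coord d ` (dom_chart c \<inter> dom_chart d) \<and>
          (\<forall>j<k. smooth_on V (s j)) \<and>
          (\<forall>x\<in>V. bij_betw (\<lambda>a. \<Sum>j<k. cscale (a j) (s j x)) ({..<k} \<rightarrow>\<^sub>E UNIV) (F d c (coord_inv d x)))"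
    using V by (intro exI[of _ V] exI[of _ k] exI[of _ g]) blast
qed

end

locale kaehler_submanifold = submanifold X A M B
  for X :: "'a topology" and A :: "('a, 'e::fin_dim_inner) chart set"
    and M :: "'a set" and B :: "('a, 'f::fin_dim_inner) chart set" +
  fixes J0 J1 :: "('a, 'e) gendo"
  assumes kaehler: "generalized_Kaehler A J0 J1"
    and conormal_invariant: "\<And>c d p. c \<in> A \<Longrightarrow> d \<in> B \<Longrightarrow> p \<in> dom_chart c \<Longrightarrow> p \<in> dom_chart d \<Longrightarrow>
      J0 c p ` annihilator (tangent_map d c p) = annihilator (tangent_map d c p)"
begin

lemma sections: "endo_section A J0" "endo_section A J1"
  using kaehler by (auto simp: generalized_Kaehler_def generalized_complex_def almost_generalized_complex_def SO_section_def)

lemma kaehler_fibre_at: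
  assumes "d \<in> B" "c \<in> A" "p \<in> dom_chart d" "p \<in> dom_chart c"
  shows "kaehler_fibre (tangent_map d c p) (J0 c p) (J1 c p)"
proof (intro kaehler_fibre.intro kaehler_fibre_axioms.intro tangent_inclusion_tangent_map assms conormal_invariant)
  have agc: "almost_generalized_complex A J0" "almost_generalized_complex A J1"
    and comm: "\<forall>c\<in>A. \<forall>p\<in>dom_chart c. \<forall>E. J0 c p (J1 c p E) = J1 c p (J0 c p E)"
    and metric: "generalized_metric A (\<lambda>c p E. - J0 c p (J1 c p E))"
    using kaehler unfolding generalized_Kaehler_def generalized_complex_def by blast+
  have J: "linear (J c p) \<and> (\<forall>E. J c p (J c p E) = - E) \<and> (\<forall>E F. gpairing (J c p E) (J c p F) = gpairing E F)"
    if "almost_generalized_complex A J" for J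
  proof -
    have lin: "\<forall>c\<in>A. \<forall>p\<in>dom_chart c. linear (J c p)"
      and iso: "\<forall>c\<in>A. \<forall>p\<in>dom_chart c. (\<forall>E F. gpairing (J c p E) (J c p F) = gpairing E F) \<and> endo_has_det (J c p) 1"
      and sq: "\<forall>c\<in>A. \<forall>p\<in>dom_chart c. \<forall>E. J c p (J c p E) = - E"
      using that unfolding almost_generalized_complex_def SO_section_def endo_section_def by - (elim conjE, assumption)+
    show ?thesis
      using bspec[OF bspec[OF lin assms(2)] assms(4)] bspec[OF bspec[OF iso assms(2)] assms(4)]
        bspec[OF bspec[OF sq assms(2)] assms(4)] by blast
  qed
  show "linear (J0 c p)" "linear (J1 c p)" using J[OF agc(1)] J[OF agc(2)] by blast+
  show "J0 c p (J0 c p E) = - E" "J1 c p (J1 c p E) = - E" for E using J[OF agc(1)] J[OF agc(2)] by blast+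
  show "gpairing (J0 c p E) (J0 c p F) = gpairing E F" "gpairing (J1 c p E) (J1 c p F) = gpairing E F" for E F
    using J[OF agc(1)] J[OF agc(2)] by blast+
  show "J0 c p (J1 c p E) = J1 c p (J0 c p E)" for E using bspec[OF bspec[OF comm assms(2)] assms(4)] by blast
  have "\<forall>c\<in>A. \<forall>p\<in>dom_chart c. (\<forall>E. - J0 c p (J1 c p (- J0 c p (J1 c p E))) = E) \<and>
      (\<forall>E. E \<noteq> 0 \<longrightarrow> gpairing (- J0 c p (J1 c p E)) E > 0)"
    using metric unfolding generalized_metric_def by (elim conjE)
  from bspec[OF bspec[OF this assms(2)] assms(4)]
  show "0 < gpairing (- J0 c p (J1 c p E)) E" if "E \<noteq> 0" for E using that by blast
qed

abbreviation "K0 \<equiv> induced_gendo A J0 :: ('a, 'f) gendo"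
abbreviation "K1 \<equiv> induced_gendo A J1 :: ('a, 'f) gendo"
abbreviation "core_at d c p \<equiv> kaehler_fibre.core (tangent_map d c p) (J1 c p)"

lemma reductions:
  assumes "d \<in> B" "c \<in> A" "p \<in> dom_chart d" "p \<in> dom_chart c"
  shows "reduction (tangent_map d c p) (J0 c p) (core_at d c p)"
    "reduction (tangent_map d c p) (J1 c p) (core_at d c p)"
proof -
  interpret kaehler_fibre "tangent_map d c p" "J0 c p" "J1 c p" using kaehler_fibre_at assms .
  show "reduction (tangent_map d c p) (J0 c p) (core_at d c p)"
    "reduction (tangent_map d c p) (J1 c p) (core_at d c p)"
    by (rule red0.reduction_axioms red1.reduction_axioms)+
qed

lemma K_eq:
  assumes "d \<in> B" "c \<in> A" "p \<in> dom_chart d" "p \<in> dom_chart c"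
  shows "K0 d p = reduction.induced (tangent_map d c p) (J0 c p) (core_at d c p)"
    "K1 d p = reduction.induced (tangent_map d c p) (J1 c p) (core_at d c p)"
  using induced_gendo_eq[OF sections(1) assms(1,3), of "\<lambda>c. core_at d c p"]
    induced_gendo_eq[OF sections(2) assms(1,3), of "\<lambda>c. core_at d c p"] reductions assms by blast+

lemma ambient_chart:
  assumes "d \<in> B" "p \<in> dom_chart d"
  obtains c where "c \<in> A" "p \<in> dom_chart c"
  using slice_exists[OF assms(1)] assms(2) by (auto simp: slice_def)

lemma K_algebra:
  assumes "d \<in> B" "p \<in> dom_chart d"
  shows "linear (K0 d p)" "linear (K1 d p)" "K0 d p (K0 d p E) = - E" "K1 d p (K1 d p E) = - E"
    "K0 d p (K1 d p E) = K1 d p (K0 d p E)"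
    "gpairing (K0 d p E) (K0 d p F) = gpairing E F" "gpairing (K1 d p E) (K1 d p F) = gpairing E F"
    "E \<noteq> 0 \<Longrightarrow> 0 < gpairing (- K0 d p (K1 d p E)) E"
proof -
  obtain c where c: "c \<in> A" "p \<in> dom_chart c" using ambient_chart assms by blast
  interpret F: kaehler_fibre "tangent_map d c p" "J0 c p" "J1 c p" using kaehler_fibre_at assms c by blast
  note K = K_eq[OF assms(1) c(1) assms(2) c(2)]
  show "linear (K0 d p)" "linear (K1 d p)" "K0 d p (K0 d p E) = - E" "K1 d p (K1 d p E) = - E"
    "K0 d p (K1 d p E) = K1 d p (K0 d p E)"
    "gpairing (K0 d p E) (K0 d p F) = gpairing E F" "gpairing (K1 d p E) (K1 d p F) = gpairing E F"
    "E \<noteq> 0 \<Longrightarrow> 0 < gpairing (- K0 d p (K1 d p E)) E"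
    unfolding K
    by (rule F.red0.linear_induced F.red1.linear_induced F.red0.induced_square F.red1.induced_square
        F.induced_comm F.induced_iso0 F.induced_iso1 | erule F.induced_pos)+
qed

lemma K_compatible:
  assumes "d \<in> B" "d' \<in> B" "p \<in> dom_chart d" "p \<in> dom_chart d'" "same_gtan d d' p E E'"
  shows "same_gtan d d' p (K0 d p E) (K0 d' p E')" "same_gtan d d' p (K1 d p E) (K1 d' p E')"
proof -
  obtain c where c: "c \<in> A" "p \<in> dom_chart c" using ambient_chart assms by blast
  note r = reductions[OF assms(1) c(1) assms(3) c(2)] and r' = reductions[OF assms(2) c(1) assms(4) c(2)]
  show "same_gtan d d' p (K0 d p E) (K0 d' p E')" "same_gtan d d' p (K1 d p E) (K1 d' p E')"
    using induced_compatible[of d d' p c J0, OF assms(1-4) c r(1) r'(1) assms(5)]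
      induced_compatible[of d d' p c J1, OF assms(1-4) c r(2) r'(2) assms(5)]
    by (simp_all only: K_eq[OF assms(1) c(1) assms(3) c(2)] K_eq[OF assms(2) c(1) assms(4) c(2)])
qed

lemma kaehler_family_slice:
  assumes s: "slice d c \<iota>"
  obtains R where "kaehler_family \<iota> R (coord d ` dom_chart d)
    (\<lambda>x. J0 c (coord_inv c (\<iota> x))) (\<lambda>x. J1 c (coord_inv c (\<iota> x)))"
proof -
  have \<iota>: "linear \<iota>" "inj \<iota>" and c: "c \<in> A" and d: "d \<in> B" using s by (auto simp: slice_def)
  obtain R where R: "linear R" "R \<circ> \<iota> = id" using linear_injective_left_inverse[OF \<iota>] by blast
  have "R (\<iota> u) = u" for u using R(2) by (metis comp_apply id_apply)
  moreover have "kaehler_fibre \<iota> (J0 c (coord_inv c (\<iota> x))) (J1 c (coord_inv c (\<iota> x)))"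
    if "x \<in> coord d ` dom_chart d" for x
    using kaehler_fibre_at[OF d c] slice_coord_inv[OF s that] tangent_map_slice[OF s] by metis
  ultimately have "kaehler_family \<iota> R (coord d ` dom_chart d)
    (\<lambda>x. J0 c (coord_inv c (\<iota> x))) (\<lambda>x. J1 c (coord_inv c (\<iota> x)))"
    by (intro kaehler_family.intro kaehler_family_axioms.intro slice_inclusion.intro slice_inclusion_axioms.intro
        tangent_inclusion.intro \<iota> R(1) open_slice_image[OF s] smooth_family_slice[OF _ s] sections)
  then show thesis by (rule that)
qed

lemma complex_subbundle_L:
  "complex_subbundle A B (L_tan J0)" "complex_subbundle A B (L_con J0)"
  "complex_subbundle A B (L_tan J1)" "complex_subbundle A B (L_con J1)"
proof -
  let ?S = "\<lambda>d. coord d ` dom_chart d"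
  have frames: "has_local_frame (?S d) x0 (\<lambda>x. minus_i_eigenspace (J0 c (coord_inv c (\<iota> x))) \<inter>
        (tangential (tangent_map d c (coord_inv c (\<iota> x))) \<times> tangential (tangent_map d c (coord_inv c (\<iota> x)))))"
      "has_local_frame (?S d) x0 (\<lambda>x. minus_i_eigenspace (J0 c (coord_inv c (\<iota> x))) \<inter>
        (annihilator (tangent_map d c (coord_inv c (\<iota> x))) \<times> annihilator (tangent_map d c (coord_inv c (\<iota> x)))))"
      "has_local_frame (?S d) x0 (\<lambda>x. minus_i_eigenspace (J1 c (coord_inv c (\<iota> x))) \<inter>
        (tangential (tangent_map d c (coord_inv c (\<iota> x))) \<times> tangential (tangent_map d c (coord_inv c (\<iota> x)))))"
      "has_local_frame (?S d) x0 (\<lambda>x. minus_i_eigenspace (J1 c (coord_inv c (\<iota> x))) \<inter>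
        (annihilator (tangent_map d c (coord_inv c (\<iota> x))) \<times> annihilator (tangent_map d c (coord_inv c (\<iota> x)))))"
    if s: "slice d c \<iota>" and x0: "x0 \<in> ?S d" for d c \<iota> x0
  proof -
    obtain R where R: "kaehler_family \<iota> R (?S d) (\<lambda>x. J0 c (coord_inv c (\<iota> x))) (\<lambda>x. J1 c (coord_inv c (\<iota> x)))"
      by (rule kaehler_family_slice[OF s])
    have T: "tangent_map d c (coord_inv c (\<iota> x)) = \<iota>" if "x \<in> ?S d" for x
      using tangent_map_slice[OF s] slice_coord_inv(1,2)[OF s that] by simp
    show "has_local_frame (?S d) x0 (\<lambda>x. minus_i_eigenspace (J0 c (coord_inv c (\<iota> x))) \<inter>
        (tangential (tangent_map d c (coord_inv c (\<iota> x))) \<times> tangential (tangent_map d c (coord_inv c (\<iota> x)))))"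
      by (rule has_local_frame_cong[OF kaehler_family.frame_tangential0[OF R x0]]) (simp add: T)
    show "has_local_frame (?S d) x0 (\<lambda>x. minus_i_eigenspace (J0 c (coord_inv c (\<iota> x))) \<inter>
        (annihilator (tangent_map d c (coord_inv c (\<iota> x))) \<times> annihilator (tangent_map d c (coord_inv c (\<iota> x)))))"
      by (rule has_local_frame_cong[OF kaehler_family.frame_annihilator0[OF R x0]]) (simp add: T)
    show "has_local_frame (?S d) x0 (\<lambda>x. minus_i_eigenspace (J1 c (coord_inv c (\<iota> x))) \<inter>
        (tangential (tangent_map d c (coord_inv c (\<iota> x))) \<times> tangential (tangent_map d c (coord_inv c (\<iota> x)))))"
      by (rule has_local_frame_cong[OF kaehler_family.frame_tangential1[OF R x0]]) (simp add: T)
    \<comment> \<open>\<open>L(N\<^sup>*)\<close> is zero for \<open>J\<^sub>1\<close>; a zero bundle has the empty frame.\<close>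
    have "has_local_frame (?S d) x0 (\<lambda>x. {0 :: 'e gtan \<times> 'e gtan})"
      unfolding has_local_frame_def
      by (intro exI[of _ "?S d"] exI[of _ "0 :: nat"] exI[of _ "\<lambda>j x. 0"])
        (simp add: open_slice_image[OF s] x0 bij_betw_def)
    then show "has_local_frame (?S d) x0 (\<lambda>x. minus_i_eigenspace (J1 c (coord_inv c (\<iota> x))) \<inter>
        (annihilator (tangent_map d c (coord_inv c (\<iota> x))) \<times> annihilator (tangent_map d c (coord_inv c (\<iota> x)))))"
      by (rule has_local_frame_cong)
        (simp add: T kaehler_fibre.eigenspace1_annihilator[OF kaehler_family.fibre[OF R]])
  qed
  show "complex_subbundle A B (L_tan J0)"
    by (rule complex_subbundle_from_slices[where J = J0 and Z = "\<lambda>d c p. tangential (tangent_map d c p)"])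
      (fact sections tangential_transport(1) frames L_tan_eq)+
  show "complex_subbundle A B (L_con J0)"
    by (rule complex_subbundle_from_slices[where J = J0 and Z = "\<lambda>d c p. annihilator (tangent_map d c p)"])
      (fact sections annihilator_transport frames L_con_eq)+
  show "complex_subbundle A B (L_tan J1)"
    by (rule complex_subbundle_from_slices[where J = J1 and Z = "\<lambda>d c p. tangential (tangent_map d c p)"])
      (fact sections tangential_transport(1) frames L_tan_eq)+
  show "complex_subbundle A B (L_con J1)"
    by (rule complex_subbundle_from_slices[where J = J1 and Z = "\<lambda>d c p. annihilator (tangent_map d c p)"])
      (fact sections annihilator_transport frames L_con_eq)+
qed

lemma J_submanifolds: "J_submanifold A B J0" "J_submanifold A B J1"
proof -
  have "{z \<in> plus_conj (L_tan J d c p). cmap (p_map d c p) z = 0} = plus_conj (L_con J d c p) \<and>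
        cmap (p_map d c p) ` plus_conj (L_tan J d c p) = UNIV"
    if "J = J0 \<or> J = J1" "c \<in> A" "d \<in> B" "p \<in> dom_chart c \<inter> dom_chart d" for J c d p
  proof -
    have "reduction (tangent_map d c p) (J c p) (core_at d c p)"
      using reductions[of d c p] that by auto
    then interpret r: reduction "tangent_map d c p" "J c p" "core_at d c p" .
    show ?thesis unfolding L_tan_eq L_con_eq p_map_eq by (intro conjI r.exact_kernel r.exact_surj)
  qed
  then show "J_submanifold A B J0" "J_submanifold A B J1"
    unfolding J_submanifold_def using complex_subbundle_L by blast+
qed

lemma smooth_K:
  assumes d: "d \<in> B"
  shows "smooth_on (coord d ` dom_chart d) (\<lambda>x. K0 d (coord_inv d x) E)"
    and "smooth_on (coord d ` dom_chart d) (\<lambda>x. K1 d (coord_inv d x) E)"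
proof -
  obtain c \<iota> where s: "slice d c \<iota>" using slice_exists d by blast
  have c: "c \<in> A" using s by (simp add: slice_def)
  let ?S = "coord d ` dom_chart d"
  obtain R where "kaehler_family \<iota> R ?S (\<lambda>x. J0 c (coord_inv c (\<iota> x))) (\<lambda>x. J1 c (coord_inv c (\<iota> x)))"
    by (rule kaehler_family_slice[OF s])
  then interpret F: kaehler_family \<iota> R ?S "\<lambda>x. J0 c (coord_inv c (\<iota> x))" "\<lambda>x. J1 c (coord_inv c (\<iota> x))" .
  \<comment> \<open>In a slice chart an induced structure is a linear restriction after \<open>J\<close> after the smooth lift.\<close>
  have *: "smooth_on ?S (\<lambda>x. K d (coord_inv d x) E)"
    if J: "smooth_family ?S (\<lambda>x. J c (coord_inv c (\<iota> x)))"
      and K: "\<And>p. p \<in> dom_chart d \<Longrightarrow> p \<in> dom_chart c \<Longrightarrow>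
          K d p = reduction.induced (tangent_map d c p) (J c p) (core_at d c p)"
      and red: "\<And>p. p \<in> dom_chart d \<Longrightarrow> p \<in> dom_chart c \<Longrightarrow>
          reduction (tangent_map d c p) (J c p) (core_at d c p)" for J and K :: "('a, 'f) gendo"
  proof (rule smooth_on_eqI[OF F.S])
    let ?lift = "\<lambda>x. reduction.lift \<iota> (F.core x)"
    have "smooth_on ?S (\<lambda>x. ?lift x E)" using F.smooth_lift unfolding smooth_family_def by blast
    then have "smooth_on ?S (\<lambda>x. J c (coord_inv c (\<iota> x)) (?lift x E))"
      by (rule smooth_family_apply[OF F.S J])
    then show "smooth_on ?S (\<lambda>x. F.linear_restriction (J c (coord_inv c (\<iota> x)) (?lift x E)))"
      by (rule smooth_on_linear[OF F.linear_linear_restriction F.S])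
  next
    fix x assume x: "x \<in> ?S"
    note ci = slice_coord_inv[OF s x]
    have T: "tangent_map d c (coord_inv d x) = \<iota>" by (rule tangent_map_slice[OF s ci(2)])
    have "reduction \<iota> (J c (coord_inv d x)) (F.core x)" using red[OF ci(2,3)] by (simp add: T ci(1))
    then interpret r: reduction \<iota> "J c (coord_inv d x)" "F.core x" .
    have "J c (coord_inv d x) (r.lift E) \<in> tangential \<iota>"
      using r.J_V[OF r.lift(1)] r.V_tangential by blast
    then show "K d (coord_inv d x) E = F.linear_restriction (J c (coord_inv c (\<iota> x)) (reduction.lift \<iota> (F.core x) E))"
      using K[OF ci(2,3)] r.induced_def[of E] by (simp add: T ci(1) F.linear_restriction_eq)
  qed
  show "smooth_on ?S (\<lambda>x. K0 d (coord_inv d x) E)"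
    by (rule *[of J0 K0, OF F.J0]) (use K_eq(1)[OF d c] reductions(1)[OF d c] in blast)+
  show "smooth_on ?S (\<lambda>x. K1 d (coord_inv d x) E)"
    by (rule *[of J1 K1, OF F.J1]) (use K_eq(2)[OF d c] reductions(2)[OF d c] in blast)+
qed

lemma endo_sections: "endo_section B K0" "endo_section B K1"
  unfolding endo_section_def using K_algebra(1,2) smooth_K K_compatible by blast+

lemma endo_section_metric: "endo_section B (\<lambda>d p E. - K0 d p (K1 d p E))"
  unfolding endo_section_def
proof (intro conjI ballI allI impI)
  fix d p assume d: "d \<in> B" "p \<in> dom_chart d"
  show "linear (\<lambda>E. - K0 d p (K1 d p E))"
    using linear_compose_neg[OF linear_compose[OF K_algebra(2)[OF d] K_algebra(1)[OF d]]] by (simp add: o_def)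
next
  fix d E assume d: "d \<in> B"
  obtain c \<iota> where s: "slice d c \<iota>" using slice_exists d by blast
  let ?S = "coord d ` dom_chart d"
  note S = open_slice_image[OF s]
  have "smooth_family ?S (\<lambda>x. K0 d (coord_inv d x))"
    by (intro smooth_familyI K_algebra(1)[OF d slice_coord_inv(2)[OF s]] smooth_K(1)[OF d])
  from smooth_on_minus[OF S smooth_family_apply[OF S this smooth_K(2)[OF d]]]
  show "smooth_on ?S (\<lambda>x. - K0 d (coord_inv d x) (K1 d (coord_inv d x) E))" .
next
  fix d d' p E E' assume d: "d \<in> B" "d' \<in> B" and p: "p \<in> dom_chart d \<inter> dom_chart d'"
    and same: "same_gtan d d' p E E'"
  have p': "p \<in> dom_chart d" "p \<in> dom_chart d'" using p by auto
  note rel = B_mutual[OF d p']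
  have "same_gtan d d' p (K0 d p (K1 d p E)) (K0 d' p (K1 d' p E'))"
    by (rule K_compatible(1)[OF d p' K_compatible(2)[OF d p' same]])
  then show "same_gtan d d' p (- K0 d p (K1 d p E)) (- K0 d' p (K1 d' p E'))"
    by (simp add: same_gtan_iff[OF rel] linear_neg[OF linear_gtan_transport[OF rel]])
qed

lemma involutive_K: "courant_involutive B K0" "courant_involutive B K1"
proof -
  \<comment> \<open>The argument is the same for both structures.\<close>
  have *: "courant_involutive B K"
    if J: "endo_section A J" and inv: "courant_involutive A J"
      and K: "\<And>d c p. d \<in> B \<Longrightarrow> c \<in> A \<Longrightarrow> p \<in> dom_chart d \<Longrightarrow> p \<in> dom_chart c \<Longrightarrow>
          K d p = reduction.induced (tangent_map d c p) (J c p) (core_at d c p)"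
      and red: "\<And>d c p. d \<in> B \<Longrightarrow> c \<in> A \<Longrightarrow> p \<in> dom_chart d \<Longrightarrow> p \<in> dom_chart c \<Longrightarrow>
          reduction (tangent_map d c p) (J c p) (core_at d c p)"
      and J2: "\<And>c p E. c \<in> A \<Longrightarrow> p \<in> dom_chart c \<Longrightarrow> J c p (J c p E) = - E" for J and K :: "('a, 'f) gendo"
    unfolding courant_involutive_def L_bundle_def
  proof (intro ballI allI impI, elim conjE)
    fix d U f g x
    assume d: "d \<in> B" and U: "open U" "U \<subseteq> coord d ` dom_chart d" and f: "smooth_on U f" and g: "smooth_on U g"
      and fg: "\<forall>x\<in>U. f x \<in> minus_i_eigenspace (K d (coord_inv d x)) \<and> g x \<in> minus_i_eigenspace (K d (coord_inv d x))"
      and x: "x \<in> U"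
    obtain c \<iota> where s: "slice d c \<iota>" using slice_exists d by blast
    have c: "c \<in> A" using s by (simp add: slice_def)
    let ?S = "coord d ` dom_chart d" and ?W = "coord c ` dom_chart c"
    obtain R where "kaehler_family \<iota> R ?S (\<lambda>x. J0 c (coord_inv c (\<iota> x))) (\<lambda>x. J1 c (coord_inv c (\<iota> x)))"
      by (rule kaehler_family_slice[OF s])
    then interpret F: kaehler_family \<iota> R ?S "\<lambda>x. J0 c (coord_inv c (\<iota> x))" "\<lambda>x. J1 c (coord_inv c (\<iota> x))" .
    let ?J = "\<lambda>y. J c (coord_inv c y)"
    let ?K = "\<lambda>x. reduction.induced \<iota> (?J (\<iota> x)) (F.core x)"
    have T: "tangent_map d c (coord_inv d x) = \<iota>" if "x \<in> ?S" for x
      using tangent_map_slice[OF s slice_coord_inv(2)[OF s that]] .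
    have K_eq: "K d (coord_inv d x) = ?K x" if "x \<in> ?S" for x
      using K[OF d c slice_coord_inv(2,3)[OF s that]] by (simp add: T[OF that] slice_coord_inv(1)[OF s that])
    have "ccourant f g x \<in> minus_i_eigenspace (?K x)"
    proof (rule F.involutive_induced[where W = ?W and U = U and J = ?J and V = F.core])
      show "open ?W" by (rule open_A_image[OF c])
      show "smooth_family ?W ?J" by (rule smooth_family_ambient[OF J c])
      show "?J y (?J y E) = - E" if y: "y \<in> ?W" for y E
      proof -
        obtain p where p: "y = coord c p" "p \<in> dom_chart c" using y by (elim imageE)
        show ?thesis using J2[OF c p(2)] coord_inv_coord[OF A_inj[OF c] p(2)] by (simp only: p(1))
      qed
      show "ccourant s t y \<in> minus_i_eigenspace (?J y)"
        if "open U'" "U' \<subseteq> ?W" "smooth_on U' s" "smooth_on U' t"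
          "\<And>y. y \<in> U' \<Longrightarrow> s y \<in> minus_i_eigenspace (?J y) \<and> t y \<in> minus_i_eigenspace (?J y)" "y \<in> U'" for U' s t y
        using inv[unfolded courant_involutive_def L_bundle_def, rule_format, OF c, of U' s t y] that by blast
      show "reduction \<iota> (?J (\<iota> x)) (F.core x)" if "\<iota> x \<in> ?W" for x
      proof -
        have xS: "x \<in> ?S" using that slice_image_dom[OF s] by blast
        show ?thesis
          using red[OF d c slice_coord_inv(2,3)[OF s xS]] by (simp add: T[OF xS] slice_coord_inv(1)[OF s xS])
      qed
      show "\<iota> ` U \<subseteq> ?W" using U(2) slice_image_dom[OF s] by blast
      show "smooth_family U (\<lambda>x. reduction.lift \<iota> (F.core x))"
        by (rule smooth_family_subset[OF F.smooth_lift U(2)])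
      show "f x \<in> minus_i_eigenspace (?K x)" "g x \<in> minus_i_eigenspace (?K x)" if "x \<in> U" for x
        using fg[rule_format, OF that] K_eq[of x] U(2) that by (simp_all add: subset_iff)
    qed (fact U(1) f g x)+
    then show "ccourant f g x \<in> minus_i_eigenspace (K d (coord_inv d x))"
      using K_eq[of x] U(2) x by (simp add: subset_iff)
  qed
  have k: "courant_involutive A J0" "courant_involutive A J1" "almost_generalized_complex A J0" "almost_generalized_complex A J1"
    using kaehler unfolding generalized_Kaehler_def generalized_complex_def by blast+
  have sq: "J c p (J c p E) = - E" if "almost_generalized_complex A J" "c \<in> A" "p \<in> dom_chart c" for J c p E
    using conjunct2[OF that(1)[unfolded almost_generalized_complex_def], rule_format, OF that(2,3)] .
  show "courant_involutive B K0"
    by (rule *[of J0 K0, OF sections(1) k(1) K_eq(1) reductions(1) sq[OF k(3)]])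
  show "courant_involutive B K1"
    by (rule *[of J1 K1, OF sections(2) k(2) K_eq(2) reductions(2) sq[OF k(4)]])
qed

lemma kaehler_induced: "generalized_Kaehler B K0 K1"
proof -
  have det: "endo_has_det (K0 d p) 1" "endo_has_det (K1 d p) 1" "endo_has_det (\<lambda>E. - K0 d p (K1 d p E)) 1"
    if "d \<in> B" "p \<in> dom_chart d" for d p
    by (rule endo_has_det_complex_structures[of "K0 d p" "K1 d p", OF K_algebra(1)[OF that] K_algebra(3)[OF that]
          K_algebra(2)[OF that] K_algebra(4)[OF that]])+
  have G2: "- K0 d p (K1 d p (- K0 d p (K1 d p E))) = E" if "d \<in> B" "p \<in> dom_chart d" for d p E
    using that by (simp add: K_algebra linear_neg)
  have Giso: "gpairing (- K0 d p (K1 d p E)) (- K0 d p (K1 d p F)) = gpairing E F" if "d \<in> B" "p \<in> dom_chart d" for d p E F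
    using that by (simp add: K_algebra gpairing_simps)
  have SO: "SO_section B K0" "SO_section B K1"
    unfolding SO_section_def using endo_sections K_algebra(6,7) det by blast+
  have "generalized_complex B K0"
    unfolding generalized_complex_def almost_generalized_complex_def
    by (intro conjI ballI allI SO(1) involutive_K(1) K_algebra(3); assumption)
  moreover have "generalized_complex B K1"
    unfolding generalized_complex_def almost_generalized_complex_def
    by (intro conjI ballI allI SO(2) involutive_K(2) K_algebra(4); assumption)
  moreover have "generalized_metric B (\<lambda>d p E. - K0 d p (K1 d p E))"
    unfolding generalized_metric_def SO_section_def
    by (intro conjI ballI allI impI endo_section_metric Giso det(3) G2 K_algebra(8); assumption)
  ultimately show ?thesis unfolding generalized_Kaehler_def using K_algebra(5) by blast
qed

end

theorem theorem1p9:
  fixes X :: "'a topology" and A :: "('a, 'e::fin_dim_inner) chart set"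
    and M :: "'a set" and B :: "('a, 'f::fin_dim_inner) chart set"
    and J0 J1 :: "('a, 'e) gendo"
    and n m :: nat
  assumes "smooth_manifold X A" and "compact_space X" and "dim (UNIV :: 'e set) = 2 * n"
    and "generalized_Kaehler A J0 J1"
    and "embedded_submanifold X A M B" and "dim (UNIV :: 'f set) = 2 * m"
    and "\<forall>c\<in>A. \<forall>d\<in>B. \<forall>p\<in>dom_chart c \<inter> dom_chart d.
           J0 c p ` conormal d c p = conormal d c p"
  shows "J_submanifold A B J0 \<and> J_submanifold A B J1 \<and>
         generalized_Kaehler B (induced_gendo A J0) (induced_gendo A J1)"
proof -
  interpret kaehler_submanifold X A M B J0 J1
    using assms(1,4,5,7)
    by (intro kaehler_submanifold.intro kaehler_submanifold_axioms.intro submanifold.intro)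
      (simp_all add: conormal_eq)
  show ?thesis using J_submanifolds kaehler_induced by blast
qed

end
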